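(* For each $\varepsilon\in(0,1]$ let $\rho\in H^1(\mathcal{T}\times\mathcal{D})$, $\varphi,j_1,j_2,w\in H^1(\mathcal{T}\times\mathcal{D}\times\Omega^+)$ be the exact solution of the two-dimensional multiscale parity decomposition system described in the context, and let $\rho_\theta,\varphi_\theta,j_{1,\theta},j_{2,\theta},w_\theta$ be neural network approximations. Then $$\mathcal{R}^\varepsilon_{\mathrm{total}}\le\frac{C}{\varepsilon}\,\mathcal{R}^\varepsilon_{\mathrm{APNN}},$$ where the constant $C>0$ is independent of $\varepsilon$.
   Context: $\varepsilon$ is the Knudsen number, $\mathcal{T}=(0,T)$ is a bounded time interval, $\lambda_1,\dots,\lambda_4>0$ are fixed penalty weights. $\mathcal{D}\subset\mathbb{R}^2$ is a bounded rectangle (period cell), $\boldsymbol{x}=(x,y)\in\mathcal{D}$, $\boldsymbol{v}=(\xi,\eta)$, $\Omega^+=\{(\xi,\eta):\xi>0,\eta>0,\xi^2+\eta^2=1\}$ with arc length measure, $\langle g\rangle=\frac2\pi\int_{\Omega^+}g\,\mathrm{d}\boldsymbol{v}$. The radiative transfer equation is $\varepsilon\partial_tf+\boldsymbol{v}\cdot\nabla_{\boldsymbol{x}}f=\frac1\varepsilon(\frac1{2\pi}\int_{|\boldsymbol{v}'|=1}f\,\mathrm{d}\boldsymbol{v}'-f)$, $|\boldsymbol{v}|=1$, with periodic boundary condition in $\boldsymbol{x}$ and initial data $f_{\mathrm{IC}}$. On $\Omega^+$ set $r_1=\frac12[f(\xi,-\eta)+f(-\xi,\eta)]$, $r_2=\frac12[f(\xi,\eta)+f(-\xi,-\eta)]$,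 $j_1=\frac1{2\varepsilon}[f(\xi,-\eta)-f(-\xi,\eta)]$, $j_2=\frac1{2\varepsilon}[f(\xi,\eta)-f(-\xi,-\eta)]$, $\rho=\langle\frac{r_1+r_2}2\rangle$, $\frac{r_1+r_2}2=\rho+\varepsilon^2w$, $\varphi=r_2-r_1$; so on $\Omega^+$, $f=\rho+\frac\varphi2+\varepsilon(\frac{j_2+j_1}2+\frac{j_2-j_1}2)+\varepsilon^2w$. Write $A=\xi\partial_x(j_1+j_2)+\eta\partial_y(j_2-j_1)$. The multiscale parity decomposition system is $$2\partial_t\rho+\langle A\rangle=0,\qquad 2\varepsilon^2\partial_tw+A-\langle A\rangle+2w=0,$$ $$\varepsilon^2\partial_t\varphi+\varepsilon^2\xi\partial_x(j_2-j_1)+\varepsilon^2\eta\partial_y(j_1+j_2)+\varphi=0,$$ $$\varepsilon^2\partial_t(j_1+j_2)+(j_1+j_2)+2\xi\partial_x(\rho+\varepsilon^2w)+\eta\partial_y\varphi=0,$$ $$\varepsilon^2\partial_t(j_2-j_1)+(j_2-j_1)+\xi\partial_x\varphi+2\eta\partial_y(\rho+\varepsilon^2w)=0,$$ with $\langle w\rangle=0$ and periodicity in $\boldsymbol{x}$. Subscripts $\mathrm{IC}$ and $\mathrm{BC}$ denote the initial data (values at $t=0$) and boundary data (values on $\partial\mathcal{D}$) of the exact solution. Neural network approximations are smooth functions of the same variables, depending on trainable parameters $\theta$. Put $f_\theta=\rho_\theta+\frac{\varphi_\theta}2+\varepsilon(\frac{j_{2,\theta}+j_{1,\theta}}2+\frac{j_{2,\theta}-j_{1,\theta}}2)+\varepsilon^2w_\theta$,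 $A_\theta=\xi\partial_x(j_{1,\theta}+j_{2,\theta})+\eta\partial_y(j_{2,\theta}-j_{1,\theta})$ and $d^{(1)}_\theta=2\partial_t\rho_\theta+\langle A_\theta\rangle$, $d^{(2)}_\theta=2\varepsilon^2\partial_tw_\theta+A_\theta-\langle A_\theta\rangle+2w_\theta$, $d^{(3)}_\theta=\partial_t\varphi_\theta+\xi\partial_x(j_{2,\theta}-j_{1,\theta})+\eta\partial_y(j_{1,\theta}+j_{2,\theta})+\frac1{\varepsilon^2}\varphi_\theta$, $d^{(4)}_\theta=\varepsilon^2\partial_t(j_{1,\theta}+j_{2,\theta})+(j_{1,\theta}+j_{2,\theta})+2\xi\partial_x(\rho_\theta+\varepsilon^2w_\theta)+\eta\partial_y\varphi_\theta$, $d^{(5)}_\theta=\varepsilon^2\partial_t(j_{2,\theta}-j_{1,\theta})+(j_{2,\theta}-j_{1,\theta})+\xi\partial_x\varphi_\theta+2\eta\partial_y(\rho_\theta+\varepsilon^2w_\theta)$. Then $\mathcal{R}^\varepsilon_{\mathrm{APNN}}=\mathcal{R}^\varepsilon_{\mathrm{residual}}+\mathcal{R}^\varepsilon_{\mathrm{initial}}+\mathcal{R}^\varepsilon_{\mathrm{boundary}}$ with $$\mathcal{R}^\varepsilon_{\mathrm{residual}}=\tfrac1{|\mathcal{T}\times\mathcal{D}|}\int_{\mathcal{T}}\int_{\mathcal{D}}|d^{(1)}_\theta|^2\mathrm{d}\boldsymbol{x}\mathrm{d}t+\tfrac1{|\mathcal{T}\times\mathcal{D}\times\Omega^+|}\sum_{k=2}^5\int_{\mathcal{T}}\int_{\mathcal{D}}\int_{\Omega^+}|d^{(k)}_\theta|^2\mathrm{d}\boldsymbol{v}\mathrm{d}\boldsymbol{x}\mathrm{d}t,$$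 $$\mathcal{R}^\varepsilon_{\mathrm{initial}}=\tfrac{\lambda_1}{|\mathcal{D}|}\int_{\mathcal{D}}|\rho_\theta-\rho_{\mathrm{IC}}|^2\mathrm{d}\boldsymbol{x}+\tfrac{\lambda_2}{|\mathcal{D}\times\Omega^+|}\int_{\mathcal{D}}\int_{\Omega^+}\big(\varepsilon^4|w_\theta-w_{\mathrm{IC}}|^2+|\varphi_\theta-\varphi_{\mathrm{IC}}|^2+\varepsilon^2|(j_{1,\theta}+j_{2,\theta})-(j_{1,\mathrm{IC}}+j_{2,\mathrm{IC}})|^2+\varepsilon^2|(j_{2,\theta}-j_{1,\theta})-(j_{2,\mathrm{IC}}-j_{1,\mathrm{IC}})|^2\big)\mathrm{d}\boldsymbol{v}\mathrm{d}\boldsymbol{x}\quad(\text{at }t=0),$$ $$\mathcal{R}^\varepsilon_{\mathrm{boundary}}=\tfrac{\lambda_3}{|\mathcal{T}\times\partial\mathcal{D}|}\int_{\mathcal{T}}\int_{\partial\mathcal{D}}|\rho_\theta-\rho_{\mathrm{BC}}|^2\mathrm{d}s\mathrm{d}t+\tfrac{\lambda_4}{|\mathcal{T}\times\partial\mathcal{D}\times\Omega^+|}\int_{\mathcal{T}}\int_{\partial\mathcal{D}}\int_{\Omega^+}\big(|w_\theta-w_{\mathrm{BC}}|^2+|\varphi_\theta-\varphi_{\mathrm{BC}}|^2+|(j_{1,\theta}+j_{2,\theta})-(j_{1,\mathrm{BC}}+j_{2,\mathrm{BC}})|^2+|(j_{2,\theta}-j_{1,\theta})-(j_{2,\mathrm{BC}}-j_{1,\mathrm{BC}})|^2\big)\mathrm{d}\boldsymbol{v}\mathrm{d}s\mathrm{d}t.$$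 The total error is $\mathcal{R}^\varepsilon_{\mathrm{total}}=\|f-f_\theta\|^2_{L^2(\mathcal{T}\times\mathcal{D}\times\Omega^+)}$. The exact solution and the networks may depend on $\varepsilon$. *)

theory Defs
  imports "HOL-Analysis.Analysis"
begin

section \<open>Smooth functions, Sobolev space and boundary values\<close>

definition partial_deriv :: "'a::euclidean_space \<Rightarrow> ('a \<Rightarrow> real) \<Rightarrow> 'a \<Rightarrow> real" where
  "partial_deriv b f x = frechet_derivative f (at x) b"

fun C_k :: "nat \<Rightarrow> ('a::euclidean_space \<Rightarrow> real) \<Rightarrow> bool" where
  "C_k 0 f \<longleftrightarrow> continuous_on UNIV f"
| "C_k (Suc k) f \<longleftrightarrow> f differentiable_on UNIV \<and> (\<forall>b\<in>Basis. C_k k (partial_deriv b f))"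

definition smooth :: "('a::euclidean_space \<Rightarrow> real) \<Rightarrow> bool" where
  "smooth f \<longleftrightarrow> (\<forall>k. C_k k f)"

definition test_function :: "'a::euclidean_space set \<Rightarrow> ('a \<Rightarrow> real) \<Rightarrow> bool" where
  "test_function U \<psi> \<longleftrightarrow> smooth \<psi> \<and> (\<exists>K. compact K \<and> K \<subseteq> U \<and> (\<forall>x. x \<notin> K \<longrightarrow> \<psi> x = 0))"

definition in_L2 :: "'a::euclidean_space set \<Rightarrow> ('a \<Rightarrow> real) \<Rightarrow> bool" where
  "in_L2 U f \<longleftrightarrow> set_borel_measurable lborel U f \<and> set_integrable lborel U (\<lambda>x. (f x)\<^sup>2)"

definition L2_dist_sq :: "'a::euclidean_space set \<Rightarrow> ('a \<Rightarrow> real) \<Rightarrow> ('a \<Rightarrow> real) \<Rightarrow> real" where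
  "L2_dist_sq U f g = (LINT x:U|lborel. (f x - g x)\<^sup>2)"

definition is_weak_deriv ::
  "'a::euclidean_space set \<Rightarrow> 'a \<Rightarrow> ('a \<Rightarrow> real) \<Rightarrow> ('a \<Rightarrow> real) \<Rightarrow> bool" where
  "is_weak_deriv U b f g \<longleftrightarrow> (\<forall>\<psi>. test_function U \<psi> \<longrightarrow>
     (LINT x:U|lborel. f x * partial_deriv b \<psi> x) = - (LINT x:U|lborel. g x * \<psi> x))"

definition in_H1 :: "'a::euclidean_space set \<Rightarrow> ('a \<Rightarrow> real) \<Rightarrow> bool" where
  "in_H1 U f \<longleftrightarrow> in_L2 U f \<and> (\<forall>b\<in>Basis. \<exists>g. in_L2 U g \<and> is_weak_deriv U b f g)"

text \<open>For functions in \<open>H\<^sup>1(U)\<close> the following is determined up to a null set of \<open>U\<close>.\<close>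

definition weak_deriv :: "'a::euclidean_space set \<Rightarrow> 'a \<Rightarrow> ('a \<Rightarrow> real) \<Rightarrow> 'a \<Rightarrow> real" where
  "weak_deriv U b f = (SOME g. in_L2 U g \<and> is_weak_deriv U b f g)"

text \<open>
  Part of the boundary of \<open>U\<close> is given by a list of faces \<open>(F, \<iota>)\<close>, where \<open>\<iota>\<close> embeds the
  parameter domain \<open>F\<close> isometrically into the boundary. The trace operator is the continuous
  extension of the restriction map from smooth functions to \<open>H\<^sup>1(U)\<close>. A function \<open>f\<close> in \<open>H\<^sup>1(U)\<close>
  may be redefined on the boundary, which is a null set; the predicate says that the
  representative \<open>f\<close> is chosen such that its values on the faces are its trace.
\<close>

definition has_trace_values ::
  "'a::euclidean_space set \<Rightarrow> ('b::euclidean_space set \<times> ('b \<Rightarrow> 'a)) list \<Rightarrow> ('a \<Rightarrow> real) \<Rightarrow> bool" where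
  "has_trace_values U \<Gamma> f \<longleftrightarrow>
     (\<forall>(F, \<iota>)\<in>set \<Gamma>. in_L2 F (f \<circ> \<iota>)) \<and>
     (\<exists>u :: nat \<Rightarrow> 'a \<Rightarrow> real.
        (\<forall>n. smooth (u n)) \<and>
        (\<lambda>n. L2_dist_sq U (u n) f) \<longlonglongrightarrow> 0 \<and>
        (\<forall>b\<in>Basis. (\<lambda>n. L2_dist_sq U (partial_deriv b (u n)) (weak_deriv U b f)) \<longlonglongrightarrow> 0) \<and>
        (\<forall>(F, \<iota>)\<in>set \<Gamma>. (\<lambda>n. L2_dist_sq F (u n \<circ> \<iota>) (f \<circ> \<iota>)) \<longlonglongrightarrow> 0))"


section \<open>Geometry\<close>

text \<open>
  The quarter circle \<open>\<Omega>\<^sup>+\<close> is parametrised by arc length, \<open>(\<xi>, \<eta>) = (cos \<alpha>, sin \<alpha>)\<close> with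
  \<open>0 < \<alpha> < \<pi>/2\<close>. Functions of \<open>(t, x, v)\<close> with \<open>v \<in> \<Omega>\<^sup>+\<close> are functions of \<open>(t, x, \<alpha>)\<close>, and
  the arc length measure is Lebesgue measure in \<open>\<alpha>\<close>.
\<close>

definition Omega_plus :: "(real \<times> real) set" where
  "Omega_plus = {(\<xi>, \<eta>). \<xi> > 0 \<and> \<eta> > 0 \<and> \<xi>\<^sup>2 + \<eta>\<^sup>2 = 1}"

definition angles :: "real set" where
  "angles = {0<..<pi/2}"

lemma bij_betw_angles: "bij_betw (\<lambda>\<alpha>. (cos \<alpha>, sin \<alpha>)) angles Omega_plus"
proof (rule bij_betw_imageI)
  show "inj_on (\<lambda>\<alpha>. (cos \<alpha>, sin \<alpha>)) angles"
    by (rule inj_onI) (auto simp: angles_def intro: cos_inj_pi)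
  show "(\<lambda>\<alpha>. (cos \<alpha>, sin \<alpha>)) ` angles = Omega_plus"
  proof (intro equalityI subsetI)
    fix p assume "p \<in> (\<lambda>\<alpha>. (cos \<alpha>, sin \<alpha>)) ` angles"
    then show "p \<in> Omega_plus"
      by (auto simp: angles_def Omega_plus_def cos_gt_zero sin_gt_zero2)
  next
    fix p assume "p \<in> Omega_plus"
    then obtain \<xi> \<eta> where p: "p = (\<xi>, \<eta>)" "\<xi> > 0" "\<eta> > 0" "\<xi>\<^sup>2 + \<eta>\<^sup>2 = 1"
      by (auto simp: Omega_plus_def)
    obtain \<alpha> where a: "0 \<le> \<alpha>" "\<alpha> \<le> pi/2" "\<xi> = cos \<alpha>" "\<eta> = sin \<alpha>"
      using sincos_total_pi_half[of \<xi> \<eta>] p by auto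
    have "\<alpha> \<noteq> 0"
      using a p by auto
    moreover have "\<alpha> \<noteq> pi/2"
      using a p cos_pi_half by (metis less_irrefl)
    ultimately have "\<alpha> \<in> angles"
      using a by (auto simp: angles_def)
    then show "p \<in> (\<lambda>\<alpha>. (cos \<alpha>, sin \<alpha>)) ` angles"
      using a p by auto
  qed
qed

definition vavg :: "(real \<Rightarrow> real) \<Rightarrow> real" where
  "vavg g = 2 / pi * (LINT \<alpha>:angles|lborel. g \<alpha>)"

text \<open>Points \<open>(t, (x, y))\<close> and \<open>(t, (x, y), \<alpha>)\<close>; the rectangle \<open>\<D>\<close> is \<^term>\<open>box a b\<close>.\<close>

type_synonym tx = "real \<times> (real \<times> real)"
type_synonym txv = "real \<times> (real \<times> real) \<times> real"

definition TD :: "real \<Rightarrow> real \<times> real \<Rightarrow> real \<times> real \<Rightarrow> tx set" where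
  "TD T a b = {0<..<T} \<times> box a b"

definition TDV :: "real \<Rightarrow> real \<times> real \<Rightarrow> real \<times> real \<Rightarrow> txv set" where
  "TDV T a b = {0<..<T} \<times> box a b \<times> angles"

type_synonym tx_face = "(real \<times> real) set \<times> (real \<times> real \<Rightarrow> tx)"
type_synonym txv_face = "((real \<times> real) \<times> real) set \<times> ((real \<times> real) \<times> real \<Rightarrow> txv)"

definition initial_face :: "real \<times> real \<Rightarrow> real \<times> real \<Rightarrow> tx_face" where
  "initial_face a b = (box a b, \<lambda>x. (0, x))"

text \<open>The four faces of \<open>(0,T) \<times> \<partial>\<D>\<close>.\<close>

definition lateral_faces :: "real \<Rightarrow> real \<times> real \<Rightarrow> real \<times> real \<Rightarrow> tx_face list" where
  "lateral_faces T a b =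
     [({0<..<T} \<times> {snd a<..<snd b}, \<lambda>(t, s). (t, (fst a, s))),
      ({0<..<T} \<times> {snd a<..<snd b}, \<lambda>(t, s). (t, (fst b, s))),
      ({0<..<T} \<times> {fst a<..<fst b}, \<lambda>(t, s). (t, (s, snd a))),
      ({0<..<T} \<times> {fst a<..<fst b}, \<lambda>(t, s). (t, (s, snd b)))]"

definition with_angle :: "tx_face \<Rightarrow> txv_face" where
  "with_angle \<Phi> = (fst \<Phi> \<times> angles, \<lambda>(q, \<alpha>). (fst (snd \<Phi> q), snd (snd \<Phi> q), \<alpha>))"

definition faces_integral :: "('b::euclidean_space set \<times> ('b \<Rightarrow> 'a)) list \<Rightarrow> ('a \<Rightarrow> real) \<Rightarrow> real" where
  "faces_integral \<Gamma> g = (\<Sum>(F, \<iota>)\<leftarrow>\<Gamma>. LINT q:F|lborel. g (\<iota> q))"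

definition perimeter :: "real \<times> real \<Rightarrow> real \<times> real \<Rightarrow> real" where
  "perimeter a b = 2 * ((fst b - fst a) + (snd b - snd a))"

definition periodic_tx :: "real \<Rightarrow> real \<times> real \<Rightarrow> real \<times> real \<Rightarrow> (tx \<Rightarrow> real) \<Rightarrow> bool" where
  "periodic_tx T a b f \<longleftrightarrow>
     (AE (t, s) in lborel. t \<in> {0<..<T} \<and> s \<in> {snd a<..<snd b} \<longrightarrow>
        f (t, (fst a, s)) = f (t, (fst b, s))) \<and>
     (AE (t, s) in lborel. t \<in> {0<..<T} \<and> s \<in> {fst a<..<fst b} \<longrightarrow>
        f (t, (s, snd a)) = f (t, (s, snd b)))"

definition periodic_txv :: "real \<Rightarrow> real \<times> real \<Rightarrow> real \<times> real \<Rightarrow> (txv \<Rightarrow> real) \<Rightarrow> bool" where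
  "periodic_txv T a b f \<longleftrightarrow>
     (AE (t, s, \<alpha>) in lborel. t \<in> {0<..<T} \<and> s \<in> {snd a<..<snd b} \<and> \<alpha> \<in> angles \<longrightarrow>
        f (t, (fst a, s), \<alpha>) = f (t, (fst b, s), \<alpha>)) \<and>
     (AE (t, s, \<alpha>) in lborel. t \<in> {0<..<T} \<and> s \<in> {fst a<..<fst b} \<and> \<alpha> \<in> angles \<longrightarrow>
        f (t, (s, snd a), \<alpha>) = f (t, (s, snd b), \<alpha>))"


section \<open>The multiscale parity decomposition\<close>

record parity =
  rho_c :: "tx \<Rightarrow> real"
  w_c :: "txv \<Rightarrow> real"
  phi_c :: "txv \<Rightarrow> real"
  j1_c :: "txv \<Rightarrow> real"
  j2_c :: "txv \<Rightarrow> real"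

definition reconstruct :: "real \<Rightarrow> parity \<Rightarrow> txv \<Rightarrow> real" where
  "reconstruct \<epsilon> u = (\<lambda>(t, x, \<alpha>).
     rho_c u (t, x) + phi_c u (t, x, \<alpha>) / 2
     + \<epsilon> * ((j2_c u (t, x, \<alpha>) + j1_c u (t, x, \<alpha>)) / 2 + (j2_c u (t, x, \<alpha>) - j1_c u (t, x, \<alpha>)) / 2)
     + \<epsilon>\<^sup>2 * w_c u (t, x, \<alpha>))"

text \<open>
  The left-hand sides of the system are written for an arbitrary choice \<open>D3\<close>, \<open>D4\<close> of (linear)
  partial differentiation operators on functions of \<open>(t, x)\<close> and \<open>(t, x, \<alpha>)\<close>: weak derivatives
  for the exact solution, classical ones for the networks. Derivatives of sums are expanded by
  linearity.
\<close>

type_synonym D_tx = "tx \<Rightarrow> (tx \<Rightarrow> real) \<Rightarrow> tx \<Rightarrow> real"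
type_synonym D_txv = "txv \<Rightarrow> (txv \<Rightarrow> real) \<Rightarrow> txv \<Rightarrow> real"

abbreviation e_t :: tx where "e_t \<equiv> (1, (0, 0))"
abbreviation e_x :: tx where "e_x \<equiv> (0, (1, 0))"
abbreviation e_y :: tx where "e_y \<equiv> (0, (0, 1))"
abbreviation e_t' :: txv where "e_t' \<equiv> (1, (0, 0), 0)"
abbreviation e_x' :: txv where "e_x' \<equiv> (0, (1, 0), 0)"
abbreviation e_y' :: txv where "e_y' \<equiv> (0, (0, 1), 0)"

definition flux :: "D_txv \<Rightarrow> parity \<Rightarrow> txv \<Rightarrow> real" where
  "flux D4 u = (\<lambda>(t, x, \<alpha>).
     cos \<alpha> * (D4 e_x' (j1_c u) (t, x, \<alpha>) + D4 e_x' (j2_c u) (t, x, \<alpha>))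
     + sin \<alpha> * (D4 e_y' (j2_c u) (t, x, \<alpha>) - D4 e_y' (j1_c u) (t, x, \<alpha>)))"

definition d1 :: "D_tx \<Rightarrow> D_txv \<Rightarrow> parity \<Rightarrow> tx \<Rightarrow> real" where
  "d1 D3 D4 u = (\<lambda>(t, x). 2 * D3 e_t (rho_c u) (t, x) + vavg (\<lambda>\<alpha>. flux D4 u (t, x, \<alpha>)))"

definition d2 :: "real \<Rightarrow> D_txv \<Rightarrow> parity \<Rightarrow> txv \<Rightarrow> real" where
  "d2 \<epsilon> D4 u = (\<lambda>(t, x, \<alpha>).
     2 * \<epsilon>\<^sup>2 * D4 e_t' (w_c u) (t, x, \<alpha>) + flux D4 u (t, x, \<alpha>)
     - vavg (\<lambda>\<beta>. flux D4 u (t, x, \<beta>)) + 2 * w_c u (t, x, \<alpha>))"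

definition d3 :: "real \<Rightarrow> D_txv \<Rightarrow> parity \<Rightarrow> txv \<Rightarrow> real" where
  "d3 \<epsilon> D4 u = (\<lambda>(t, x, \<alpha>).
     D4 e_t' (phi_c u) (t, x, \<alpha>)
     + cos \<alpha> * (D4 e_x' (j2_c u) (t, x, \<alpha>) - D4 e_x' (j1_c u) (t, x, \<alpha>))
     + sin \<alpha> * (D4 e_y' (j1_c u) (t, x, \<alpha>) + D4 e_y' (j2_c u) (t, x, \<alpha>))
     + 1 / \<epsilon>\<^sup>2 * phi_c u (t, x, \<alpha>))"

definition d4 :: "real \<Rightarrow> D_tx \<Rightarrow> D_txv \<Rightarrow> parity \<Rightarrow> txv \<Rightarrow> real" where
  "d4 \<epsilon> D3 D4 u = (\<lambda>(t, x, \<alpha>).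
     \<epsilon>\<^sup>2 * (D4 e_t' (j1_c u) (t, x, \<alpha>) + D4 e_t' (j2_c u) (t, x, \<alpha>))
     + (j1_c u (t, x, \<alpha>) + j2_c u (t, x, \<alpha>))
     + 2 * cos \<alpha> * (D3 e_x (rho_c u) (t, x) + \<epsilon>\<^sup>2 * D4 e_x' (w_c u) (t, x, \<alpha>))
     + sin \<alpha> * D4 e_y' (phi_c u) (t, x, \<alpha>))"

definition d5 :: "real \<Rightarrow> D_tx \<Rightarrow> D_txv \<Rightarrow> parity \<Rightarrow> txv \<Rightarrow> real" where
  "d5 \<epsilon> D3 D4 u = (\<lambda>(t, x, \<alpha>).
     \<epsilon>\<^sup>2 * (D4 e_t' (j2_c u) (t, x, \<alpha>) - D4 e_t' (j1_c u) (t, x, \<alpha>))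
     + (j2_c u (t, x, \<alpha>) - j1_c u (t, x, \<alpha>))
     + cos \<alpha> * D4 e_x' (phi_c u) (t, x, \<alpha>)
     + 2 * sin \<alpha> * (D3 e_y (rho_c u) (t, x) + \<epsilon>\<^sup>2 * D4 e_y' (w_c u) (t, x, \<alpha>)))"

definition solves_system :: "real \<Rightarrow> real \<times> real \<Rightarrow> real \<times> real \<Rightarrow> real \<Rightarrow> parity \<Rightarrow> bool" where
  "solves_system T a b \<epsilon> u \<longleftrightarrow>
     (let D3 = weak_deriv (TD T a b); D4 = weak_deriv (TDV T a b) in
       (AE p in lborel. p \<in> TD T a b \<longrightarrow> d1 D3 D4 u p = 0) \<and>
       (AE z in lborel. z \<in> TDV T a b \<longrightarrow>
          d2 \<epsilon> D4 u z = 0 \<and> \<epsilon>\<^sup>2 * d3 \<epsilon> D4 u z = 0 \<and> d4 \<epsilon> D3 D4 u z = 0 \<and> d5 \<epsilon> D3 D4 u z = 0) \<and>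
       (AE (t, x) in lborel. (t, x) \<in> TD T a b \<longrightarrow> vavg (\<lambda>\<alpha>. w_c u (t, x, \<alpha>)) = 0))"

text \<open>
  Because of the conditions \<^const>\<open>has_trace_values\<close>, the initial and boundary data of an exact
  solution are simply its values at \<open>t = 0\<close> and on \<open>\<partial>\<D>\<close>.
\<close>

definition exact_solution :: "real \<Rightarrow> real \<times> real \<Rightarrow> real \<times> real \<Rightarrow> real \<Rightarrow> parity \<Rightarrow> bool" where
  "exact_solution T a b \<epsilon> u \<longleftrightarrow>
     in_H1 (TD T a b) (rho_c u) \<and>
     has_trace_values (TD T a b) (initial_face a b # lateral_faces T a b) (rho_c u) \<and>
     periodic_tx T a b (rho_c u) \<and>
     (\<forall>g \<in> {w_c u, phi_c u, j1_c u, j2_c u}.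
        in_H1 (TDV T a b) g \<and>
        has_trace_values (TDV T a b) (map with_angle (initial_face a b # lateral_faces T a b)) g \<and>
        periodic_txv T a b g) \<and>
     solves_system T a b \<epsilon> u"

definition network :: "parity \<Rightarrow> bool" where
  "network v \<longleftrightarrow> smooth (rho_c v) \<and> smooth (w_c v) \<and> smooth (phi_c v) \<and> smooth (j1_c v) \<and> smooth (j2_c v)"


section \<open>Risk functionals\<close>

definition R_residual :: "real \<Rightarrow> real \<times> real \<Rightarrow> real \<times> real \<Rightarrow> real \<Rightarrow> parity \<Rightarrow> real" where
  "R_residual T a b \<epsilon> v =
     1 / measure lborel (TD T a b) *
       (LINT p:TD T a b|lborel. \<bar>d1 partial_deriv partial_deriv v p\<bar>\<^sup>2)
     + 1 / measure lborel (TDV T a b) *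
       ((LINT z:TDV T a b|lborel. \<bar>d2 \<epsilon> partial_deriv v z\<bar>\<^sup>2)
        + (LINT z:TDV T a b|lborel. \<bar>d3 \<epsilon> partial_deriv v z\<bar>\<^sup>2)
        + (LINT z:TDV T a b|lborel. \<bar>d4 \<epsilon> partial_deriv partial_deriv v z\<bar>\<^sup>2)
        + (LINT z:TDV T a b|lborel. \<bar>d5 \<epsilon> partial_deriv partial_deriv v z\<bar>\<^sup>2))"

definition R_initial ::
  "real \<times> real \<Rightarrow> real \<times> real \<Rightarrow> real \<Rightarrow> real \<Rightarrow> real \<Rightarrow> parity \<Rightarrow> parity \<Rightarrow> real" where
  "R_initial a b lam1 lam2 \<epsilon> u v =
     lam1 / measure lborel (box a b) *
       (LINT x:box a b|lborel. \<bar>rho_c v (0, x) - rho_c u (0, x)\<bar>\<^sup>2)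
     + lam2 / measure lborel (box a b \<times> angles) *
       (LINT (x, \<alpha>):box a b \<times> angles|lborel.
            \<epsilon>^4 * \<bar>w_c v (0, x, \<alpha>) - w_c u (0, x, \<alpha>)\<bar>\<^sup>2
          + \<bar>phi_c v (0, x, \<alpha>) - phi_c u (0, x, \<alpha>)\<bar>\<^sup>2
          + \<epsilon>\<^sup>2 * \<bar>(j1_c v (0, x, \<alpha>) + j2_c v (0, x, \<alpha>)) - (j1_c u (0, x, \<alpha>) + j2_c u (0, x, \<alpha>))\<bar>\<^sup>2
          + \<epsilon>\<^sup>2 * \<bar>(j2_c v (0, x, \<alpha>) - j1_c v (0, x, \<alpha>)) - (j2_c u (0, x, \<alpha>) - j1_c u (0, x, \<alpha>))\<bar>\<^sup>2)"

text \<open>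
  The normalisations are \<open>|(0,T) \<times> \<partial>\<D>|\<close> and \<open>|(0,T) \<times> \<partial>\<D> \<times> \<Omega>\<^sup>+|\<close>; the former is \<open>T\<close> times the
  perimeter of \<open>\<D>\<close>.
\<close>

definition R_boundary ::
  "real \<Rightarrow> real \<times> real \<Rightarrow> real \<times> real \<Rightarrow> real \<Rightarrow> real \<Rightarrow> parity \<Rightarrow> parity \<Rightarrow> real" where
  "R_boundary T a b lam3 lam4 u v =
     lam3 / (T * perimeter a b) *
       faces_integral (lateral_faces T a b) (\<lambda>p. \<bar>rho_c v p - rho_c u p\<bar>\<^sup>2)
     + lam4 / (T * perimeter a b * measure lborel angles) *
       faces_integral (map with_angle (lateral_faces T a b))
         (\<lambda>z. \<bar>w_c v z - w_c u z\<bar>\<^sup>2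
            + \<bar>phi_c v z - phi_c u z\<bar>\<^sup>2
            + \<bar>(j1_c v z + j2_c v z) - (j1_c u z + j2_c u z)\<bar>\<^sup>2
            + \<bar>(j2_c v z - j1_c v z) - (j2_c u z - j1_c u z)\<bar>\<^sup>2)"

definition R_APNN ::
  "real \<Rightarrow> real \<times> real \<Rightarrow> real \<times> real \<Rightarrow> real \<Rightarrow> real \<Rightarrow> real \<Rightarrow> real \<Rightarrow> real \<Rightarrow> parity \<Rightarrow> parity \<Rightarrow> real" where
  "R_APNN T a b lam1 lam2 lam3 lam4 \<epsilon> u v =
     R_residual T a b \<epsilon> v + R_initial a b lam1 lam2 \<epsilon> u v + R_boundary T a b lam3 lam4 u v"

definition R_total :: "real \<Rightarrow> real \<times> real \<Rightarrow> real \<times> real \<Rightarrow> real \<Rightarrow> parity \<Rightarrow> parity \<Rightarrow> real" where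
  "R_total T a b \<epsilon> u v = L2_dist_sq (TDV T a b) (reconstruct \<epsilon> u) (reconstruct \<epsilon> v)"

end

theory Submission
  imports Defs
begin

text \<open>
  The estimate is linear in the error, so it is proved first for a smooth parity tuple with
  arbitrary residuals, initial and boundary values, and then transferred to the difference of the
  network and smooth approximations of the exact solution, whose residuals tend to \<open>0\<close> in \<open>L\<^sup>2\<close>.

  For smooth tuples put \<open>r = \<rho> + \<epsilon>\<^sup>2 w\<close>, \<open>P = j\<^sub>1 + j\<^sub>2\<close>, \<open>M = j\<^sub>2 - j\<^sub>1\<close>. The system is symmetrised by the
  energy density \<open>e = 2 r\<^sup>2 + (\<phi>\<^sup>2 + \<epsilon>\<^sup>2 P\<^sup>2 + \<epsilon>\<^sup>2 M\<^sup>2) / 2\<close>; the fluxes \<open>\<xi> (2 r P + \<phi> M)\<close> and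
  \<open>\<eta> (2 r M + \<phi> P)\<close> only contribute boundary terms. The one term without a sign is \<open>\<rho> \<langle>w\<rangle>\<close>, because
  the mean of \<open>w\<close> need not vanish for a network. It solves \<open>2 \<epsilon>\<^sup>2 \<partial>\<^sub>t \<langle>w\<rangle> + 2 \<langle>w\<rangle> = \<langle>d\<^sub>2\<rangle>\<close>, hence consists of
  an initial layer of size \<open>\<kappa>(t) = exp (- t / \<epsilon>\<^sup>2)\<close> and of a part controlled by the residual. The time
  weight \<open>exp (\<kappa>(t) - 1 - 3 t)\<close>, which is bounded below uniformly in \<open>\<epsilon>\<close>, turns the layer into an
  absorbable term. Integrating the weighted energy identity once over the whole space-time domain
  gives the bound, in fact without the factor \<open>1 / \<epsilon>\<close>.
\<close>

section \<open>Convergence in \<open>L\<^sup>2\<close>\<close>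

text \<open>The obstacle is a power of \<epsilon>. The initial risk controls only \<epsilon>^4 w^2,
  so the mean W of w may start at size 1 / \<epsilon>^2 and then decay like \<kappa>. Young's
  inequality for r W with fixed weights leaves the time integral of \<kappa>^2 W(0)^2, which is of
  order \<epsilon>^2 W(0)^2 and too large by 1 / \<epsilon>^2. With the weight 1 + \<kappa> /
  \<epsilon>^2 on r^2, the remainder is D W^2 with D = 1 / (1 + \<kappa> / \<epsilon>^2); since D
  \<kappa>^2 \<le> \<epsilon>^2 \<kappa>, its integral over the layer is of order \<epsilon>^4
  W(0)^2, exactly what is available. The price (\<kappa> / \<epsilon>^2) r^2 is paid by
  differentiating exp \<kappa>, as \<kappa>' = - \<kappa> / \<epsilon>^2; because \<kappa> stays in
  (0, 1], this part of the weight varies by at most a factor e. The rate 3 in the weight is spent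
  evenly: one E is the damping that survives, one covers r d1 + r d2, one the constant part of the
  weight on r^2. The variable r arises because the mean flux cancels in d1 + d2.\<close>

definition L2_sq :: "'a::euclidean_space set \<Rightarrow> ('a \<Rightarrow> real) \<Rightarrow> real" where
  "L2_sq U f = (LINT x:U|lborel. (f x)\<^sup>2)"

lemma L2_dist_sq_eq: "L2_dist_sq U f g = L2_sq U (\<lambda>x. f x - g x)"
  by (simp add: L2_dist_sq_def L2_sq_def)

text \<open>Extension by zero: with the indicator as a factor, membership becomes a statement about
  one function on the whole space, to which the lemmas on plain Bochner integrals apply.\<close>

lemma in_L2_iff:
  "in_L2 U f \<longleftrightarrow> (\<lambda>x. indicator U x * f x) \<in> borel_measurable borel \<and>
     integrable lborel (\<lambda>x. (indicator U x * f x)\<^sup>2)"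
proof -
  have "(\<lambda>x. (indicator U x * f x)\<^sup>2) = (\<lambda>x. indicator U x *\<^sub>R (f x)\<^sup>2)"
    by (auto simp: indicator_def fun_eq_iff)
  then show ?thesis
    by (simp add: in_L2_def set_borel_measurable_def set_integrable_def)
qed

lemma L2_sq_alt: "L2_sq U f = (LINT x|lborel. (indicator U x * f x)\<^sup>2)"
  unfolding L2_sq_def set_lebesgue_integral_def
  by (intro Bochner_Integration.integral_cong) (auto simp: indicator_def)

lemma L2_sq_nonneg: "0 \<le> L2_sq U f"
  by (simp add: L2_sq_alt)

lemma in_L2_add:
  assumes f: "in_L2 U f" and g: "in_L2 U g"
  shows "in_L2 U (\<lambda>x. f x + g x)"
    and "L2_sq U (\<lambda>x. f x + g x) \<le> 2 * L2_sq U f + 2 * L2_sq U g"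
proof -
  let ?F = "\<lambda>x. indicator U x * f x" and ?G = "\<lambda>x. indicator U x * g x"
  have eq: "indicator U x * (f x + g x) = ?F x + ?G x" for x
    by (simp add: distrib_left)
  have le: "(s + t)\<^sup>2 \<le> 2 * s\<^sup>2 + 2 * t\<^sup>2" for s t :: real
    using zero_le_power2[of "s - t"] by (simp add: power2_diff power2_sum)
  have int: "integrable lborel (\<lambda>x. 2 * (?F x)\<^sup>2 + 2 * (?G x)\<^sup>2)"
    using f g by (auto simp: in_L2_iff)
  have meas: "?F \<in> borel_measurable borel" "?G \<in> borel_measurable borel"
    using f g by (auto simp: in_L2_iff)
  have int': "integrable lborel (\<lambda>x. (?F x + ?G x)\<^sup>2)"
    by (rule Bochner_Integration.integrable_bound[OF int]) (use meas le in \<open>auto\<close>)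
  then show "in_L2 U (\<lambda>x. f x + g x)"
    unfolding in_L2_iff eq using meas by auto
  have "L2_sq U (\<lambda>x. f x + g x) \<le> (LINT x|lborel. 2 * (?F x)\<^sup>2 + 2 * (?G x)\<^sup>2)"
    unfolding L2_sq_alt eq using int int' le by (intro integral_mono) auto
  also have "\<dots> = 2 * L2_sq U f + 2 * L2_sq U g"
    unfolding L2_sq_alt using f g by (subst Bochner_Integration.integral_add) (auto simp: in_L2_iff)
  finally show "L2_sq U (\<lambda>x. f x + g x) \<le> 2 * L2_sq U f + 2 * L2_sq U g" .
qed

lemma in_L2_bounded_mult:
  assumes f: "in_L2 U f" and c: "c \<in> borel_measurable borel" and B: "\<And>x. x \<in> U \<Longrightarrow> \<bar>c x\<bar> \<le> B"
  shows "in_L2 U (\<lambda>x. c x * f x)"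
    and "L2_sq U (\<lambda>x. c x * f x) \<le> B\<^sup>2 * L2_sq U f"
proof -
  let ?F = "\<lambda>x. indicator U x * f x"
  have eq: "indicator U x * (c x * f x) = c x * ?F x" for x
    by simp
  have le: "(c x * ?F x)\<^sup>2 \<le> B\<^sup>2 * (?F x)\<^sup>2" for x
  proof (cases "x \<in> U")
    case True
    then have "(c x)\<^sup>2 \<le> B\<^sup>2"
      using B[of x] by (simp add: abs_le_square_iff[symmetric])
    then show ?thesis
      by (simp add: power_mult_distrib mult_right_mono)
  qed auto
  have meas: "?F \<in> borel_measurable borel" and int: "integrable lborel (\<lambda>x. B\<^sup>2 * (?F x)\<^sup>2)"
    using f by (auto simp: in_L2_iff)
  have int': "integrable lborel (\<lambda>x. (c x * ?F x)\<^sup>2)"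
  proof (rule Bochner_Integration.integrable_bound[OF int])
    show "(\<lambda>x. (c x * ?F x)\<^sup>2) \<in> borel_measurable lborel"
      using meas c by simp
    show "AE x in lborel. norm ((c x * ?F x)\<^sup>2) \<le> norm (B\<^sup>2 * (?F x)\<^sup>2)"
      using le by (auto intro: abs_of_nonneg)
  qed
  then show "in_L2 U (\<lambda>x. c x * f x)"
    unfolding in_L2_iff eq using meas c by auto
  show "L2_sq U (\<lambda>x. c x * f x) \<le> B\<^sup>2 * L2_sq U f"
    unfolding L2_sq_alt eq using int int' le
    by (subst integral_mult_right_zero[symmetric]) (intro integral_mono, auto)
qed

lemma in_L2_cmult:
  assumes "in_L2 U f" shows "in_L2 U (\<lambda>x. c * f x)" "L2_sq U (\<lambda>x. c * f x) = c\<^sup>2 * L2_sq U f"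
  using in_L2_bounded_mult(1)[OF assms, of "\<lambda>_. c" "\<bar>c\<bar>"]
  by (auto simp: L2_sq_def power_mult_distrib)

lemma in_L2_diff:
  assumes "in_L2 U f" "in_L2 U g"
  shows "in_L2 U (\<lambda>x. f x - g x)" "L2_sq U (\<lambda>x. f x - g x) \<le> 2 * L2_sq U f + 2 * L2_sq U g"
  using in_L2_add[OF assms(1) in_L2_cmult(1)[OF assms(2), of "-1"]] in_L2_cmult(2)[OF assms(2), of "-1"]
  by simp_all

text \<open>Membership of all terms is part of the notion because the integral of a non-integrable
  function is 0 by convention, so a vanishing \<open>L2_sq\<close> alone would say nothing.\<close>

definition L2_tendsto :: "'a::euclidean_space set \<Rightarrow> (nat \<Rightarrow> 'a \<Rightarrow> real) \<Rightarrow> ('a \<Rightarrow> real) \<Rightarrow> bool" where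
  "L2_tendsto U F f \<longleftrightarrow>
     (\<forall>n. in_L2 U (F n)) \<and> in_L2 U f \<and> (\<lambda>n. L2_sq U (\<lambda>x. F n x - f x)) \<longlonglongrightarrow> 0"

lemma L2_tendstoI:
  assumes "\<And>n. in_L2 U (F n)" "in_L2 U f"
    and "\<And>n. L2_sq U (\<lambda>x. F n x - f x) \<le> X n" "X \<longlonglongrightarrow> 0"
  shows "L2_tendsto U F f"
  unfolding L2_tendsto_def
  using assms by (auto intro!: tendsto_sandwich[OF _ _ tendsto_const assms(4)] simp: L2_sq_nonneg)

lemma L2_tendsto_add:
  assumes "L2_tendsto U F f" "L2_tendsto U G g"
  shows "L2_tendsto U (\<lambda>n x. F n x + G n x) (\<lambda>x. f x + g x)"
proof (rule L2_tendstoI)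
  fix n
  show "L2_sq U (\<lambda>x. F n x + G n x - (f x + g x)) \<le>
      2 * L2_sq U (\<lambda>x. F n x - f x) + 2 * L2_sq U (\<lambda>x. G n x - g x)"
    using in_L2_add(2)[of U "\<lambda>x. F n x - f x" "\<lambda>x. G n x - g x"] assms
    by (simp add: L2_tendsto_def in_L2_diff algebra_simps)
  show "(\<lambda>n. 2 * L2_sq U (\<lambda>x. F n x - f x) + 2 * L2_sq U (\<lambda>x. G n x - g x)) \<longlonglongrightarrow> 0"
    using assms unfolding L2_tendsto_def by (auto intro!: tendsto_eq_intros)
qed (use assms in \<open>auto simp: L2_tendsto_def in_L2_add\<close>)

lemma L2_tendsto_bounded_mult:
  assumes "L2_tendsto U F f" "c \<in> borel_measurable borel" "\<And>x. x \<in> U \<Longrightarrow> \<bar>c x\<bar> \<le> B"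
  shows "L2_tendsto U (\<lambda>n x. c x * F n x) (\<lambda>x. c x * f x)"
proof (rule L2_tendstoI)
  fix n
  show "L2_sq U (\<lambda>x. c x * F n x - c x * f x) \<le> B\<^sup>2 * L2_sq U (\<lambda>x. F n x - f x)"
    using in_L2_bounded_mult(2)[of U "\<lambda>x. F n x - f x" c B] assms
    by (simp add: L2_tendsto_def in_L2_diff right_diff_distrib)
  show "(\<lambda>n. B\<^sup>2 * L2_sq U (\<lambda>x. F n x - f x)) \<longlonglongrightarrow> 0"
    using assms unfolding L2_tendsto_def by (auto intro!: tendsto_eq_intros)
qed (use assms in \<open>auto simp: L2_tendsto_def intro: in_L2_bounded_mult(1)\<close>)

lemma L2_tendsto_cmult:
  "L2_tendsto U F f \<Longrightarrow> L2_tendsto U (\<lambda>n x. c * F n x) (\<lambda>x. c * f x)"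
  by (rule L2_tendsto_bounded_mult[where B = "\<bar>c\<bar>"]) auto

lemma L2_tendsto_diff:
  assumes "L2_tendsto U F f" "L2_tendsto U G g"
  shows "L2_tendsto U (\<lambda>n x. F n x - G n x) (\<lambda>x. f x - g x)"
  using L2_tendsto_add[OF assms(1) L2_tendsto_cmult[OF assms(2), of "-1"]] by simp

text \<open>Cauchy-Schwarz against the constant 1 on each section, then Fubini. Square integrability
  on the product passes to sections only for almost every x, which is harmless since the claims do
  not see null sets.\<close>

lemma in_L2_integral:
  fixes f :: "'a::euclidean_space \<times> 'b::euclidean_space \<Rightarrow> real"
  assumes f: "in_L2 (U \<times> V) f" and U: "U \<in> sets borel" and V: "V \<in> sets borel" "emeasure lborel V < \<infinity>"
  shows "AE x in lborel. x \<in> U \<longrightarrow> set_integrable lborel V (\<lambda>y. f (x, y))"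
    and "in_L2 U (\<lambda>x. LINT y:V|lborel. f (x, y))"
    and "L2_sq U (\<lambda>x. LINT y:V|lborel. f (x, y)) \<le> measure lborel V * L2_sq (U \<times> V) f"
proof -
  let ?F = "\<lambda>x y. indicator (U \<times> V) (x, y) * f (x, y)"
  have eq: "?F x y = indicator U x * (indicator V y * f (x, y))" for x y
    by (auto simp: indicator_def)
  have m: "(\<lambda>z. indicator (U \<times> V) z * f z) \<in> borel_measurable (lborel \<Otimes>\<^sub>M lborel)"
    using f by (simp add: in_L2_iff lborel_prod)
  have "integrable (lborel \<Otimes>\<^sub>M lborel) (\<lambda>z. (indicator (U \<times> V) z * f z)\<^sup>2)"
    using f by (simp add: in_L2_iff lborel_prod)
  then have int: "integrable (lborel \<Otimes>\<^sub>M lborel) (case_prod (\<lambda>x y. (?F x y)\<^sup>2))"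
    by (simp add: case_prod_beta')
  have m': "(\<lambda>y. ?F x y) \<in> borel_measurable lborel" for x
    using measurable_compose[OF measurable_Pair1'[of x lborel lborel] m] by simp
  have ae: "AE x in lborel. integrable lborel (\<lambda>y. (?F x y)\<^sup>2)"
    using lborel_pair.AE_integrable_fst[OF int] by simp
  have intV: "integrable lborel (indicator V :: 'b \<Rightarrow> real)"
    using V by simp
  have sec: "integrable lborel (\<lambda>y. ?F x y) \<and>
      (LINT y|lborel. ?F x y)\<^sup>2 \<le> measure lborel V * (LINT y|lborel. (?F x y)\<^sup>2)"
    if i: "integrable lborel (\<lambda>y. (?F x y)\<^sup>2)" for x
  proof -
    have i1: "integrable lborel (\<lambda>y. ?F x y)"
    proof (rule Bochner_Integration.integrable_bound)
      show "integrable lborel (\<lambda>y. indicator V y + (?F x y)\<^sup>2)"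
        using intV i by simp
      have "\<bar>s\<bar> \<le> 1 + s\<^sup>2" for s :: real
        using zero_le_power2[of "\<bar>s\<bar> - 1"] zero_le_power2[of s] by (simp add: power2_diff)
      then show "AE y in lborel. norm (?F x y) \<le> norm (indicator V y + (?F x y)\<^sup>2)"
        by (auto simp: indicator_def abs_of_nonneg)
    qed (rule m')
    let ?m = "measure lborel V" and ?I = "LINT y|lborel. ?F x y"
    \<comment> \<open>The variance of \<open>?F x\<close> around its mean on V, scaled by the
      measure \<open>?m\<close> to avoid a division; expanding it gives \<open>?m\<close> times the
      gap in Cauchy-Schwarz.\<close>
    have "0 \<le> (LINT y|lborel. (?m * ?F x y - indicator V y * ?I)\<^sup>2)"
      by simp
    also have "\<dots> = (LINT y|lborel. ?m\<^sup>2 * (?F x y)\<^sup>2 - 2 * ?m * ?I * ?F x y + ?I\<^sup>2 * indicator V y)"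
      by (intro Bochner_Integration.integral_cong)
        (auto simp: indicator_def power2_diff power_mult_distrib)
    also have "\<dots> = ?m\<^sup>2 * (LINT y|lborel. (?F x y)\<^sup>2) - 2 * ?m * ?I * ?I + ?I\<^sup>2 * ?m"
      using i i1 intV by simp
    finally have *: "0 \<le> ?m * (?m * (LINT y|lborel. (?F x y)\<^sup>2) - ?I\<^sup>2)"
      by (simp add: algebra_simps power2_eq_square)
    have "?I\<^sup>2 \<le> ?m * (LINT y|lborel. (?F x y)\<^sup>2)"
    proof (cases "?m = 0")
      case True
      then have "emeasure lborel V = 0"
        using V by (simp add: emeasure_eq_ennreal_measure less_top)
      then have "V \<in> null_sets lborel"
        using V by auto
      then have "AE y in lborel. ?F x y = 0"
        by (auto dest: AE_not_in elim!: eventually_mono simp: indicator_def)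
      then have "?I = 0"
        by (rule integral_eq_zero_AE)
      then show ?thesis using True by simp
    next
      case False
      then have "0 < ?m" by (simp add: zero_less_measure_iff)
      with * show ?thesis by (simp add: zero_le_mult_iff)
    qed
    with i1 show ?thesis by simp
  qed
  show "AE x in lborel. x \<in> U \<longrightarrow> set_integrable lborel V (\<lambda>y. f (x, y))"
    using ae
  proof eventually_elim
    fix x assume "integrable lborel (\<lambda>y. (?F x y)\<^sup>2)"
    from sec[OF this] show "x \<in> U \<longrightarrow> set_integrable lborel V (\<lambda>y. f (x, y))"
      unfolding eq by (auto simp: set_integrable_def)
  qed
  have ieq: "indicator U x * (LINT y:V|lborel. f (x, y)) = (LINT y|lborel. ?F x y)" for x
    by (auto simp: set_lebesgue_integral_def indicator_def)
  have mI: "(\<lambda>x. LINT y|lborel. ?F x y) \<in> borel_measurable lborel"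
    using m by (intro lborel.borel_measurable_lebesgue_integral) (simp add: case_prod_beta')
  have intI: "integrable lborel (\<lambda>x. measure lborel V * (LINT y|lborel. (?F x y)\<^sup>2))"
    using lborel_pair.integrable_fst[OF int] by simp
  have aeI: "AE x in lborel. (LINT y|lborel. ?F x y)\<^sup>2 \<le> measure lborel V * (LINT y|lborel. (?F x y)\<^sup>2)"
    using ae by eventually_elim (use sec in blast)
  have intI': "integrable lborel (\<lambda>x. (LINT y|lborel. ?F x y)\<^sup>2)"
    by (rule Bochner_Integration.integrable_bound[OF intI]) (use mI aeI in \<open>auto elim!: eventually_mono\<close>)
  show "in_L2 U (\<lambda>x. LINT y:V|lborel. f (x, y))"
    unfolding in_L2_iff ieq using mI intI' by simp
  have "L2_sq U (\<lambda>x. LINT y:V|lborel. f (x, y)) \<le> (LINT x|lborel. measure lborel V * (LINT y|lborel. (?F x y)\<^sup>2))"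
    unfolding L2_sq_alt ieq using intI intI' aeI by (intro integral_mono_AE) auto
  also have "\<dots> = measure lborel V * L2_sq (U \<times> V) f"
    using lborel_pair.integral_fst[OF int]
    by (simp add: L2_sq_alt lborel_prod case_prod_beta')
  finally show "L2_sq U (\<lambda>x. LINT y:V|lborel. f (x, y)) \<le> measure lborel V * L2_sq (U \<times> V) f" .
qed

lemma in_L2_fst:
  fixes f :: "'a::euclidean_space \<Rightarrow> real" and V :: "'b::euclidean_space set"
  assumes f: "in_L2 U f" and V: "V \<in> sets borel" "emeasure lborel V < \<infinity>"
  shows "in_L2 (U \<times> V) (\<lambda>z. f (fst z))"
    and "L2_sq (U \<times> V) (\<lambda>z. f (fst z)) = measure lborel V * L2_sq U f"
proof -
  let ?F = "\<lambda>x. indicator U x * f x"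
  have eq: "indicator (U \<times> V) z * f (fst z) = ?F (fst z) * indicator V (snd z)" for z
    by (cases z) (auto simp: indicator_def)
  have eq2: "(?F (fst z) * indicator V (snd z))\<^sup>2 = (?F (fst z))\<^sup>2 * indicator V (snd z)" for z
    by (auto simp: indicator_def)
  have m: "?F \<in> borel_measurable borel" and i: "integrable lborel (\<lambda>x. (?F x)\<^sup>2)"
    using f by (auto simp: in_L2_iff)
  have iV: "integrable lborel (indicator V :: 'b \<Rightarrow> real)"
    using V by simp
  have I: "integrable (lborel \<Otimes>\<^sub>M lborel) (\<lambda>(x, y). (?F x)\<^sup>2 * indicator V y :: real)"
  proof (rule lborel_pair.Fubini_integrable)
    show "(\<lambda>(x, y). (?F x)\<^sup>2 * indicator V y :: real) \<in> borel_measurable (lborel \<Otimes>\<^sub>M lborel)"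
      using m V by simp
    show "integrable lborel (\<lambda>x. LINT y|lborel. norm ((\<lambda>(x, y). (?F x)\<^sup>2 * indicator V y :: real) (x, y)))"
      using i V by (simp add: abs_mult)
    show "AE x in lborel. integrable lborel (\<lambda>y. (\<lambda>(x, y). (?F x)\<^sup>2 * indicator V y :: real) (x, y))"
      using iV by simp
  qed
  show "in_L2 (U \<times> V) (\<lambda>z. f (fst z))"
    unfolding in_L2_iff eq eq2
  proof
    show "(\<lambda>z. ?F (fst z) * indicator V (snd z)) \<in> borel_measurable (borel :: ('a \<times> 'b) measure)"
      using V m by (auto simp: borel_prod[symmetric])
    show "integrable lborel (\<lambda>z. (?F (fst z))\<^sup>2 * indicator V (snd z) :: real)"
      using I by (simp add: lborel_prod case_prod_beta')
  qed
  show "L2_sq (U \<times> V) (\<lambda>z. f (fst z)) = measure lborel V * L2_sq U f"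
    unfolding L2_sq_alt eq eq2
    using lborel_pair.integral_fst[OF I] V
    by (simp add: lborel_prod case_prod_beta' mult.commute)
qed

section \<open>Integration over products\<close>

lemma set_integrable_continuous:
  fixes f :: "'a::euclidean_space \<Rightarrow> real"
  assumes "continuous_on UNIV f" "bounded U" "U \<in> sets borel"
  shows "set_integrable lborel U f"
proof (rule set_integrable_subset)
  show "set_integrable lborel (closure U) f"
    unfolding set_integrable_def using assms
    by (intro borel_integrable_compact) (auto intro: continuous_on_subset)
qed (use assms closure_subset in auto)

lemma in_L2_continuous:
  fixes f :: "'a::euclidean_space \<Rightarrow> real"
  assumes f: "continuous_on UNIV f" and U: "bounded U" "U \<in> sets borel"
  shows "in_L2 U f"
proof -
  have "set_integrable lborel U (\<lambda>x. (f x)\<^sup>2)"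
    using assms by (intro set_integrable_continuous continuous_intros)
  moreover have "f \<in> borel_measurable borel"
    using f by (rule borel_measurable_continuous_onI)
  ultimately show ?thesis
    using U by (simp add: in_L2_def set_borel_measurable_def)
qed

text \<open>Fubini with the first variable innermost reduces this to the one-dimensional theorem on
  each line. Continuity on the whole space and boundedness of \<open>B\<close> supply every
  integrability condition.\<close>

lemma integral_Times_FTC:
  fixes F G :: "real \<times> 'b::euclidean_space \<Rightarrow> real"
  assumes "l \<le> u" and B: "bounded B" "B \<in> sets borel"
    and F: "continuous_on UNIV F" and G: "continuous_on UNIV G"
    and deriv: "\<And>s w. ((\<lambda>s. F (s, w)) has_real_derivative G (s, w)) (at s)"
  shows "(LINT z:{l<..<u} \<times> B|lborel. G z) = (LINT w:B|lborel. F (u, w)) - (LINT w:B|lborel. F (l, w))"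
proof -
  have inner: "(LINT s|lborel. indicator ({l<..<u} \<times> B) (s, w) *\<^sub>R G (s, w)) = indicator B w *\<^sub>R (F (u, w) - F (l, w))" for w
  proof -
    have cont: "continuous_on UNIV (\<lambda>s. G (s, w))"
      by (rule continuous_on_compose2[OF G]) (auto intro!: continuous_intros)
    have "(LINT s:{l<..<u}|lborel. G (s, w)) = integral {l<..<u} (\<lambda>s. G (s, w))"
      using cont by (intro set_borel_integral_eq_integral set_integrable_continuous) auto
    also have "\<dots> = integral {l..u} (\<lambda>s. G (s, w))"
      by (simp add: integral_open_interval_real)
    also have "\<dots> = F (u, w) - F (l, w)"
    proof (intro integral_unique fundamental_theorem_of_calculus)
      fix s
      show "((\<lambda>s. F (s, w)) has_vector_derivative G (s, w)) (at s within {l..u})"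
        using deriv[of w s] by (simp add: has_real_derivative_iff_has_vector_derivative has_vector_derivative_at_within)
    qed fact
    finally show ?thesis
      by (cases "w \<in> B") (auto simp: set_lebesgue_integral_def indicator_def)
  qed
  have int: "set_integrable lborel ({l<..<u} \<times> B) G"
    using B G by (intro set_integrable_continuous bounded_Times) (auto simp: borel_Times)
  then have int': "integrable (lborel \<Otimes>\<^sub>M lborel) (\<lambda>(s, w). indicator ({l<..<u} \<times> B) (s, w) *\<^sub>R G (s, w))"
    by (simp add: set_integrable_def lborel_prod case_prod_beta')
  have "(LINT z:{l<..<u} \<times> B|lborel. G z) =
      (LINT w|lborel. LINT s|lborel. indicator ({l<..<u} \<times> B) (s, w) *\<^sub>R G (s, w))"
    using lborel_pair.integral_snd[OF int']
    by (simp add: set_lebesgue_integral_def lborel_prod case_prod_beta')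
  also have "\<dots> = (LINT w:B|lborel. F (u, w) - F (l, w))"
    unfolding inner by (simp add: set_lebesgue_integral_def)
  also have "\<dots> = (LINT w:B|lborel. F (u, w)) - (LINT w:B|lborel. F (l, w))"
    using B by (intro set_integral_diff set_integrable_continuous continuous_on_compose2[OF F])
      (auto intro!: continuous_intros)
  finally show ?thesis .
qed

section \<open>Product measures and measure-preserving rearrangements of coordinates\<close>

lemma emeasure_lborel_Times:
  "A \<in> sets borel \<Longrightarrow> B \<in> sets borel \<Longrightarrow>
     emeasure lborel (A \<times> B) = emeasure lborel (A :: 'a::euclidean_space set) * emeasure lborel (B :: 'b::euclidean_space set)"
  using lborel.emeasure_pair_measure_Times[of A lborel B] by (simp add: lborel_prod)

lemma measure_lborel_Times:
  "A \<in> sets borel \<Longrightarrow> B \<in> sets borel \<Longrightarrow>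
     measure lborel (A \<times> B) = measure lborel (A :: 'a::euclidean_space set) * measure lborel (B :: 'b::euclidean_space set)"
  by (simp add: measure_def emeasure_lborel_Times enn2real_mult)

definition preserves_lborel :: "('a::euclidean_space \<Rightarrow> 'b::euclidean_space) \<Rightarrow> bool" where
  "preserves_lborel h \<longleftrightarrow> continuous_on UNIV h \<and> distr lborel lborel h = lborel"

text \<open>Lebesgue measure is determined by its values on boxes, and for a rearrangement of
  coordinates both sides are products of the same factors there.\<close>

lemma preserves_lborelI:
  fixes h :: "'a::euclidean_space \<Rightarrow> 'b::euclidean_space"
  assumes h: "continuous_on UNIV h"
    and box: "\<And>l u. emeasure lborel (h -` box l u) = emeasure lborel (box l u)"
  shows "preserves_lborel h"
proof -
  have m: "h \<in> lborel \<rightarrow>\<^sub>M lborel"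
    using borel_measurable_continuous_onI[OF h] by simp
  have "lborel = distr lborel lborel h"
    by (rule lborel_eqI) (simp_all add: emeasure_distr[OF m] box emeasure_lborel_box)
  then show ?thesis
    using h by (simp add: preserves_lborel_def)
qed

lemma box_prod_eq: "box l u = box (fst l) (fst u) \<times> box (snd l) (snd u)"
  by (cases l; cases u) (auto simp: box_prod)

text \<open>\<open>txv\<close> is nested as (t, (x, \<alpha>)), whereas integrating out the angle
  with Fubini requires ((t, x), \<alpha>).\<close>

lemma preserves_lborel_assoc: "preserves_lborel (\<lambda>z :: ('a::euclidean_space \<times> 'b::euclidean_space) \<times> 'c::euclidean_space. (fst (fst z), snd (fst z), snd z))"
proof (rule preserves_lborelI)
  fix l u :: "'a \<times> 'b \<times> 'c"
  have "(\<lambda>z. (fst (fst z), snd (fst z), snd z)) -` box l u =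
      (box (fst l) (fst u) \<times> box (fst (snd l)) (fst (snd u))) \<times> box (snd (snd l)) (snd (snd u))"
    by (auto simp: box_prod_eq)
  then show "emeasure lborel ((\<lambda>z. (fst (fst z), snd (fst z), snd z)) -` box l u) = emeasure lborel (box l u)"
    by (simp add: box_prod_eq emeasure_lborel_Times borel_Times mult_ac)
qed (auto intro!: continuous_intros)

text \<open>The next two maps bring \<open>x\<close>, respectively \<open>y\<close>, to the front, so that the fundamental theorem
  for the first coordinate yields all directions.\<close>

lemma preserves_lborel_x:
  "preserves_lborel (\<lambda>z :: 'b::euclidean_space \<times> ('a::euclidean_space \<times> 'c::euclidean_space) \<times> 'd::euclidean_space. (fst (fst (snd z)), (fst z, snd (fst (snd z))), snd (snd z)))"
proof (rule preserves_lborelI)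
  fix l u :: "'a \<times> ('b \<times> 'c) \<times> 'd"
  let ?h = "\<lambda>z. (fst (fst (snd z)), (fst z, snd (fst (snd z))), snd (snd z))"
  have "?h -` box l u = box (fst (fst (snd l))) (fst (fst (snd u))) \<times>
      (box (fst l) (fst u) \<times> box (snd (fst (snd l))) (snd (fst (snd u)))) \<times> box (snd (snd l)) (snd (snd u))"
    by (auto simp: box_prod_eq)
  then show "emeasure lborel (?h -` box l u) = emeasure lborel (box l u)"
    by (simp add: box_prod_eq emeasure_lborel_Times borel_Times mult_ac)
qed (auto intro!: continuous_intros)

lemma preserves_lborel_y:
  "preserves_lborel (\<lambda>z :: 'c::euclidean_space \<times> ('a::euclidean_space \<times> 'b::euclidean_space) \<times> 'd::euclidean_space. (fst (fst (snd z)), (snd (fst (snd z)), fst z), snd (snd z)))"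
proof (rule preserves_lborelI)
  fix l u :: "'a \<times> ('b \<times> 'c) \<times> 'd"
  let ?h = "\<lambda>z. (fst (fst (snd z)), (snd (fst (snd z)), fst z), snd (snd z))"
  have "?h -` box l u = box (snd (fst (snd l))) (snd (fst (snd u))) \<times>
      (box (fst l) (fst u) \<times> box (fst (fst (snd l))) (fst (fst (snd u)))) \<times> box (snd (snd l)) (snd (snd u))"
    by (auto simp: box_prod_eq)
  then show "emeasure lborel (?h -` box l u) = emeasure lborel (box l u)"
    by (simp add: box_prod_eq emeasure_lborel_Times borel_Times mult_ac)
qed (auto intro!: continuous_intros)

lemma preserves_lborel_integral:
  assumes h: "preserves_lborel h" and f: "continuous_on UNIV f" and S: "S \<in> sets borel"
  shows "(LINT z:h -` S|lborel. (f (h z) :: real)) = (LINT z:S|lborel. f z)"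
proof -
  have m: "h \<in> lborel \<rightarrow>\<^sub>M lborel" "f \<in> borel_measurable borel"
    using h f borel_measurable_continuous_onI by (auto simp: preserves_lborel_def)
  have "(LINT z:S|lborel. f z) = (LINT z|distr lborel lborel h. indicator S z *\<^sub>R f z)"
    using h by (simp add: preserves_lborel_def set_lebesgue_integral_def)
  also have "\<dots> = (LINT z|lborel. indicator S (h z) *\<^sub>R f (h z))"
    using S m by (intro integral_distr) auto
  finally show ?thesis
    by (simp add: set_lebesgue_integral_def indicator_vimage)
qed

lemma preserves_lborel_in_L2:
  assumes h: "preserves_lborel h" and f: "in_L2 S f"
  shows "in_L2 (h -` S) (\<lambda>z. f (h z))" and "L2_sq (h -` S) (\<lambda>z. f (h z)) = L2_sq S f"
proof -
  let ?F = "\<lambda>z. indicator S z * f z"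
  have eq: "indicator (h -` S) z * f (h z) = ?F (h z)" for z
    by (simp add: indicator_vimage)
  have m: "h \<in> lborel \<rightarrow>\<^sub>M lborel"
    using h borel_measurable_continuous_onI by (auto simp: preserves_lborel_def)
  have F: "?F \<in> borel_measurable lborel" "integrable lborel (\<lambda>z. (?F z)\<^sup>2)"
    using f by (auto simp: in_L2_iff)
  have d: "distr lborel lborel h = lborel"
    using h by (simp add: preserves_lborel_def)
  show "in_L2 (h -` S) (\<lambda>z. f (h z))"
    unfolding in_L2_iff eq
  proof
    show "(\<lambda>z. ?F (h z)) \<in> borel_measurable borel"
      using measurable_compose[OF m F(1)] by simp
    show "integrable lborel (\<lambda>z. (?F (h z))\<^sup>2)"
      using integrable_distr[OF m, of "\<lambda>z. (?F z)\<^sup>2"] F(2) d by simp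
  qed
  show "L2_sq (h -` S) (\<lambda>z. f (h z)) = L2_sq S f"
    unfolding L2_sq_alt eq
    using integral_distr[OF m, of "\<lambda>z. (?F z)\<^sup>2"] F d by simp
qed

lemma L2_sq_cong_AE:
  assumes "AE x in lborel. x \<in> U \<longrightarrow> f x = g x" "in_L2 U f" "in_L2 U g"
  shows "L2_sq U f = L2_sq U g"
  unfolding L2_sq_alt using assms
  by (intro integral_cong_AE) (auto simp: in_L2_iff indicator_def elim!: eventually_mono)

section \<open>Continuously differentiable functions\<close>

text \<open>The energy argument involves first derivatives only. At this level closure under
  differences is immediate, whereas \<open>smooth\<close> would require an induction over all
  orders.\<close>

definition C1 :: "('a::euclidean_space \<Rightarrow> real) \<Rightarrow> bool" where
  "C1 f \<longleftrightarrow> f differentiable_on UNIV \<and> (\<forall>b\<in>Basis. continuous_on UNIV (partial_deriv b f))"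

lemma smooth_imp_C1: "smooth f \<Longrightarrow> C1 f"
proof -
  assume "smooth f"
  then have "C_k (Suc 0) f" unfolding smooth_def by blast
  then show ?thesis by (simp add: C1_def)
qed

lemma C1_continuous: "C1 f \<Longrightarrow> continuous_on UNIV f"
  by (simp add: C1_def differentiable_imp_continuous_on)

lemma partial_deriv_diff:
  assumes "C1 f" "C1 g"
  shows "partial_deriv b (\<lambda>x. f x - g x) = (\<lambda>x. partial_deriv b f x - partial_deriv b g x)"
proof
  fix x
  have "f differentiable at x" "g differentiable at x"
    using assms by (auto simp: C1_def differentiable_on_def)
  then have "((\<lambda>x. f x - g x) has_derivative (\<lambda>h. frechet_derivative f (at x) h - frechet_derivative g (at x) h)) (at x)"
    by (intro has_derivative_diff) (simp_all add: frechet_derivative_works[symmetric])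
  then have "frechet_derivative (\<lambda>x. f x - g x) (at x) = (\<lambda>h. frechet_derivative f (at x) h - frechet_derivative g (at x) h)"
    by (rule frechet_derivative_at[symmetric])
  then show "partial_deriv b (\<lambda>x. f x - g x) x = partial_deriv b f x - partial_deriv b g x"
    by (simp add: partial_deriv_def)
qed

lemma C1_diff: "C1 f \<Longrightarrow> C1 g \<Longrightarrow> C1 (\<lambda>x. f x - g x)"
  unfolding C1_def
  by (auto intro!: continuous_intros derivative_intros simp: partial_deriv_diff[unfolded C1_def])

text \<open>Chain rule along a curve with velocity b; coordinate lines as \<open>p\<close> give all
  the partial derivatives below from one statement.\<close>

lemma C1_has_real_derivative:
  assumes f: "C1 f" and p: "(p has_derivative (\<lambda>h. h *\<^sub>R b)) (at t)"
  shows "((\<lambda>s. f (p s)) has_real_derivative partial_deriv b f (p t)) (at t)"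
proof -
  have "f differentiable at (p t)"
    using f by (auto simp: C1_def differentiable_on_def)
  then have d: "(f has_derivative frechet_derivative f (at (p t))) (at (p t))"
    by (simp add: frechet_derivative_works[symmetric])
  have "((\<lambda>s. f (p s)) has_derivative (\<lambda>h. frechet_derivative f (at (p t)) (h *\<^sub>R b))) (at t)"
    by (rule has_derivative_compose[OF p d])
  also have "(\<lambda>h. frechet_derivative f (at (p t)) (h *\<^sub>R b)) = (*) (partial_deriv b f (p t))"
    using linear_scale[OF has_derivative_linear[OF d]] by (auto simp: partial_deriv_def)
  finally show ?thesis
    by (simp add: has_field_derivative_def)
qed

lemma e_Basis: "e_t \<in> Basis" "e_x \<in> Basis" "e_y \<in> Basis" "e_t' \<in> Basis" "e_x' \<in> Basis" "e_y' \<in> Basis"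
  by (auto simp: Basis_prod_def zero_prod_def image_iff)

lemma C1_partials_tx:
  fixes f :: "tx \<Rightarrow> real"
  assumes "C1 f"
  shows "((\<lambda>t. f (t, p)) has_real_derivative partial_deriv e_t f (t, p)) (at t)"
    and "((\<lambda>x. f (t, x, y)) has_real_derivative partial_deriv e_x f (t, x, y)) (at x)"
    and "((\<lambda>y. f (t, x, y)) has_real_derivative partial_deriv e_y f (t, x, y)) (at y)"
  by (rule C1_has_real_derivative[OF assms], auto intro!: derivative_eq_intros simp: zero_prod_def)+

lemma C1_partials_txv:
  fixes f :: "txv \<Rightarrow> real"
  assumes "C1 f"
  shows "((\<lambda>t. f (t, p)) has_real_derivative partial_deriv e_t' f (t, p)) (at t)"
    and "((\<lambda>x. f (t, (x, y), \<alpha>)) has_real_derivative partial_deriv e_x' f (t, (x, y), \<alpha>)) (at x)"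
    and "((\<lambda>y. f (t, (x, y), \<alpha>)) has_real_derivative partial_deriv e_y' f (t, (x, y), \<alpha>)) (at y)"
  by (rule C1_has_real_derivative[OF assms], auto intro!: derivative_eq_intros simp: zero_prod_def)+

lemma C1_continuous_partials:
  assumes "C1 f" "b \<in> Basis" shows "continuous_on UNIV (partial_deriv b f)"
  using assms by (auto simp: C1_def)

section \<open>Velocity averages and the space-time domain\<close>

lemma angles_facts: "angles \<in> sets borel" "bounded angles" "emeasure lborel angles < \<infinity>" "measure lborel angles = pi / 2"
  by (auto simp: angles_def ennreal_less_top)

lemma continuous_on_UNIV_compose:
  "continuous_on UNIV f \<Longrightarrow> continuous_on S h \<Longrightarrow> continuous_on S (\<lambda>x. f (h x))"
  by (rule continuous_on_compose2) auto

text \<open>Closing the interval costs only a null set and makes it compact, as continuity in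
  parameters and differentiation under the integral require.\<close>

lemma vavg_eq_integral:
  assumes "continuous_on UNIV h"
  shows "vavg h = 2 / pi * integral (cbox 0 (pi/2)) h"
proof -
  have "(LINT \<alpha>:angles|lborel. h \<alpha>) = integral {0<..<pi/2} h"
    using set_borel_integral_eq_integral(2)[OF set_integrable_continuous[OF assms angles_facts(2,1)]]
    by (simp add: angles_def)
  then show ?thesis
    by (simp add: vavg_def integral_open_interval_real)
qed

lemma continuous_on_section:
  assumes "continuous_on UNIV (f :: txv \<Rightarrow> real)"
  shows "continuous_on UNIV (\<lambda>\<alpha>. f (t, x, \<alpha>))"
  by (rule continuous_on_UNIV_compose[OF assms]) (auto intro!: continuous_intros)

lemma continuous_on_vavg:
  assumes f: "continuous_on UNIV (f :: txv \<Rightarrow> real)"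
  shows "continuous_on UNIV (\<lambda>p. vavg (\<lambda>\<alpha>. f (fst p, snd p, \<alpha>)))"
proof -
  have "continuous_on UNIV (\<lambda>p. integral (cbox 0 (pi/2)) (\<lambda>\<alpha>. f (fst p, snd p, \<alpha>)))"
    by (rule integral_continuous_on_param)
      (auto simp: case_prod_beta' intro!: continuous_on_UNIV_compose[OF f] continuous_intros)
  then show ?thesis
    by (auto simp: vavg_eq_integral continuous_on_section f intro!: continuous_intros)
qed

lemma vavg_has_real_derivative:
  assumes f: "C1 (f :: txv \<Rightarrow> real)"
  shows "((\<lambda>t. vavg (\<lambda>\<alpha>. f (t, x, \<alpha>))) has_real_derivative vavg (\<lambda>\<alpha>. partial_deriv e_t' f (t, x, \<alpha>))) (at t)"
proof -
  have c: "continuous_on UNIV f" "continuous_on UNIV (partial_deriv e_t' f)"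
    using C1_continuous[OF f] C1_continuous_partials[OF f e_Basis(4)] by auto
  have "((\<lambda>t. integral (cbox 0 (pi/2)) (\<lambda>\<alpha>. f (t, x, \<alpha>))) has_real_derivative
      integral (cbox 0 (pi/2)) (\<lambda>\<alpha>. partial_deriv e_t' f (t, x, \<alpha>))) (at t within UNIV)"
  proof (rule leibniz_rule_field_derivative)
    show "(\<lambda>\<alpha>. f (s, x, \<alpha>)) integrable_on cbox 0 (pi/2)" for s
      by (rule integrable_continuous, rule continuous_on_subset[OF continuous_on_section[OF c(1)]]) simp
    show "continuous_on (UNIV \<times> cbox 0 (pi / 2)) (\<lambda>(s, \<alpha>). partial_deriv e_t' f (s, x, \<alpha>))"
      by (auto simp: case_prod_beta' intro!: continuous_on_UNIV_compose[OF c(2)] continuous_intros)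
  qed (use C1_partials_txv(1)[OF f] in auto)
  then show ?thesis
    by (auto simp: vavg_eq_integral continuous_on_section c intro!: derivative_eq_intros)
qed

lemma vavg_add: "continuous_on UNIV f \<Longrightarrow> continuous_on UNIV g \<Longrightarrow> vavg (\<lambda>\<alpha>. f \<alpha> + g \<alpha>) = vavg f + vavg g"
  unfolding vavg_def
  by (subst set_integral_add(2)) (auto intro!: set_integrable_continuous angles_facts simp: algebra_simps)

lemma vavg_cmult: "vavg (\<lambda>\<alpha>. c * f \<alpha>) = c * vavg f"
  by (simp add: vavg_def)

lemma vavg_const: "vavg (\<lambda>\<alpha>. c) = c"
  by (simp add: vavg_def set_lebesgue_integral_def angles_facts)

text \<open>The shape is that of \<open>d2\<close> along one velocity arc: \<open>f\<close> is the
  time derivative of w, \<open>g\<close> the flux, \<open>k\<close> minus the mean flux, which is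
  constant in the angle, and \<open>h\<close> is w.\<close>

lemma vavg_linear:
  assumes "continuous_on UNIV f" "continuous_on UNIV g" "continuous_on UNIV h"
  shows "vavg (\<lambda>\<alpha>. c * f \<alpha> + (g \<alpha> + (k + d * h \<alpha>))) = c * vavg f + (vavg g + (k + d * vavg h))"
proof -
  have "vavg (\<lambda>\<alpha>. c * f \<alpha> + (g \<alpha> + (k + d * h \<alpha>))) = vavg (\<lambda>\<alpha>. c * f \<alpha>) + vavg (\<lambda>\<alpha>. g \<alpha> + (k + d * h \<alpha>))"
    using assms by (intro vavg_add continuous_intros)
  also have "vavg (\<lambda>\<alpha>. g \<alpha> + (k + d * h \<alpha>)) = vavg g + vavg (\<lambda>\<alpha>. k + d * h \<alpha>)"
    using assms by (intro vavg_add continuous_intros)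
  also have "vavg (\<lambda>\<alpha>. k + d * h \<alpha>) = vavg (\<lambda>\<alpha>. k) + vavg (\<lambda>\<alpha>. d * h \<alpha>)"
    using assms by (intro vavg_add continuous_intros)
  finally show ?thesis by (simp only: vavg_cmult vavg_const)
qed

section \<open>The period cell: averaging, lifting and integration in each direction\<close>

locale cell =
  fixes T :: real and a b :: "real \<times> real"
  assumes T: "0 < T" and ab: "fst a < fst b" "snd a < snd b"
begin

lemma box_ab: "box a b = {fst a<..<fst b} \<times> {snd a<..<snd b}"
  by (simp add: box_prod_eq)

lemma domain_facts:
  "TD T a b \<in> sets borel" "bounded (TD T a b)" "TDV T a b \<in> sets borel" "bounded (TDV T a b)"
  "box a b \<times> angles \<in> sets borel" "bounded (box a b \<times> angles)"
  by (auto simp: TD_def TDV_def borel_Times angles_facts bounded_Times bounded_box)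

lemma assoc_vimage: "(\<lambda>z. (fst (fst z), snd (fst z), snd z)) -` TDV T a b = TD T a b \<times> angles"
  by (auto simp: TD_def TDV_def)

text \<open>Jensen's inequality on an arc of length pi / 2. The integrability of almost every
  section is recorded because it makes the average of a difference the difference of the
  averages.\<close>

lemma in_L2_vavg:
  assumes f: "in_L2 (TDV T a b) f"
  shows "AE p in lborel. p \<in> TD T a b \<longrightarrow> set_integrable lborel angles (\<lambda>\<alpha>. f (fst p, snd p, \<alpha>))"
    and "in_L2 (TD T a b) (\<lambda>p. vavg (\<lambda>\<alpha>. f (fst p, snd p, \<alpha>)))"
    and "pi / 2 * L2_sq (TD T a b) (\<lambda>p. vavg (\<lambda>\<alpha>. f (fst p, snd p, \<alpha>))) \<le> L2_sq (TDV T a b) f"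
proof -
  note L = preserves_lborel_in_L2[OF preserves_lborel_assoc f, unfolded assoc_vimage]
  note I = in_L2_integral[OF L(1) domain_facts(1) angles_facts(1,3)]
  show "AE p in lborel. p \<in> TD T a b \<longrightarrow> set_integrable lborel angles (\<lambda>\<alpha>. f (fst p, snd p, \<alpha>))"
    using I(1) by simp
  show "in_L2 (TD T a b) (\<lambda>p. vavg (\<lambda>\<alpha>. f (fst p, snd p, \<alpha>)))"
    using in_L2_cmult(1)[OF I(2), of "2/pi"] by (simp add: vavg_def)
  have "L2_sq (TD T a b) (\<lambda>p. vavg (\<lambda>\<alpha>. f (fst p, snd p, \<alpha>))) \<le> (2/pi)\<^sup>2 * (pi/2 * L2_sq (TDV T a b) f)"
    using in_L2_cmult(2)[OF I(2), of "2/pi"] I(3) L(2) unfolding vavg_def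
    by (simp add: angles_facts mult_left_mono)
  then show "pi / 2 * L2_sq (TD T a b) (\<lambda>p. vavg (\<lambda>\<alpha>. f (fst p, snd p, \<alpha>))) \<le> L2_sq (TDV T a b) f"
    by (simp add: field_simps power2_eq_square)
qed

lemma L2_sq_vavg_box:
  assumes f: "in_L2 (box a b \<times> angles) f"
  shows "pi / 2 * L2_sq (box a b) (\<lambda>x. vavg (\<lambda>\<alpha>. f (x, \<alpha>))) \<le> L2_sq (box a b \<times> angles) f"
proof -
  note I = in_L2_integral[OF f _ angles_facts(1,3)]
  have "L2_sq (box a b) (\<lambda>x. vavg (\<lambda>\<alpha>. f (x, \<alpha>))) \<le> (2/pi)\<^sup>2 * (pi/2 * L2_sq (box a b \<times> angles) f)"
    using in_L2_cmult(2)[OF I(2), of "2/pi"] I(3) unfolding vavg_def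
    by (simp add: angles_facts mult_left_mono)
  then show ?thesis
    by (simp add: field_simps power2_eq_square)
qed

text \<open>\<open>rho_c\<close>, \<open>d1\<close> and the mean flux live on \<open>TD\<close> but
  enter expressions integrated over \<open>TDV\<close>; being constant in the angle, they gain the
  arc length as a factor.\<close>

lemma in_L2_lift:
  assumes f: "in_L2 (TD T a b) f"
  shows "in_L2 (TDV T a b) (\<lambda>z. f (fst z, fst (snd z)))"
    and "L2_sq (TDV T a b) (\<lambda>z. f (fst z, fst (snd z))) = pi / 2 * L2_sq (TD T a b) f"
proof -
  note L = in_L2_fst[OF f angles_facts(1,3)]
  have pr: "preserves_lborel (\<lambda>z :: txv. ((fst z, fst (snd z)), snd (snd z)))"
  proof (rule preserves_lborelI)
    fix l u :: "tx \<times> real"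
    have "(\<lambda>z :: txv. ((fst z, fst (snd z)), snd (snd z))) -` box l u =
        box (fst (fst l)) (fst (fst u)) \<times> box (snd (fst l)) (snd (fst u)) \<times> box (snd l) (snd u)"
      by (auto simp: box_prod_eq)
    then show "emeasure lborel ((\<lambda>z :: txv. ((fst z, fst (snd z)), snd (snd z))) -` box l u) = emeasure lborel (box l u)"
      by (simp add: box_prod_eq[where 'a="tx" and 'b=real] box_prod_eq[where 'a=real and 'b="real \<times> real"]
          emeasure_lborel_Times borel_Times mult_ac del: box_real)
  qed (auto intro!: continuous_intros)
  have vim: "(\<lambda>z :: txv. ((fst z, fst (snd z)), snd (snd z))) -` (TD T a b \<times> angles) = TDV T a b"
    by (auto simp: TD_def TDV_def)
  show "in_L2 (TDV T a b) (\<lambda>z. f (fst z, fst (snd z)))"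
    using preserves_lborel_in_L2(1)[OF pr L(1)] unfolding vim by simp
  show "L2_sq (TDV T a b) (\<lambda>z. f (fst z, fst (snd z))) = pi / 2 * L2_sq (TD T a b) f"
    using preserves_lborel_in_L2(2)[OF pr L(1)] L(2) unfolding vim by (simp add: angles_facts)
qed

lemma integral_TDV_vavg:
  assumes f: "continuous_on UNIV (f :: txv \<Rightarrow> real)"
  shows "(LINT z:TDV T a b|lborel. f z) = pi / 2 * (LINT p:TD T a b|lborel. vavg (\<lambda>\<alpha>. f (fst p, snd p, \<alpha>)))"
proof -
  let ?g = "\<lambda>z :: tx \<times> real. f (fst (fst z), snd (fst z), snd z)"
  have g: "continuous_on UNIV ?g"
    by (intro continuous_on_UNIV_compose[OF f] continuous_intros)
  have "set_integrable lborel (TD T a b \<times> angles) ?g"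
    using g by (intro set_integrable_continuous) (auto simp: domain_facts angles_facts borel_Times bounded_Times)
  then have int: "integrable (lborel \<Otimes>\<^sub>M lborel) (\<lambda>(p, \<alpha>). indicator (TD T a b \<times> angles) (p, \<alpha>) *\<^sub>R ?g (p, \<alpha>))"
    by (simp add: set_integrable_def lborel_prod case_prod_beta')
  have sec: "(LINT \<alpha>|lborel. indicator (TD T a b \<times> angles) (p, \<alpha>) *\<^sub>R ?g (p, \<alpha>)) =
      indicator (TD T a b) p *\<^sub>R (pi / 2 * vavg (\<lambda>\<alpha>. f (fst p, snd p, \<alpha>)))" for p
    by (auto simp: vavg_def set_lebesgue_integral_def indicator_def)
  have "(LINT z:TDV T a b|lborel. f z) = (LINT z:TD T a b \<times> angles|lborel. ?g z)"
    using preserves_lborel_integral[OF preserves_lborel_assoc f domain_facts(3)] by (simp add: assoc_vimage)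
  also have "\<dots> = (LINT p|lborel. LINT \<alpha>|lborel. indicator (TD T a b \<times> angles) (p, \<alpha>) *\<^sub>R ?g (p, \<alpha>))"
    using lborel_pair.integral_fst[OF int] by (simp add: set_lebesgue_integral_def lborel_prod case_prod_beta')
  also have "\<dots> = pi / 2 * (LINT p:TD T a b|lborel. vavg (\<lambda>\<alpha>. f (fst p, snd p, \<alpha>)))"
    unfolding sec set_lebesgue_integral_def integral_mult_right_zero[symmetric]
    by (intro Bochner_Integration.integral_cong) auto
  finally show ?thesis .
qed

lemma integral_TD_dt:
  fixes F G :: "tx \<Rightarrow> real"
  assumes "continuous_on UNIV F" "continuous_on UNIV G"
    and "\<And>t p. ((\<lambda>t. F (t, p)) has_real_derivative G (t, p)) (at t)"
  shows "(LINT z:TD T a b|lborel. G z) = (LINT p:box a b|lborel. F (T, p)) - (LINT p:box a b|lborel. F (0, p))"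
  unfolding TD_def using T assms by (intro integral_Times_FTC) (auto simp: bounded_box)

lemma integral_TDV_dt:
  fixes F G :: "txv \<Rightarrow> real"
  assumes "continuous_on UNIV F" "continuous_on UNIV G"
    and "\<And>t p. ((\<lambda>t. F (t, p)) has_real_derivative G (t, p)) (at t)"
  shows "(LINT z:TDV T a b|lborel. G z) =
    (LINT p:box a b \<times> angles|lborel. F (T, p)) - (LINT p:box a b \<times> angles|lborel. F (0, p))"
  unfolding TDV_def using T assms by (intro integral_Times_FTC) (auto simp: domain_facts)

text \<open>The faces are parametrised by ((t, s), \<alpha>), the order used by
  \<open>with_angle\<close>, so that the boundary terms can be read off as face integrals of the
  risk.\<close>

lemma integral_TDV_dx:
  fixes F G :: "txv \<Rightarrow> real"
  assumes F: "continuous_on UNIV F" and G: "continuous_on UNIV G"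
    and d: "\<And>t x y \<alpha>. ((\<lambda>x. F (t, (x, y), \<alpha>)) has_real_derivative G (t, (x, y), \<alpha>)) (at x)"
  shows "(LINT z:TDV T a b|lborel. G z) =
    (LINT q:({0<..<T} \<times> {snd a<..<snd b}) \<times> angles|lborel. F (fst (fst q), (fst b, snd (fst q)), snd q))
    - (LINT q:({0<..<T} \<times> {snd a<..<snd b}) \<times> angles|lborel. F (fst (fst q), (fst a, snd (fst q)), snd q))"
proof -
  let ?h = "\<lambda>z :: real \<times> (real \<times> real) \<times> real. (fst (fst (snd z)), (fst z, snd (fst (snd z))), snd (snd z))"
  have vim: "?h -` TDV T a b = {fst a<..<fst b} \<times> (({0<..<T} \<times> {snd a<..<snd b}) \<times> angles)"
    by (auto simp: TDV_def box_ab)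
  have "(LINT z:TDV T a b|lborel. G z) =
      (LINT z:{fst a<..<fst b} \<times> (({0<..<T} \<times> {snd a<..<snd b}) \<times> angles)|lborel. G (?h z))"
    using preserves_lborel_integral[OF preserves_lborel_x G domain_facts(3)] by (simp add: vim)
  also have "\<dots> = (LINT q:({0<..<T} \<times> {snd a<..<snd b}) \<times> angles|lborel. F (?h (fst b, q)))
    - (LINT q:({0<..<T} \<times> {snd a<..<snd b}) \<times> angles|lborel. F (?h (fst a, q)))"
    by (rule integral_Times_FTC)
      (use ab d in \<open>auto intro!: continuous_on_UNIV_compose[OF F] continuous_on_UNIV_compose[OF G]
         continuous_intros bounded_Times simp: borel_Times angles_facts\<close>)
  finally show ?thesis by simp
qed

lemma integral_TDV_dy:
  fixes F G :: "txv \<Rightarrow> real"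
  assumes F: "continuous_on UNIV F" and G: "continuous_on UNIV G"
    and d: "\<And>t x y \<alpha>. ((\<lambda>y. F (t, (x, y), \<alpha>)) has_real_derivative G (t, (x, y), \<alpha>)) (at y)"
  shows "(LINT z:TDV T a b|lborel. G z) =
    (LINT q:({0<..<T} \<times> {fst a<..<fst b}) \<times> angles|lborel. F (fst (fst q), (snd (fst q), snd b), snd q))
    - (LINT q:({0<..<T} \<times> {fst a<..<fst b}) \<times> angles|lborel. F (fst (fst q), (snd (fst q), snd a), snd q))"
proof -
  let ?h = "\<lambda>z :: real \<times> (real \<times> real) \<times> real. (fst (fst (snd z)), (snd (fst (snd z)), fst z), snd (snd z))"
  have vim: "?h -` TDV T a b = {snd a<..<snd b} \<times> (({0<..<T} \<times> {fst a<..<fst b}) \<times> angles)"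
    by (auto simp: TDV_def box_ab)
  have "(LINT z:TDV T a b|lborel. G z) =
      (LINT z:{snd a<..<snd b} \<times> (({0<..<T} \<times> {fst a<..<fst b}) \<times> angles)|lborel. G (?h z))"
    using preserves_lborel_integral[OF preserves_lborel_y G domain_facts(3)] by (simp add: vim)
  also have "\<dots> = (LINT q:({0<..<T} \<times> {fst a<..<fst b}) \<times> angles|lborel. F (?h (snd b, q)))
    - (LINT q:({0<..<T} \<times> {fst a<..<fst b}) \<times> angles|lborel. F (?h (snd a, q)))"
    by (rule integral_Times_FTC)
      (use ab d in \<open>auto intro!: continuous_on_UNIV_compose[OF F] continuous_on_UNIV_compose[OF G]
         continuous_intros bounded_Times simp: borel_Times angles_facts\<close>)
  finally show ?thesis by simp
qed

end

section \<open>The a priori estimate for smooth tuples\<close>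

text \<open>\<open>\<kappa>\<close> is the value of the initial layer. The factor \<open>D = 1 / (1 + \<kappa> / \<epsilon>\<^sup>2)\<close> is the weight with which
  \<open>W\<^sup>2\<close> has to be controlled after \<open>4 r W\<close> is absorbed by the term \<open>\<kappa> / \<epsilon>\<^sup>2 * E\<close> coming from the
  time weight. The last term on the right vanishes after averaging over the angle.\<close>

lemma energy_density_inequality:
  fixes \<epsilon> \<kappa> d1 d2 d3 d4 d5 :: real
  assumes eps: "0 < \<epsilon>" "\<epsilon> \<le> 1" and kap: "0 < \<kappa>" "\<kappa> \<le> 1"
    and r: "r = \<rho> + \<epsilon>\<^sup>2 * w" and E: "E = 2 * r\<^sup>2 + \<phi>\<^sup>2 / 2 + \<epsilon>\<^sup>2 * P\<^sup>2 / 2 + \<epsilon>\<^sup>2 * M\<^sup>2 / 2"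
    and D: "D = \<epsilon>\<^sup>2 / (\<epsilon>\<^sup>2 + \<kappa>)"
    and d1: "d1 = 2 * \<rho>t + A" and d2: "d2 = 2 * \<epsilon>\<^sup>2 * wt + (c * Px + s * My) - A + 2 * w"
    and d3: "d3 = \<phi>t + c * Mx + s * Py + 1 / \<epsilon>\<^sup>2 * \<phi>"
    and d4: "d4 = \<epsilon>\<^sup>2 * Pt + P + 2 * c * rx + s * \<phi>y"
    and d5: "d5 = \<epsilon>\<^sup>2 * Mt + M + c * \<phi>x + 2 * s * ry"
  shows "- (3 + \<kappa> / \<epsilon>\<^sup>2) * E + (4 * r * (\<rho>t + \<epsilon>\<^sup>2 * wt) + \<phi> * \<phi>t + \<epsilon>\<^sup>2 * P * Pt + \<epsilon>\<^sup>2 * M * Mt)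
     + c * (2 * rx * P + 2 * r * Px + \<phi>x * M + \<phi> * Mx) + s * (2 * ry * M + 2 * r * My + \<phi>y * P + \<phi> * Py)
     \<le> - E + 4 * D * W\<^sup>2 + (d1\<^sup>2 + d2\<^sup>2 + d3\<^sup>2 + d4\<^sup>2 + d5\<^sup>2) - 4 * \<rho> * (w - W)"
    (is "?L \<le> ?R")
proof -
  define \<mu> where "\<mu> = \<kappa> / \<epsilon>\<^sup>2"
  \<comment> \<open>The multipliers are 2 r for the sum of the first two equations, where
    \<open>A\<close> cancels, and then \<phi>, P and M. They consume all time and flux terms of
    \<open>?L\<close>, leaving residuals and damping.\<close>
  have L: "?L = - (3 + \<mu>) * E + 2 * r * (d1 + d2 - 2 * w) + \<phi> * (d3 - 1 / \<epsilon>\<^sup>2 * \<phi>) + P * (d4 - P) + M * (d5 - M)"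
    unfolding d1 d2 d3 d4 d5 \<mu>_def by (simp add: algebra_simps power2_eq_square)
  have e2: "0 < \<epsilon>\<^sup>2" "\<epsilon>\<^sup>2 \<le> 1"
    using eps by (auto simp: power_le_one)
  have mu: "0 \<le> \<mu>" using kap e2 by (simp add: \<mu>_def)
  have D0: "0 < D" "D \<le> 1" using kap e2 by (simp_all add: D divide_pos_pos add_pos_pos)
  have "1 + \<mu> = (\<epsilon>\<^sup>2 + \<kappa>) / \<epsilon>\<^sup>2"
    using e2 by (simp add: \<mu>_def add_divide_distrib)
  moreover have "\<epsilon>\<^sup>2 + \<kappa> \<noteq> 0"
    using e2 kap by linarith
  ultimately have DD: "D * (1 + \<mu>) = 1"
    using e2 by (simp add: D)
  \<comment> \<open>From \<epsilon>^2 + \<kappa> \<le> 2. It allows the stray term \<epsilon>^2 W^2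
    in \<open>a2\<close> to be charged to D W^2.\<close>
  have e2D: "\<epsilon>\<^sup>2 \<le> 2 * D"
  proof -
    have "\<epsilon>\<^sup>2 * (\<epsilon>\<^sup>2 + \<kappa>) \<le> \<epsilon>\<^sup>2 * 2"
      using e2 kap by (intro mult_left_mono) auto
    moreover have "0 < \<epsilon>\<^sup>2 + \<kappa>" using e2 kap by linarith
    ultimately have "\<epsilon>\<^sup>2 \<le> \<epsilon>\<^sup>2 * 2 / (\<epsilon>\<^sup>2 + \<kappa>)"
      by (subst pos_le_divide_eq)
    then show ?thesis unfolding D by (simp only: mult.commute times_divide_eq_right)
  qed
  have E_ge: "2 * r\<^sup>2 \<le> E"
    using e2 by (simp add: E)
  have young: "x * y \<le> k * x\<^sup>2 + y\<^sup>2 / (4 * k)" if "0 < k" for x y k :: real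
    using zero_le_power2[of "2 * k * x - y"] that by (simp add: field_simps power2_eq_square)
  have i1: "2 * r * d1 \<le> r\<^sup>2 + d1\<^sup>2" "2 * r * d2 \<le> r\<^sup>2 + d2\<^sup>2"
    using zero_le_power2[of "r - d1"] zero_le_power2[of "r - d2"] by (simp_all add: power2_diff)
  have "\<phi> * d3 \<le> \<phi>\<^sup>2 + d3\<^sup>2 / 4" "P * d4 \<le> P\<^sup>2 + d4\<^sup>2 / 4" "M * d5 \<le> M\<^sup>2 + d5\<^sup>2 / 4"
    using young[of 1] by simp_all
  \<comment> \<open>The stiff damping of \<phi> is used with rate 1 only, which \<epsilon> \<le> 1
    permits.\<close>
  moreover have "\<phi>\<^sup>2 \<le> \<phi> * (1 / \<epsilon>\<^sup>2 * \<phi>)"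
    using e2 mult_right_mono[of "\<epsilon>\<^sup>2" 1 "\<phi>\<^sup>2"] by (simp add: field_simps power2_eq_square)
  moreover have "0 \<le> d3\<^sup>2" "0 \<le> d4\<^sup>2" "0 \<le> d5\<^sup>2" by simp_all
  ultimately have i2: "\<phi> * (d3 - 1 / \<epsilon>\<^sup>2 * \<phi>) \<le> d3\<^sup>2" "P * (d4 - P) \<le> d4\<^sup>2" "M * (d5 - M) \<le> d5\<^sup>2"
    unfolding right_diff_distrib power2_eq_square[of P, symmetric] power2_eq_square[of M, symmetric]
    by linarith+
  \<comment> \<open>Replacing w by W in \<rho> w splits off a part that averages out. What remains
    is - r W and \<epsilon>^2 w W, and the latter is absorbed by the negative term - 4 \<epsilon>^2
    w^2 contained in - 4 r w.\<close>
  have i3: "- 4 * r * w \<le> 2 * (1 + \<mu>) * r\<^sup>2 + 4 * D * W\<^sup>2 - 4 * \<rho> * (w - W)"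
  proof -
    \<comment> \<open>Young with parameter (1 + \<mu>) / 2 on r^2, whose dual weight on W^2 is D /
      2.\<close>
    have a1: "4 * (- r * W) \<le> 2 * (1 + \<mu>) * r\<^sup>2 + 2 * D * W\<^sup>2"
    proof -
      have "D = 1 / (1 + \<mu>)"
        using DD mu by (simp add: eq_divide_eq)
      moreover have "x / (4 * (k / 2)) = 1 / k / 2 * x" for k x :: real
        by simp
      ultimately have "W\<^sup>2 / (4 * ((1 + \<mu>) / 2)) = D / 2 * W\<^sup>2"
        by (simp only:)
      moreover have "- r * W \<le> (1 + \<mu>) / 2 * (- r)\<^sup>2 + W\<^sup>2 / (4 * ((1 + \<mu>) / 2))"
        using mu by (intro young) simp
      ultimately have "- r * W \<le> (1 + \<mu>) / 2 * (- r)\<^sup>2 + D / 2 * W\<^sup>2"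
        by (simp only:)
      then have "4 * (- r * W) \<le> 4 * ((1 + \<mu>) / 2 * (- r)\<^sup>2 + D / 2 * W\<^sup>2)"
        by (rule mult_left_mono) simp
      also have "\<dots> = 2 * (1 + \<mu>) * r\<^sup>2 + 2 * D * W\<^sup>2"
        by (simp add: algebra_simps)
      finally show ?thesis .
    qed
    have a2: "4 * \<epsilon>\<^sup>2 * (w * W) \<le> 4 * \<epsilon>\<^sup>2 * w\<^sup>2 + 2 * D * W\<^sup>2"
    proof -
      have "4 * \<epsilon>\<^sup>2 * (w * W) \<le> 4 * \<epsilon>\<^sup>2 * (w\<^sup>2 + W\<^sup>2 / 4)"
        using young[of 1 w W] e2 by (intro mult_left_mono) auto
      moreover have "\<epsilon>\<^sup>2 * W\<^sup>2 \<le> 2 * D * W\<^sup>2"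
        using e2D by (intro mult_right_mono) auto
      ultimately show ?thesis by (simp add: algebra_simps)
    qed
    have "- 4 * r * w = 4 * (- r * W) + 4 * \<epsilon>\<^sup>2 * (w * W) - 4 * \<epsilon>\<^sup>2 * w\<^sup>2 - 4 * \<rho> * (w - W)"
      unfolding r by (simp add: algebra_simps power2_eq_square)
    then show ?thesis using a1 a2 by linarith
  qed
  \<comment> \<open>The budget: 2 + \<mu> copies of 2 r^2 \<le> E pay for 2 (1 + \<mu>) r^2 from
    \<open>i3\<close> and 2 r^2 from \<open>i1\<close>, and one E is left.\<close>
  have i4: "- (3 + \<mu>) * E + 2 * (1 + \<mu>) * r\<^sup>2 + 2 * r\<^sup>2 \<le> - E"
    using mult_left_mono[OF E_ge, of "2 + \<mu>"] mu by (simp add: algebra_simps)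
  have "?L \<le> - (3 + \<mu>) * E + (2 * r * d1 + 2 * r * d2 + (- 4 * r * w)) + (d3\<^sup>2 + d4\<^sup>2 + d5\<^sup>2)"
    unfolding L using i2 by (simp add: algebra_simps)
  also have "\<dots> \<le> ?R"
    using i1 i3 i4 by linarith
  finally show ?thesis .
qed

text \<open>The left-hand side is, up to the time weight, the derivative of \<open>8 / (\<epsilon>\<^sup>2 + \<kappa>) * \<epsilon>\<^sup>4 W\<^sup>2\<close>; the
  prefactor is chosen to produce the dissipation \<open>4 D W\<^sup>2\<close> while keeping the initial value of order
  \<open>\<epsilon>\<^sup>4 W\<^sup>2\<close>.\<close>

lemma mean_w_inequality:
  fixes \<epsilon> \<kappa> d1 d2 d3 d4 d5 :: real
  assumes eps: "0 < \<epsilon>" "\<epsilon> \<le> 1" and kap: "0 < \<kappa>" "\<kappa> \<le> 1"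
    and D: "D = \<epsilon>\<^sup>2 / (\<epsilon>\<^sup>2 + \<kappa>)" and S: "S = 2 * \<epsilon>\<^sup>2 * Wt + 2 * W"
  shows "- (3 + \<kappa> / \<epsilon>\<^sup>2) * (8 / (\<epsilon>\<^sup>2 + \<kappa>) * \<epsilon>^4 * W\<^sup>2)
      + (8 * (\<kappa> / \<epsilon>\<^sup>2) / (\<epsilon>\<^sup>2 + \<kappa>)\<^sup>2 * \<epsilon>^4 * W\<^sup>2 + 8 / (\<epsilon>\<^sup>2 + \<kappa>) * \<epsilon>^4 * (2 * W * Wt))
      \<le> - 4 * D * W\<^sup>2 + 4 * S\<^sup>2" (is "?A + (?B + ?C) \<le> _")
proof -
  have e2: "0 < \<epsilon>\<^sup>2" "\<epsilon>\<^sup>2 \<le> 1"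
    using eps by (auto simp: power_le_one)
  have e4: "\<epsilon>^4 = \<epsilon>\<^sup>2 * \<epsilon>\<^sup>2"
    by (simp add: power2_eq_square power4_eq_xxxx)
  have D0: "0 < D" "D \<le> 1" using kap e2 by (simp_all add: D divide_pos_pos add_pos_pos)
  have "0 \<le> (3 + \<kappa> / \<epsilon>\<^sup>2) * (8 / (\<epsilon>\<^sup>2 + \<kappa>) * \<epsilon>^4 * W\<^sup>2)"
    using kap e2 by (intro mult_nonneg_nonneg divide_nonneg_nonneg add_nonneg_nonneg) auto
  then have A: "?A \<le> 0" by linarith
  \<comment> \<open>\<open>?B\<close> comes from the growth of the prefactor while \<kappa> decays.
    It costs at most 8 D W^2, against the 12 D W^2 that \<open>?C\<close> gains from the relaxation
    of W.\<close>
  have "?B = 8 * D * (\<kappa> / (\<epsilon>\<^sup>2 + \<kappa>)) * W\<^sup>2"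
  proof -
    have *: "8 * (k / e) / s\<^sup>2 * (e * e) * x = 8 * (e / s) * (k / s) * x" if "e \<noteq> 0" for k e s x :: real
      using that by (simp add: power2_eq_square)
    show ?thesis
      unfolding D e4 by (rule *) (use e2 in simp)
  qed
  also have "\<dots> \<le> 8 * D * 1 * W\<^sup>2"
  proof (intro mult_right_mono mult_left_mono)
    have "0 < \<epsilon>\<^sup>2 + \<kappa>" using e2 kap by linarith
    then show "\<kappa> / (\<epsilon>\<^sup>2 + \<kappa>) \<le> 1" by (simp add: pos_divide_le_eq)
  qed (use D0 in auto)
  finally have B: "?B \<le> 8 * D * W\<^sup>2" by simp
  have "?C = 8 * D * W * (2 * \<epsilon>\<^sup>2 * Wt)"
    unfolding D e4 by (simp add: field_simps)
  also have "\<dots> = 8 * D * (W * S) - 16 * D * W\<^sup>2"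
    unfolding S by (simp add: algebra_simps power2_eq_square)
  also have "8 * D * (W * S) \<le> 8 * D * (W\<^sup>2 / 2 + S\<^sup>2 / 2)"
    using D0 zero_le_power2[of "W - S"] by (intro mult_left_mono) (auto simp: power2_diff)
  also have "\<dots> \<le> 4 * D * W\<^sup>2 + 4 * S\<^sup>2"
    using mult_right_mono[OF D0(2), of "S\<^sup>2"] by (simp add: algebra_simps)
  finally have C: "?C \<le> 4 * S\<^sup>2 - 12 * D * W\<^sup>2" by simp
  show ?thesis using A B C by linarith
qed

section \<open>Smooth tuples: energy, averages and residuals\<close>

abbreviation pd :: "'a::euclidean_space \<Rightarrow> ('a \<Rightarrow> real) \<Rightarrow> 'a \<Rightarrow> real" where
  "pd \<equiv> partial_deriv"

definition faces_L2_sq :: "('b::euclidean_space set \<times> ('b \<Rightarrow> 'a)) list \<Rightarrow> ('a \<Rightarrow> real) \<Rightarrow> real" where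
  "faces_L2_sq \<Gamma> f = (\<Sum>(F, \<iota>)\<leftarrow>\<Gamma>. L2_sq F (f \<circ> \<iota>))"

locale smooth_parity = cell +
  fixes \<epsilon> :: real and g :: parity
  assumes eps: "0 < \<epsilon>" "\<epsilon> \<le> 1"
    and rho: "C1 (rho_c g)" and w: "C1 (w_c g)" and phi: "C1 (phi_c g)" and j1: "C1 (j1_c g)" and j2: "C1 (j2_c g)"
begin

text \<open>The letters \<open>rr\<close>, \<open>PP\<close>, \<open>MM\<close>, \<open>WW\<close> stand for \<open>\<rho> + \<epsilon>\<^sup>2 w\<close>, \<open>j\<^sub>1 + j\<^sub>2\<close>, \<open>j\<^sub>2 - j\<^sub>1\<close>, \<open>\<langle>w\<rangle>\<close>; \<open>dr\<close> takes the
  direction twice, as a vector in the domains of \<open>\<rho>\<close> and of \<open>w\<close>.\<close>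

definition "kap t = exp (- t / \<epsilon>\<^sup>2)"
definition "weight t = exp (kap t - 1 - 3 * t)"
definition "rr z = rho_c g (fst z, fst (snd z)) + \<epsilon>\<^sup>2 * w_c g z"
definition "PP z = j1_c g z + j2_c g z"
definition "MM z = j2_c g z - j1_c g z"
definition "dr e e' z = pd e (rho_c g) (fst z, fst (snd z)) + \<epsilon>\<^sup>2 * pd e' (w_c g) z"
definition "dP e z = pd e (j1_c g) z + pd e (j2_c g) z"
definition "dM e z = pd e (j2_c g) z - pd e (j1_c g) z"
definition "WW p = vavg (\<lambda>\<alpha>. w_c g (fst p, snd p, \<alpha>))"
definition "Wt p = vavg (\<lambda>\<alpha>. pd e_t' (w_c g) (fst p, snd p, \<alpha>))"
definition "mean_flux p = vavg (\<lambda>\<alpha>. flux pd g (fst p, snd p, \<alpha>))"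
definition "mean_d2 p = vavg (\<lambda>\<alpha>. d2 \<epsilon> pd g (fst p, snd p, \<alpha>))"
definition "energy z = 2 * (rr z)\<^sup>2 + (phi_c g z)\<^sup>2 / 2 + \<epsilon>\<^sup>2 * (PP z)\<^sup>2 / 2 + \<epsilon>\<^sup>2 * (MM z)\<^sup>2 / 2"
definition "energy_t z = 4 * rr z * dr e_t e_t' z + phi_c g z * pd e_t' (phi_c g) z
   + \<epsilon>\<^sup>2 * PP z * dP e_t' z + \<epsilon>\<^sup>2 * MM z * dM e_t' z"

lemmas C1_all = rho w phi j1 j2

lemma continuous_partial [continuous_intros]:
  "e \<in> Basis \<Longrightarrow> continuous_on S h \<Longrightarrow> continuous_on S (\<lambda>x. pd e (rho_c g) (h x))"
  "e' \<in> Basis \<Longrightarrow> continuous_on S k \<Longrightarrow> continuous_on S (\<lambda>x. pd e' (w_c g) (k x))"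
  "e' \<in> Basis \<Longrightarrow> continuous_on S k \<Longrightarrow> continuous_on S (\<lambda>x. pd e' (phi_c g) (k x))"
  "e' \<in> Basis \<Longrightarrow> continuous_on S k \<Longrightarrow> continuous_on S (\<lambda>x. pd e' (j1_c g) (k x))"
  "e' \<in> Basis \<Longrightarrow> continuous_on S k \<Longrightarrow> continuous_on S (\<lambda>x. pd e' (j2_c g) (k x))"
  using C1_all by (auto intro: continuous_on_UNIV_compose C1_continuous_partials)

lemma continuous_component [continuous_intros]:
  "continuous_on S h \<Longrightarrow> continuous_on S (\<lambda>x. rho_c g (h x))"
  "continuous_on S k \<Longrightarrow> continuous_on S (\<lambda>x. w_c g (k x))"
  "continuous_on S k \<Longrightarrow> continuous_on S (\<lambda>x. phi_c g (k x))"
  "continuous_on S k \<Longrightarrow> continuous_on S (\<lambda>x. j1_c g (k x))"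
  "continuous_on S k \<Longrightarrow> continuous_on S (\<lambda>x. j2_c g (k x))"
  using C1_all by (auto intro: continuous_on_UNIV_compose C1_continuous)

lemma continuous_flux: "continuous_on UNIV (flux pd g)"
  unfolding flux_def case_prod_beta' by (intro continuous_intros) (simp_all add: e_Basis)

lemma continuous_aux [continuous_intros]:
  "continuous_on S t \<Longrightarrow> continuous_on S (\<lambda>x. kap (t x))"
  "continuous_on S t \<Longrightarrow> continuous_on S (\<lambda>x. weight (t x))"
  "continuous_on S k \<Longrightarrow> continuous_on S (\<lambda>x. rr (k x))"
  "continuous_on S k \<Longrightarrow> continuous_on S (\<lambda>x. PP (k x))"
  "continuous_on S k \<Longrightarrow> continuous_on S (\<lambda>x. MM (k x))"
  "continuous_on S k \<Longrightarrow> continuous_on S (\<lambda>x. energy (k x))"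
  unfolding kap_def weight_def rr_def PP_def MM_def energy_def using eps by (auto intro!: continuous_intros)

lemma continuous_aux_d [continuous_intros]:
  "e \<in> Basis \<Longrightarrow> e' \<in> Basis \<Longrightarrow> continuous_on S k \<Longrightarrow> continuous_on S (\<lambda>x. dr e e' (k x))"
  "e' \<in> Basis \<Longrightarrow> continuous_on S k \<Longrightarrow> continuous_on S (\<lambda>x. dP e' (k x))"
  "e' \<in> Basis \<Longrightarrow> continuous_on S k \<Longrightarrow> continuous_on S (\<lambda>x. dM e' (k x))"
  unfolding dr_def dP_def dM_def by (auto intro!: continuous_intros)

lemma continuous_energy_t [continuous_intros]:
  "continuous_on S k \<Longrightarrow> continuous_on S (\<lambda>x. energy_t (k x))"
  unfolding energy_t_def by (intro continuous_intros) (simp_all add: e_Basis)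

lemma continuous_avg [continuous_intros]:
  "continuous_on S h \<Longrightarrow> continuous_on S (\<lambda>x. WW (h x))"
  "continuous_on S h \<Longrightarrow> continuous_on S (\<lambda>x. Wt (h x))"
  "continuous_on S h \<Longrightarrow> continuous_on S (\<lambda>x. mean_flux (h x))"
proof -
  have "continuous_on UNIV WW" "continuous_on UNIV Wt" "continuous_on UNIV mean_flux"
    unfolding WW_def[abs_def] Wt_def[abs_def] mean_flux_def[abs_def]
    by (rule continuous_on_vavg; use continuous_flux C1_continuous[OF w] C1_continuous_partials[OF w e_Basis(4)] in simp)+
  then show "continuous_on S h \<Longrightarrow> continuous_on S (\<lambda>x. WW (h x))"
    "continuous_on S h \<Longrightarrow> continuous_on S (\<lambda>x. Wt (h x))"
    "continuous_on S h \<Longrightarrow> continuous_on S (\<lambda>x. mean_flux (h x))"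
    by (auto intro: continuous_on_UNIV_compose)
qed

lemma d_eqs:
  "d1 pd pd g = (\<lambda>p. 2 * pd e_t (rho_c g) p + mean_flux p)"
  "d2 \<epsilon> pd g = (\<lambda>z. 2 * \<epsilon>\<^sup>2 * pd e_t' (w_c g) z + flux pd g z - mean_flux (fst z, fst (snd z)) + 2 * w_c g z)"
  "d3 \<epsilon> pd g = (\<lambda>z. pd e_t' (phi_c g) z + cos (snd (snd z)) * dM e_x' z + sin (snd (snd z)) * dP e_y' z + 1 / \<epsilon>\<^sup>2 * phi_c g z)"
  "d4 \<epsilon> pd pd g = (\<lambda>z. \<epsilon>\<^sup>2 * dP e_t' z + PP z + 2 * cos (snd (snd z)) * dr e_x e_x' z + sin (snd (snd z)) * pd e_y' (phi_c g) z)"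
  "d5 \<epsilon> pd pd g = (\<lambda>z. \<epsilon>\<^sup>2 * dM e_t' z + MM z + cos (snd (snd z)) * pd e_x' (phi_c g) z + 2 * sin (snd (snd z)) * dr e_y e_y' z)"
  by (auto simp: fun_eq_iff d1_def d2_def d3_def d4_def d5_def mean_flux_def dM_def dP_def PP_def MM_def dr_def)

lemma flux_eq: "flux pd g z = cos (snd (snd z)) * dP e_x' z + sin (snd (snd z)) * dM e_y' z"
  by (cases z) (simp add: flux_def dP_def dM_def)

lemma continuous_d:
  "continuous_on UNIV (d1 pd pd g)" "continuous_on UNIV (d2 \<epsilon> pd g)" "continuous_on UNIV (d3 \<epsilon> pd g)"
  "continuous_on UNIV (d4 \<epsilon> pd pd g)" "continuous_on UNIV (d5 \<epsilon> pd pd g)"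
  unfolding d_eqs flux_eq by (intro continuous_intros; simp add: e_Basis)+

text \<open>The flux occurs in \<open>d2\<close> only as the deviation from its mean, so averaging
  removes all spatial derivatives and leaves an ordinary differential equation in t for each
  x.\<close>

lemma mean_d2_eq: "mean_d2 p = 2 * \<epsilon>\<^sup>2 * Wt p + 2 * WW p"
proof -
  obtain t x where p: "p = (t, x)" by (cases p)
  have c: "continuous_on UNIV (\<lambda>\<alpha>. pd e_t' (w_c g) (t, x, \<alpha>))" "continuous_on UNIV (\<lambda>\<alpha>. flux pd g (t, x, \<alpha>))"
    "continuous_on UNIV (\<lambda>\<alpha>. w_c g (t, x, \<alpha>))"
    using continuous_flux C1_continuous[OF w] C1_continuous_partials[OF w e_Basis(4)]
    by (auto intro: continuous_on_section)
  have "mean_d2 p = vavg (\<lambda>\<alpha>. 2 * \<epsilon>\<^sup>2 * pd e_t' (w_c g) (t, x, \<alpha>) + (flux pd g (t, x, \<alpha>) + (- mean_flux p + 2 * w_c g (t, x, \<alpha>))))"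
    unfolding mean_d2_def d_eqs by (simp add: p algebra_simps)
  also have "\<dots> = 2 * \<epsilon>\<^sup>2 * Wt p + (mean_flux p + (- mean_flux p + 2 * WW p))"
    using vavg_linear[OF c] by (simp only: Wt_def mean_flux_def WW_def p fst_conv snd_conv)
  finally show ?thesis by simp
qed

lemma kap_facts: "0 < kap t" "0 \<le> t \<Longrightarrow> kap t \<le> 1" "kap 0 = 1"
  by (auto simp: kap_def)

lemma weight_facts: "0 < weight t" "0 \<le> t \<Longrightarrow> weight t \<le> 1" "weight 0 = 1" "t \<le> T \<Longrightarrow> exp (- (3 * T + 1)) \<le> weight t"
proof -
  show "t \<le> T \<Longrightarrow> exp (- (3 * T + 1)) \<le> weight t"
    using kap_facts(1)[of t] unfolding weight_def exp_le_cancel_iff by linarith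
  show "0 \<le> t \<Longrightarrow> weight t \<le> 1"
    using kap_facts(2)[of t] unfolding weight_def exp_le_one_iff by linarith
qed (simp_all add: weight_def kap_facts)

lemma deriv_kap: "(kap has_real_derivative - kap t / \<epsilon>\<^sup>2) (at t)"
proof -
  have "((\<lambda>t. exp (- t / \<epsilon>\<^sup>2)) has_real_derivative exp (- t / \<epsilon>\<^sup>2) * (- 1 / \<epsilon>\<^sup>2)) (at t)"
    by (intro DERIV_fun_exp DERIV_cdivide DERIV_minus DERIV_ident)
  then show ?thesis by (simp add: kap_def[abs_def])
qed

lemma deriv_weight: "(weight has_real_derivative - (3 + kap t / \<epsilon>\<^sup>2) * weight t) (at t)"
  unfolding weight_def[abs_def] by (auto intro!: derivative_eq_intros deriv_kap simp: algebra_simps)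

section \<open>The weighted energy identity\<close>

lemma derivs_t:
  "((\<lambda>t. rr (t, p)) has_real_derivative dr e_t e_t' (t, p)) (at t)"
  "((\<lambda>t. PP (t, p)) has_real_derivative dP e_t' (t, p)) (at t)"
  "((\<lambda>t. MM (t, p)) has_real_derivative dM e_t' (t, p)) (at t)"
  "((\<lambda>t. phi_c g (t, p)) has_real_derivative pd e_t' (phi_c g) (t, p)) (at t)"
  unfolding rr_def PP_def MM_def dr_def dP_def dM_def
  by (auto intro!: derivative_eq_intros C1_partials_tx(1)[OF rho] C1_partials_txv(1)[OF w]
      C1_partials_txv(1)[OF phi] C1_partials_txv(1)[OF j1] C1_partials_txv(1)[OF j2])

lemma derivs_x:
  "((\<lambda>x. rr (t, (x, y), \<alpha>)) has_real_derivative dr e_x e_x' (t, (x, y), \<alpha>)) (at x)"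
  "((\<lambda>x. PP (t, (x, y), \<alpha>)) has_real_derivative dP e_x' (t, (x, y), \<alpha>)) (at x)"
  "((\<lambda>x. MM (t, (x, y), \<alpha>)) has_real_derivative dM e_x' (t, (x, y), \<alpha>)) (at x)"
  "((\<lambda>x. phi_c g (t, (x, y), \<alpha>)) has_real_derivative pd e_x' (phi_c g) (t, (x, y), \<alpha>)) (at x)"
  unfolding rr_def PP_def MM_def dr_def dP_def dM_def
  by (auto intro!: derivative_eq_intros C1_partials_tx(2)[OF rho] C1_partials_txv(2)[OF w]
      C1_partials_txv(2)[OF phi] C1_partials_txv(2)[OF j1] C1_partials_txv(2)[OF j2])

lemma derivs_y:
  "((\<lambda>y. rr (t, (x, y), \<alpha>)) has_real_derivative dr e_y e_y' (t, (x, y), \<alpha>)) (at y)"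
  "((\<lambda>y. PP (t, (x, y), \<alpha>)) has_real_derivative dP e_y' (t, (x, y), \<alpha>)) (at y)"
  "((\<lambda>y. MM (t, (x, y), \<alpha>)) has_real_derivative dM e_y' (t, (x, y), \<alpha>)) (at y)"
  "((\<lambda>y. phi_c g (t, (x, y), \<alpha>)) has_real_derivative pd e_y' (phi_c g) (t, (x, y), \<alpha>)) (at y)"
  unfolding rr_def PP_def MM_def dr_def dP_def dM_def
  by (auto intro!: derivative_eq_intros C1_partials_tx(3)[OF rho] C1_partials_txv(3)[OF w]
      C1_partials_txv(3)[OF phi] C1_partials_txv(3)[OF j1] C1_partials_txv(3)[OF j2])

text \<open>\<open>Gt\<close>, \<open>Gx\<close>, \<open>Gy\<close> are the derivatives in t, x, y
  of the weighted energy, of \<open>Fx\<close> and of \<open>Fy\<close>; the weight depends on t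
  alone and passes through the spatial ones. The expanded forms serve the pointwise inequality, the
  primitives serve the fundamental theorem.\<close>

definition "Gt z = weight (fst z) * (- (3 + kap (fst z) / \<epsilon>\<^sup>2) * energy z + energy_t z)"
definition "Fx z = weight (fst z) * (cos (snd (snd z)) * (2 * rr z * PP z + phi_c g z * MM z))"
definition "Gx z = weight (fst z) * (cos (snd (snd z)) *
   (2 * dr e_x e_x' z * PP z + 2 * rr z * dP e_x' z + pd e_x' (phi_c g) z * MM z + phi_c g z * dM e_x' z))"
definition "Fy z = weight (fst z) * (sin (snd (snd z)) * (2 * rr z * MM z + phi_c g z * PP z))"
definition "Gy z = weight (fst z) * (sin (snd (snd z)) *
   (2 * dr e_y e_y' z * MM z + 2 * rr z * dM e_y' z + pd e_y' (phi_c g) z * PP z + phi_c g z * dP e_y' z))"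

lemma continuous_FG:
  "continuous_on UNIV Gt" "continuous_on UNIV Fx" "continuous_on UNIV Gx" "continuous_on UNIV Fy" "continuous_on UNIV Gy"
  unfolding Gt_def[abs_def] Fx_def[abs_def] Gx_def[abs_def] Fy_def[abs_def] Gy_def[abs_def]
  by (intro continuous_intros; use eps in \<open>simp add: e_Basis\<close>)+

lemma int_Gt: "(LINT z:TDV T a b|lborel. Gt z) =
   (LINT p:box a b \<times> angles|lborel. weight T * energy (T, p)) - (LINT p:box a b \<times> angles|lborel. energy (0, p))"
proof -
  have "(LINT z:TDV T a b|lborel. Gt z) =
   (LINT p:box a b \<times> angles|lborel. (\<lambda>z. weight (fst z) * energy z) (T, p))
     - (LINT p:box a b \<times> angles|lborel. (\<lambda>z. weight (fst z) * energy z) (0, p))"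
  proof (rule integral_TDV_dt)
    fix t p
    have "((\<lambda>t. energy (t, p)) has_real_derivative energy_t (t, p)) (at t)"
      unfolding energy_def energy_t_def
      by (auto intro!: derivative_eq_intros derivs_t simp: algebra_simps)
    then show "((\<lambda>t. weight (fst (t, p)) * energy (t, p)) has_real_derivative Gt (t, p)) (at t)"
      unfolding Gt_def by (auto intro!: derivative_eq_intros deriv_weight simp: algebra_simps)
  qed (auto intro!: continuous_intros continuous_FG)
  then show ?thesis by (simp add: weight_facts)
qed

lemma int_Gx: "(LINT z:TDV T a b|lborel. Gx z) =
    (LINT q:({0<..<T} \<times> {snd a<..<snd b}) \<times> angles|lborel. Fx (fst (fst q), (fst b, snd (fst q)), snd q))
    - (LINT q:({0<..<T} \<times> {snd a<..<snd b}) \<times> angles|lborel. Fx (fst (fst q), (fst a, snd (fst q)), snd q))"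
  by (rule integral_TDV_dx[OF continuous_FG(2,3)])
    (auto intro!: derivative_eq_intros derivs_x simp: Fx_def Gx_def algebra_simps)

lemma int_Gy: "(LINT z:TDV T a b|lborel. Gy z) =
    (LINT q:({0<..<T} \<times> {fst a<..<fst b}) \<times> angles|lborel. Fy (fst (fst q), (snd (fst q), snd b), snd q))
    - (LINT q:({0<..<T} \<times> {fst a<..<fst b}) \<times> angles|lborel. Fy (fst (fst q), (snd (fst q), snd a), snd q))"
  by (rule integral_TDV_dy[OF continuous_FG(4,5)])
    (auto intro!: derivative_eq_intros derivs_y simp: Fy_def Gy_def algebra_simps)

definition "DD t = \<epsilon>\<^sup>2 / (\<epsilon>\<^sup>2 + kap t)"

lemma denom_pos: "0 < \<epsilon>\<^sup>2 + kap t"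
  using kap_facts(1)[of t] eps by (simp add: add_pos_pos)

lemma continuous_DD [continuous_intros]: "continuous_on S t \<Longrightarrow> continuous_on S (\<lambda>x. DD (t x))"
  unfolding DD_def using denom_pos by (auto intro!: continuous_intros simp: less_imp_neq[symmetric])

lemma energy_balance:
  assumes z: "z \<in> TDV T a b"
  shows "Gt z + Gx z + Gy z \<le> weight (fst z) * (- energy z + 4 * DD (fst z) * (WW (fst z, fst (snd z)))\<^sup>2
     + ((d1 pd pd g (fst z, fst (snd z)))\<^sup>2 + (d2 \<epsilon> pd g z)\<^sup>2 + (d3 \<epsilon> pd g z)\<^sup>2 + (d4 \<epsilon> pd pd g z)\<^sup>2 + (d5 \<epsilon> pd pd g z)\<^sup>2)
     - 4 * rho_c g (fst z, fst (snd z)) * (w_c g z - WW (fst z, fst (snd z))))"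
proof -
  have t: "0 \<le> fst z" using z by (auto simp: TDV_def)
  note E = energy_density_inequality[OF eps kap_facts(1) kap_facts(2)[OF t] rr_def energy_def[of z] DD_def, of
    "d1 pd pd g (fst z, fst (snd z))" "pd e_t (rho_c g) (fst z, fst (snd z))" "mean_flux (fst z, fst (snd z))"
    "d2 \<epsilon> pd g z" "pd e_t' (w_c g) z" "cos (snd (snd z))" "dP e_x' z" "sin (snd (snd z))" "dM e_y' z"
    "d3 \<epsilon> pd g z" "pd e_t' (phi_c g) z" "dM e_x' z" "dP e_y' z" "d4 \<epsilon> pd pd g z" "dP e_t' z" "dr e_x e_x' z"
    "pd e_y' (phi_c g) z" "d5 \<epsilon> pd pd g z" "dM e_t' z" "pd e_x' (phi_c g) z" "dr e_y e_y' z" "WW (fst z, fst (snd z))"]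
  show ?thesis
    unfolding Gt_def Gx_def Gy_def distrib_left[symmetric]
  proof (rule mult_left_mono)
    show "- (3 + kap (fst z) / \<epsilon>\<^sup>2) * energy z + energy_t z + cos (snd (snd z)) *
   (2 * dr e_x e_x' z * PP z + 2 * rr z * dP e_x' z + pd e_x' (phi_c g) z * MM z + phi_c g z * dM e_x' z) + sin (snd (snd z)) *
   (2 * dr e_y e_y' z * MM z + 2 * rr z * dM e_y' z + pd e_y' (phi_c g) z * PP z + phi_c g z * dP e_y' z)
   \<le> - energy z + 4 * DD (fst z) * (WW (fst z, fst (snd z)))\<^sup>2
     + ((d1 pd pd g (fst z, fst (snd z)))\<^sup>2 + (d2 \<epsilon> pd g z)\<^sup>2 + (d3 \<epsilon> pd g z)\<^sup>2 + (d4 \<epsilon> pd pd g z)\<^sup>2 + (d5 \<epsilon> pd pd g z)\<^sup>2)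
     - 4 * rho_c g (fst z, fst (snd z)) * (w_c g z - WW (fst z, fst (snd z)))"
      using E by (simp add: d_eqs flux_eq energy_t_def dr_def[of e_t])
  qed (use weight_facts in \<open>simp add: less_imp_le\<close>)
qed

end

lemma set_integral_mono_continuous:
  fixes f g :: "'a::euclidean_space \<Rightarrow> real"
  assumes "continuous_on UNIV f" "continuous_on UNIV g" "bounded U" "U \<in> sets borel" "\<And>x. x \<in> U \<Longrightarrow> f x \<le> g x"
  shows "(LINT x:U|lborel. f x) \<le> (LINT x:U|lborel. g x)"
  using assms by (intro set_integral_mono set_integrable_continuous)

lemma set_integral_add_continuous:
  fixes f g :: "'a::euclidean_space \<Rightarrow> real"
  assumes "continuous_on UNIV f" "continuous_on UNIV g" "bounded U" "U \<in> sets borel"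
  shows "(LINT x:U|lborel. f x + g x) = (LINT x:U|lborel. f x) + (LINT x:U|lborel. g x)"
  using assms by (intro set_integral_add(2) set_integrable_continuous)

text \<open>The pattern is the integrated energy balance: energy, mean of w, five squared residuals,
  and the fluctuation term with its factor.\<close>

lemma set_integral_combination:
  fixes f1 :: "'a::euclidean_space \<Rightarrow> real"
  assumes "continuous_on UNIV f1" "continuous_on UNIV f2" "continuous_on UNIV f3"
    "continuous_on UNIV g1" "continuous_on UNIV g2" "continuous_on UNIV g3" "continuous_on UNIV g4" "continuous_on UNIV g5"
    "bounded U" "U \<in> sets borel"
  shows "(LINT z:U|lborel. - f1 z + f2 z + (g1 z + g2 z + g3 z + g4 z + g5 z) + c * f3 z) =
     - (LINT z:U|lborel. f1 z) + (LINT z:U|lborel. f2 z)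
     + ((LINT z:U|lborel. g1 z) + (LINT z:U|lborel. g2 z) + (LINT z:U|lborel. g3 z) + (LINT z:U|lborel. g4 z) + (LINT z:U|lborel. g5 z))
     + c * (LINT z:U|lborel. f3 z)"
proof -
  have i: "integrable lborel (\<lambda>z. indicator U z * f z)" if "continuous_on UNIV f" for f :: "'a \<Rightarrow> real"
    using set_integrable_continuous[OF that assms(9,10)] by (simp add: set_integrable_def)
  have eq: "indicator U z *\<^sub>R (- f1 z + f2 z + (g1 z + g2 z + g3 z + g4 z + g5 z) + c * f3 z) =
      - (indicator U z * f1 z) + indicator U z * f2 z + (indicator U z * g1 z + indicator U z * g2 z
        + indicator U z * g3 z + indicator U z * g4 z + indicator U z * g5 z) + c * (indicator U z * f3 z)" for z
    by (simp add: algebra_simps)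
  show ?thesis
    unfolding set_lebesgue_integral_def eq using i assms(1-8) by simp
qed

section \<open>Bounds for the mean of w, the lateral fluxes and the initial energy\<close>

context smooth_parity
begin

lemma continuous_d_compose [continuous_intros]:
  "continuous_on S h \<Longrightarrow> continuous_on S (\<lambda>x. d1 pd pd g (h x))"
  "continuous_on S k \<Longrightarrow> continuous_on S (\<lambda>x. d2 \<epsilon> pd g (k x))"
  "continuous_on S k \<Longrightarrow> continuous_on S (\<lambda>x. d3 \<epsilon> pd g (k x))"
  "continuous_on S k \<Longrightarrow> continuous_on S (\<lambda>x. d4 \<epsilon> pd pd g (k x))"
  "continuous_on S k \<Longrightarrow> continuous_on S (\<lambda>x. d5 \<epsilon> pd pd g (k x))"
  using continuous_d by (auto intro: continuous_on_UNIV_compose)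

lemma continuous_mean_d2 [continuous_intros]: "continuous_on S h \<Longrightarrow> continuous_on S (\<lambda>x. mean_d2 (h x))"
  unfolding mean_d2_eq by (intro continuous_intros)

lemma integral_lift:
  assumes "continuous_on UNIV f"
  shows "(LINT z:TDV T a b|lborel. f (fst z, fst (snd z))) = pi / 2 * (LINT p:TD T a b|lborel. f p)"
  by (subst integral_TDV_vavg)
    (auto intro!: continuous_on_UNIV_compose[OF assms] continuous_intros simp: vavg_const)

text \<open>The weight, \<open>rho_c\<close> and \<open>WW\<close> are constant in the angle, and w
  - \<open>WW\<close> has average zero, so the integral over each arc vanishes. This removes the
  unsigned term of the energy balance.\<close>

lemma fluctuation_orthogonal:
  "(LINT z:TDV T a b|lborel. weight (fst z) * (rho_c g (fst z, fst (snd z)) * (w_c g z - WW (fst z, fst (snd z))))) = 0"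
proof -
  have "vavg (\<lambda>\<alpha>. weight (fst p) * (rho_c g p * (w_c g (fst p, snd p, \<alpha>) - WW p))) = 0" for p
  proof -
    have c: "continuous_on UNIV (\<lambda>\<alpha>. w_c g (fst p, snd p, \<alpha>))"
      by (intro continuous_intros)
    have "vavg (\<lambda>\<alpha>. w_c g (fst p, snd p, \<alpha>) + (- WW p)) = WW p + (- WW p)"
      using c by (subst vavg_add) (auto simp: vavg_const WW_def)
    then show ?thesis by (simp add: vavg_cmult)
  qed
  then show ?thesis
    by (subst integral_TDV_vavg) (auto intro!: continuous_intros simp: set_lebesgue_integral_def)
qed

text \<open>The equation for \<open>WW\<close> contains no spatial derivative, so it is integrated
  in time on \<open>TD\<close> without boundary terms on the cell. Only the result is lifted to
  \<open>TDV\<close>, where Jensen's inequality replaces the averages by \<open>w_c\<close> and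
  \<open>d2\<close> themselves.\<close>

lemma mean_w_bound:
  "(LINT z:TDV T a b|lborel. weight (fst z) * (4 * DD (fst z) * (WW (fst z, fst (snd z)))\<^sup>2))
     \<le> 8 * \<epsilon>^4 * L2_sq (box a b \<times> angles) (\<lambda>z. w_c g (0, z)) + 4 * L2_sq (TDV T a b) (d2 \<epsilon> pd g)"
proof -
  let ?h = "\<lambda>p. 8 / (\<epsilon>\<^sup>2 + kap (fst p)) * \<epsilon>^4 * (WW p)\<^sup>2"
  let ?F = "\<lambda>p. weight (fst p) * ?h p"
  let ?G = "\<lambda>p. weight (fst p) * (- (3 + kap (fst p) / \<epsilon>\<^sup>2) * ?h p
    + (8 * (kap (fst p) / \<epsilon>\<^sup>2) / (\<epsilon>\<^sup>2 + kap (fst p))\<^sup>2 * \<epsilon>^4 * (WW p)\<^sup>2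
       + 8 / (\<epsilon>\<^sup>2 + kap (fst p)) * \<epsilon>^4 * (2 * WW p * Wt p)))"
  have ne: "\<epsilon>\<^sup>2 + kap s \<noteq> 0" for s using denom_pos[of s] by linarith
  have contF: "continuous_on UNIV ?F" and contG: "continuous_on UNIV ?G"
    using ne eps by (auto intro!: continuous_intros)
  have "((\<lambda>t. ?F (t, p)) has_real_derivative ?G (t, p)) (at t)" for t p
  proof -
    have W: "((\<lambda>t. WW (t, p)) has_real_derivative Wt (t, p)) (at t)"
      unfolding WW_def Wt_def using vavg_has_real_derivative[OF w] by simp
    have "((\<lambda>t. 8 / (\<epsilon>\<^sup>2 + kap t)) has_real_derivative 8 * (kap t / \<epsilon>\<^sup>2) / (\<epsilon>\<^sup>2 + kap t)\<^sup>2) (at t)"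
      using ne[of t] by (auto intro!: derivative_eq_intros deriv_kap simp: power2_eq_square)
    from DERIV_mult[OF deriv_weight DERIV_mult[OF DERIV_cmult_right[OF this, of "\<epsilon>^4"] DERIV_power[OF W, of 2]]]
    show ?thesis
      by (simp add: algebra_simps)
  qed
  from integral_TD_dt[OF contF contG this]
  have eq: "(LINT p:TD T a b|lborel. ?G p) = (LINT p:box a b|lborel. ?F (T, p)) - (LINT p:box a b|lborel. ?F (0, p))" .
  \<comment> \<open>The terminal value has the favourable sign and is dropped.\<close>
  have "0 \<le> (LINT p:box a b|lborel. ?F (T, p))"
    unfolding set_lebesgue_integral_def
    by (rule Bochner_Integration.integral_nonneg) (use weight_facts(1) denom_pos[of T] in \<open>auto intro!: mult_nonneg_nonneg divide_nonneg_nonneg simp: less_imp_le\<close>)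
  moreover have "(LINT p:box a b|lborel. ?F (0, p)) \<le> (LINT p:box a b|lborel. 8 * \<epsilon>^4 * (WW (0, p))\<^sup>2)"
  proof (rule set_integral_mono_continuous)
    fix p
    \<comment> \<open>Since \<open>kap 0 = 1\<close>, the prefactor is bounded uniformly at t = 0;
      it approaches size 1 / \<epsilon>^2 only as the layer decays.\<close>
    have "8 / (\<epsilon>\<^sup>2 + 1) \<le> (8::real)"
      by (subst pos_divide_le_eq) (auto intro: add_nonneg_pos)
    then have "8 / (\<epsilon>\<^sup>2 + 1) * (\<epsilon>^4 * (WW (0, p))\<^sup>2) \<le> 8 * (\<epsilon>^4 * (WW (0, p))\<^sup>2)"
      by (rule mult_right_mono) simp
    then show "?F (0, p) \<le> 8 * \<epsilon>^4 * (WW (0, p))\<^sup>2"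
      by (simp add: weight_facts kap_facts mult.assoc)
  qed (use ne in \<open>auto intro!: continuous_intros simp: bounded_box\<close>)
  moreover have "(LINT p:TD T a b|lborel. ?G p) \<le>
      (LINT p:TD T a b|lborel. - (weight (fst p) * (4 * DD (fst p) * (WW p)\<^sup>2)) + 4 * (mean_d2 p)\<^sup>2)"
  proof (rule set_integral_mono_continuous[OF contG])
    fix p assume "p \<in> TD T a b"
    then have t: "0 \<le> fst p" by (auto simp: TD_def)
    have "?G p \<le> weight (fst p) * (- 4 * DD (fst p) * (WW p)\<^sup>2 + 4 * (mean_d2 p)\<^sup>2)"
      by (rule mult_left_mono[OF mean_w_inequality[OF eps kap_facts(1) kap_facts(2)[OF t] DD_def mean_d2_eq]])
        (simp add: weight_facts less_imp_le)
    also have "\<dots> \<le> - (weight (fst p) * (4 * DD (fst p) * (WW p)\<^sup>2)) + 4 * (mean_d2 p)\<^sup>2"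
      using mult_right_mono[OF weight_facts(2)[OF t], of "4 * (mean_d2 p)\<^sup>2"] by (simp add: algebra_simps)
    finally show "?G p \<le> - (weight (fst p) * (4 * DD (fst p) * (WW p)\<^sup>2)) + 4 * (mean_d2 p)\<^sup>2" .
  qed (auto intro!: continuous_intros simp: domain_facts)
  moreover have "(LINT p:TD T a b|lborel. - (weight (fst p) * (4 * DD (fst p) * (WW p)\<^sup>2)) + 4 * (mean_d2 p)\<^sup>2) =
      - (LINT p:TD T a b|lborel. weight (fst p) * (4 * DD (fst p) * (WW p)\<^sup>2)) + 4 * L2_sq (TD T a b) mean_d2"
    by (subst set_integral_add_continuous)
      (auto intro!: continuous_intros simp: domain_facts L2_sq_def set_lebesgue_integral_def)
  ultimately have *: "(LINT p:TD T a b|lborel. weight (fst p) * (4 * DD (fst p) * (WW p)\<^sup>2))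
      \<le> 8 * \<epsilon>^4 * L2_sq (box a b) (\<lambda>x. WW (0, x)) + 4 * L2_sq (TD T a b) mean_d2"
    using eq by (simp add: L2_sq_def)
  have "(LINT z:TDV T a b|lborel. weight (fst z) * (4 * DD (fst z) * (WW (fst z, fst (snd z)))\<^sup>2)) =
      pi / 2 * (LINT p:TD T a b|lborel. weight (fst p) * (4 * DD (fst p) * (WW p)\<^sup>2))"
    using integral_lift[of "\<lambda>p. weight (fst p) * (4 * DD (fst p) * (WW p)\<^sup>2)"]
    by (simp add: continuous_intros continuous_on_mult continuous_on_power)
  also have "\<dots> \<le> pi / 2 * (8 * \<epsilon>^4 * L2_sq (box a b) (\<lambda>x. WW (0, x)) + 4 * L2_sq (TD T a b) mean_d2)"
    using * by (intro mult_left_mono) auto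
  also have "\<dots> = 8 * \<epsilon>^4 * (pi / 2 * L2_sq (box a b) (\<lambda>x. WW (0, x))) + 4 * (pi / 2 * L2_sq (TD T a b) mean_d2)"
    by (simp add: algebra_simps)
  also have "\<dots> \<le> 8 * \<epsilon>^4 * L2_sq (box a b \<times> angles) (\<lambda>z. w_c g (0, z)) + 4 * L2_sq (TDV T a b) (d2 \<epsilon> pd g)"
  proof (intro add_mono mult_left_mono)
    have "in_L2 (box a b \<times> angles) (\<lambda>z. w_c g (0, z))"
      by (intro in_L2_continuous continuous_intros) (auto simp: domain_facts)
    from L2_sq_vavg_box[OF this]
    show "pi / 2 * L2_sq (box a b) (\<lambda>x. WW (0, x)) \<le> L2_sq (box a b \<times> angles) (\<lambda>z. w_c g (0, z))"
      by (simp add: WW_def)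
    show "pi / 2 * L2_sq (TD T a b) mean_d2 \<le> L2_sq (TDV T a b) (d2 \<epsilon> pd g)"
      unfolding mean_d2_def[abs_def] by (intro in_L2_vavg in_L2_continuous continuous_d) (auto simp: domain_facts)
  qed (use eps in auto)
  finally show ?thesis .
qed

definition "sq_sum z = (rho_c g (fst z, fst (snd z)))\<^sup>2 + (w_c g z)\<^sup>2 + (phi_c g z)\<^sup>2 + (PP z)\<^sup>2 + (MM z)\<^sup>2"

text \<open>By \<epsilon> \<le> 1, \<epsilon>^2 w may be replaced by w. The fluxes carry no power of
  \<epsilon> in P and M, and the lateral risk measures w, P and M without such powers too, so the
  bound is uniform. \<open>p\<close> and \<open>m\<close> are free because the x- and y-fluxes
  exchange the roles of \<open>PP\<close> and \<open>MM\<close>.\<close>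

lemma flux_form_bound: "\<bar>2 * rr z * p + phi_c g z * m\<bar> \<le> 2 * ((rho_c g (fst z, fst (snd z)))\<^sup>2 + (w_c g z)\<^sup>2 + (phi_c g z)\<^sup>2 + p\<^sup>2 + m\<^sup>2)"
proof -
  have y: "\<bar>x * y\<bar> \<le> x\<^sup>2 / 2 + y\<^sup>2 / 2" for x y :: real
    using zero_le_power2[of "\<bar>x\<bar> - \<bar>y\<bar>"] by (simp add: power2_diff abs_mult)
  have "(\<epsilon>\<^sup>2)\<^sup>2 \<le> 1" using eps by (intro power_le_one) auto
  then have "(\<epsilon>\<^sup>2 * w_c g z)\<^sup>2 \<le> (w_c g z)\<^sup>2"
    using mult_right_mono[of "(\<epsilon>\<^sup>2)\<^sup>2" 1 "(w_c g z)\<^sup>2"] by (simp add: power_mult_distrib)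
  moreover have "(rr z)\<^sup>2 \<le> 2 * (rho_c g (fst z, fst (snd z)))\<^sup>2 + 2 * (\<epsilon>\<^sup>2 * w_c g z)\<^sup>2"
    using zero_le_power2[of "rho_c g (fst z, fst (snd z)) - \<epsilon>\<^sup>2 * w_c g z"] unfolding rr_def power2_diff power2_sum by linarith
  ultimately have r: "(rr z)\<^sup>2 \<le> 2 * (rho_c g (fst z, fst (snd z)))\<^sup>2 + 2 * (w_c g z)\<^sup>2" by linarith
  have "\<bar>2 * rr z * p + phi_c g z * m\<bar> \<le> 2 * \<bar>rr z * p\<bar> + \<bar>phi_c g z * m\<bar>"
    by (simp add: abs_mult order_trans[OF abs_triangle_ineq])
  then show ?thesis
    using y[of "rr z" p] y[of "phi_c g z" m] r zero_le_power2[of p] zero_le_power2[of m] zero_le_power2[of "phi_c g z"]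
    unfolding distrib_left by linarith
qed

lemma F_bound: "0 \<le> fst z \<Longrightarrow> \<bar>Fx z\<bar> \<le> 2 * sq_sum z" "0 \<le> fst z \<Longrightarrow> \<bar>Fy z\<bar> \<le> 2 * sq_sum z"
proof -
  have *: "\<bar>weight (fst z) * (c * k)\<bar> \<le> 2 * sq_sum z" if "0 \<le> fst z" "\<bar>c\<bar> \<le> 1" "\<bar>k\<bar> \<le> 2 * sq_sum z" for c k :: real
  proof -
    have "\<bar>weight (fst z) * (c * k)\<bar> = weight (fst z) * (\<bar>c\<bar> * \<bar>k\<bar>)"
      using weight_facts(1)[of "fst z"] by (simp add: abs_mult)
    also have "\<dots> \<le> 1 * (1 * \<bar>k\<bar>)"
      using that weight_facts(1,2)[of "fst z"] by (intro mult_mono) auto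
    finally show ?thesis using that by simp
  qed
  show "0 \<le> fst z \<Longrightarrow> \<bar>Fx z\<bar> \<le> 2 * sq_sum z"
    unfolding Fx_def by (rule *) (use flux_form_bound[of z "PP z" "MM z"] in \<open>auto simp: sq_sum_def\<close>)
  show "0 \<le> fst z \<Longrightarrow> \<bar>Fy z\<bar> \<le> 2 * sq_sum z"
    unfolding Fy_def by (rule *) (use flux_form_bound[of z "MM z" "PP z"] in \<open>auto simp: sq_sum_def\<close>)
qed

lemma continuous_sq_sum [continuous_intros]: "continuous_on S k \<Longrightarrow> continuous_on S (\<lambda>x. sq_sum (k x))"
  unfolding sq_sum_def by (intro continuous_intros)

lemma continuous_F [continuous_intros]:
  "continuous_on S k \<Longrightarrow> continuous_on S (\<lambda>x. Fx (k x))" "continuous_on S k \<Longrightarrow> continuous_on S (\<lambda>x. Fy (k x))"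
  by (auto intro: continuous_on_UNIV_compose continuous_FG)

text \<open>For a general tuple the fluxes through opposite faces need not cancel, so each is
  bounded in absolute value; the orientation, the sign s in \<open>le\<close>, then plays no
  part.\<close>

lemma lateral_fluxes_bound:
  "- (LINT z:TDV T a b|lborel. Gx z) - (LINT z:TDV T a b|lborel. Gy z)
     \<le> 2 * faces_integral (map with_angle (lateral_faces T a b)) sq_sum"
proof -
  have le: "s * (LINT q:({0<..<T} \<times> {l<..<u}) \<times> angles|lborel. F (fst (fst q), h (snd (fst q)), snd q))
      \<le> 2 * (LINT q:({0<..<T} \<times> {l<..<u}) \<times> angles|lborel. sq_sum (fst (fst q), h (snd (fst q)), snd q))"
    if F: "\<And>z. 0 \<le> fst z \<Longrightarrow> \<bar>F z\<bar> \<le> 2 * sq_sum z" "continuous_on UNIV F" and h: "continuous_on UNIV h" and s: "\<bar>s\<bar> = 1"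
    for F :: "txv \<Rightarrow> real" and h s and l u :: real
  proof -
    note c = continuous_on_UNIV_compose[OF F(2)] continuous_on_UNIV_compose[OF h]
    have "(LINT q:({0<..<T} \<times> {l<..<u}) \<times> angles|lborel. s * F (fst (fst q), h (snd (fst q)), snd q))
      \<le> (LINT q:({0<..<T} \<times> {l<..<u}) \<times> angles|lborel. 2 * sq_sum (fst (fst q), h (snd (fst q)), snd q))"
    proof (rule set_integral_mono_continuous)
      fix q :: "(real \<times> real) \<times> real" assume "q \<in> ({0<..<T} \<times> {l<..<u}) \<times> angles"
      then have "\<bar>F (fst (fst q), h (snd (fst q)), snd q)\<bar> \<le> 2 * sq_sum (fst (fst q), h (snd (fst q)), snd q)"
        by (intro F) auto
      then show "s * F (fst (fst q), h (snd (fst q)), snd q) \<le> 2 * sq_sum (fst (fst q), h (snd (fst q)), snd q)"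
        using s abs_ge_self[of "s * F (fst (fst q), h (snd (fst q)), snd q)"] by (simp add: abs_mult)
    qed (auto intro!: continuous_intros c simp: borel_Times angles_facts bounded_Times)
    then show ?thesis by simp
  qed
  have x: "- (LINT z:TDV T a b|lborel. Gx z) \<le>
      2 * (LINT q:({0<..<T} \<times> {snd a<..<snd b}) \<times> angles|lborel. sq_sum (fst (fst q), (fst b, snd (fst q)), snd q)) +
      2 * (LINT q:({0<..<T} \<times> {snd a<..<snd b}) \<times> angles|lborel. sq_sum (fst (fst q), (fst a, snd (fst q)), snd q))"
    using le[of Fx "\<lambda>s. (fst b, s)" "-1" "snd a" "snd b"] le[of Fx "\<lambda>s. (fst a, s)" 1 "snd a" "snd b"]
    unfolding int_Gx by (simp add: F_bound continuous_FG continuous_on_Pair)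
  have y: "- (LINT z:TDV T a b|lborel. Gy z) \<le>
      2 * (LINT q:({0<..<T} \<times> {fst a<..<fst b}) \<times> angles|lborel. sq_sum (fst (fst q), (snd (fst q), snd b), snd q)) +
      2 * (LINT q:({0<..<T} \<times> {fst a<..<fst b}) \<times> angles|lborel. sq_sum (fst (fst q), (snd (fst q), snd a), snd q))"
    using le[of Fy "\<lambda>s. (s, snd b)" "-1" "fst a" "fst b"] le[of Fy "\<lambda>s. (s, snd a)" 1 "fst a" "fst b"]
    unfolding int_Gy by (simp add: F_bound continuous_FG continuous_on_Pair)
  show ?thesis
    using x y by (simp add: faces_integral_def lateral_faces_def with_angle_def case_prod_beta')
qed

text \<open>Splitting 2 r^2 gives 4 \<rho>^2 + 4 \<epsilon>^4 w^2, with the powers of \<epsilon> of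
  the initial risk; the arc length pi / 2 turns the 4 into 2 pi for the angle-independent
  \<rho>.\<close>

lemma initial_energy_bound:
  "(LINT p:box a b \<times> angles|lborel. energy (0, p)) \<le>
     2 * pi * L2_sq (box a b) (\<lambda>x. rho_c g (0, x)) + 4 * \<epsilon>^4 * L2_sq (box a b \<times> angles) (\<lambda>z. w_c g (0, z))
     + L2_sq (box a b \<times> angles) (\<lambda>z. phi_c g (0, z)) + \<epsilon>\<^sup>2 * L2_sq (box a b \<times> angles) (\<lambda>z. PP (0, z))
     + \<epsilon>\<^sup>2 * L2_sq (box a b \<times> angles) (\<lambda>z. MM (0, z))"
proof -
  let ?U = "box a b \<times> angles"
  have "(LINT p:?U|lborel. energy (0, p)) \<le>
     (LINT p:?U|lborel. 4 * (rho_c g (0, fst p))\<^sup>2 + 4 * \<epsilon>^4 * (w_c g (0, p))\<^sup>2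
        + (phi_c g (0, p))\<^sup>2 + \<epsilon>\<^sup>2 * (PP (0, p))\<^sup>2 + \<epsilon>\<^sup>2 * (MM (0, p))\<^sup>2)"
  proof (rule set_integral_mono_continuous)
    fix p
    have "(rr (0, p))\<^sup>2 \<le> 2 * (rho_c g (0, fst p))\<^sup>2 + 2 * (\<epsilon>\<^sup>2 * w_c g (0, p))\<^sup>2"
      using zero_le_power2[of "rho_c g (0, fst p) - \<epsilon>\<^sup>2 * w_c g (0, p)"]
      unfolding rr_def power2_diff power2_sum fst_conv snd_conv by linarith
    moreover have "(\<epsilon>\<^sup>2 * w_c g (0, p))\<^sup>2 = \<epsilon>^4 * (w_c g (0, p))\<^sup>2"
      by (simp add: power_mult_distrib)
    moreover have "0 \<le> \<epsilon>\<^sup>2 * (PP (0, p))\<^sup>2" "0 \<le> \<epsilon>\<^sup>2 * (MM (0, p))\<^sup>2" "0 \<le> (phi_c g (0, p))\<^sup>2" by simp_all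
    ultimately show "energy (0, p) \<le> 4 * (rho_c g (0, fst p))\<^sup>2 + 4 * \<epsilon>^4 * (w_c g (0, p))\<^sup>2
        + (phi_c g (0, p))\<^sup>2 + \<epsilon>\<^sup>2 * (PP (0, p))\<^sup>2 + \<epsilon>\<^sup>2 * (MM (0, p))\<^sup>2"
      unfolding energy_def by linarith
  qed (auto intro!: continuous_intros simp: domain_facts)
  also have "\<dots> = 4 * L2_sq ?U (\<lambda>z. rho_c g (0, fst z)) + 4 * \<epsilon>^4 * L2_sq ?U (\<lambda>z. w_c g (0, z))
     + L2_sq ?U (\<lambda>z. phi_c g (0, z)) + \<epsilon>\<^sup>2 * L2_sq ?U (\<lambda>z. PP (0, z)) + \<epsilon>\<^sup>2 * L2_sq ?U (\<lambda>z. MM (0, z))"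
    by (simp add: L2_sq_def set_integral_add_continuous domain_facts continuous_intros continuous_on_add
        continuous_on_mult continuous_on_power)
  also have "L2_sq ?U (\<lambda>z. rho_c g (0, fst z)) = pi / 2 * L2_sq (box a b) (\<lambda>x. rho_c g (0, x))"
  proof -
    have "in_L2 (box a b) (\<lambda>x. rho_c g (0, x))"
      by (intro in_L2_continuous continuous_intros) (auto simp: bounded_box)
    from in_L2_fst(2)[OF this angles_facts(1,3)] show ?thesis by (simp add: angles_facts)
  qed
  finally show ?thesis by simp
qed

lemma faces_integral_sq_sum:
  "faces_integral (map with_angle (lateral_faces T a b)) sq_sum =
     pi / 2 * faces_L2_sq (lateral_faces T a b) (rho_c g)
     + faces_L2_sq (map with_angle (lateral_faces T a b)) (w_c g)
     + faces_L2_sq (map with_angle (lateral_faces T a b)) (phi_c g)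
     + faces_L2_sq (map with_angle (lateral_faces T a b)) PP
     + faces_L2_sq (map with_angle (lateral_faces T a b)) MM"
proof -
  have *: "(LINT q:({0<..<T} \<times> {l<..<u}) \<times> angles|lborel. sq_sum (fst (fst q), h (snd (fst q)), snd q)) =
      pi / 2 * L2_sq ({0<..<T} \<times> {l<..<u}) (\<lambda>q. rho_c g (fst q, h (snd q)))
      + L2_sq (({0<..<T} \<times> {l<..<u}) \<times> angles) (\<lambda>q. w_c g (fst (fst q), h (snd (fst q)), snd q))
      + L2_sq (({0<..<T} \<times> {l<..<u}) \<times> angles) (\<lambda>q. phi_c g (fst (fst q), h (snd (fst q)), snd q))
      + L2_sq (({0<..<T} \<times> {l<..<u}) \<times> angles) (\<lambda>q. PP (fst (fst q), h (snd (fst q)), snd q))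
      + L2_sq (({0<..<T} \<times> {l<..<u}) \<times> angles) (\<lambda>q. MM (fst (fst q), h (snd (fst q)), snd q))"
    if h: "continuous_on UNIV h" for h and l u :: real
  proof -
    let ?U = "({0<..<T} \<times> {l<..<u}) \<times> angles"
    have U: "bounded ?U" "?U \<in> sets borel" "bounded ({0<..<T} \<times> {l<..<u})" "{0<..<T} \<times> {l<..<u} \<in> sets borel"
      by (auto simp: borel_Times angles_facts bounded_Times)
    have h': "continuous_on S k \<Longrightarrow> continuous_on S (\<lambda>x. h (k x))" for S :: "((real \<times> real) \<times> real) set" and k
      by (rule continuous_on_UNIV_compose[OF h])
    have h'': "continuous_on S k \<Longrightarrow> continuous_on S (\<lambda>x. h (k x))" for S :: "(real \<times> real) set" and k
      by (rule continuous_on_UNIV_compose[OF h])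
    have c: "continuous_on UNIV (\<lambda>q. rho_c g (fst q, h (snd q)))"
      by (intro continuous_intros h'')
    have "L2_sq ?U (\<lambda>q. (\<lambda>q. rho_c g (fst q, h (snd q))) (fst q)) = pi / 2 * L2_sq ({0<..<T} \<times> {l<..<u}) (\<lambda>q. rho_c g (fst q, h (snd q)))"
      using in_L2_fst(2)[OF in_L2_continuous[OF c U(3,4)] angles_facts(1,3)] by (simp add: angles_facts)
    then show ?thesis
      unfolding sq_sum_def L2_sq_def
      by (simp add: set_integral_add_continuous U h' continuous_intros continuous_on_add
        continuous_on_mult continuous_on_power)
  qed
  show ?thesis
    using *[of "\<lambda>s. (fst a, s)" "snd a" "snd b"] *[of "\<lambda>s. (fst b, s)" "snd a" "snd b"]
      *[of "\<lambda>s. (s, snd a)" "fst a" "fst b"] *[of "\<lambda>s. (s, snd b)" "fst a" "fst b"]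
    by (simp add: faces_integral_def faces_L2_sq_def lateral_faces_def with_angle_def case_prod_beta' comp_def
        continuous_on_Pair distrib_left)
qed

section \<open>The estimate for smooth tuples\<close>

lemma weighted_energy_bound:
  "(LINT z:TDV T a b|lborel. weight (fst z) * energy z) \<le>
     (LINT p:box a b \<times> angles|lborel. energy (0, p))
     + 2 * faces_integral (map with_angle (lateral_faces T a b)) sq_sum
     + (LINT z:TDV T a b|lborel. weight (fst z) * (4 * DD (fst z) * (WW (fst z, fst (snd z)))\<^sup>2))
     + (pi / 2 * L2_sq (TD T a b) (d1 pd pd g) + L2_sq (TDV T a b) (d2 \<epsilon> pd g) + L2_sq (TDV T a b) (d3 \<epsilon> pd g)
        + L2_sq (TDV T a b) (d4 \<epsilon> pd pd g) + L2_sq (TDV T a b) (d5 \<epsilon> pd pd g))"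
proof -
  let ?U = "TDV T a b"
  let ?p = "\<lambda>z :: txv. (fst z, fst (snd z))"
  note U = domain_facts(4,3)
  let ?R = "\<lambda>z. - (weight (fst z) * energy z) + weight (fst z) * (4 * DD (fst z) * (WW (?p z))\<^sup>2)
     + ((d1 pd pd g (?p z))\<^sup>2 + (d2 \<epsilon> pd g z)\<^sup>2 + (d3 \<epsilon> pd g z)\<^sup>2 + (d4 \<epsilon> pd pd g z)\<^sup>2 + (d5 \<epsilon> pd pd g z)\<^sup>2)
     + (- 4) * (weight (fst z) * (rho_c g (?p z) * (w_c g z - WW (?p z))))"
  have "(LINT z:?U|lborel. Gt z) + (LINT z:?U|lborel. Gx z) + (LINT z:?U|lborel. Gy z) = (LINT z:?U|lborel. Gt z + Gx z + Gy z)"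
    using U continuous_FG by (simp add: set_integral_add_continuous continuous_on_add)
  also have "\<dots> \<le> (LINT z:?U|lborel. ?R z)"
  proof (rule set_integral_mono_continuous)
    fix z assume z: "z \<in> ?U"
    then have t: "0 \<le> fst z" by (auto simp: TDV_def)
    let ?s = "(d1 pd pd g (?p z))\<^sup>2 + (d2 \<epsilon> pd g z)\<^sup>2 + (d3 \<epsilon> pd g z)\<^sup>2 + (d4 \<epsilon> pd pd g z)\<^sup>2 + (d5 \<epsilon> pd pd g z)\<^sup>2"
    \<comment> \<open>The weight is dropped only on the squared residuals. The energy has a negative
      sign, the fluctuation has none, and \<open>mean_w_bound\<close> is stated with the
      weight.\<close>
    have "weight (fst z) * ?s \<le> 1 * ?s"
      by (rule mult_right_mono) (use weight_facts(2)[OF t] in auto)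
    then show "Gt z + Gx z + Gy z \<le> ?R z"
      using energy_balance[OF z] by (simp add: algebra_simps)
  qed (use U in \<open>auto intro!: continuous_intros continuous_FG\<close>)
  also have "\<dots> = - (LINT z:?U|lborel. weight (fst z) * energy z) + (LINT z:?U|lborel. weight (fst z) * (4 * DD (fst z) * (WW (?p z))\<^sup>2))
     + (L2_sq ?U (\<lambda>z. d1 pd pd g (?p z)) + L2_sq ?U (d2 \<epsilon> pd g) + L2_sq ?U (d3 \<epsilon> pd g)
        + L2_sq ?U (d4 \<epsilon> pd pd g) + L2_sq ?U (d5 \<epsilon> pd pd g))
     + (- 4) * (LINT z:?U|lborel. weight (fst z) * (rho_c g (?p z) * (w_c g z - WW (?p z))))"
    (is "_ = ?Q")
    unfolding L2_sq_def
    by (rule set_integral_combination; intro continuous_intros U)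
  also have "L2_sq ?U (\<lambda>z. d1 pd pd g (?p z)) = pi / 2 * L2_sq (TD T a b) (d1 pd pd g)"
    by (rule in_L2_lift(2)) (intro in_L2_continuous continuous_d, auto simp: domain_facts)
  finally have "(LINT z:?U|lborel. Gt z) + (LINT z:?U|lborel. Gx z) + (LINT z:?U|lborel. Gy z)
    \<le> - (LINT z:?U|lborel. weight (fst z) * energy z) + (LINT z:?U|lborel. weight (fst z) * (4 * DD (fst z) * (WW (?p z))\<^sup>2))
     + (pi / 2 * L2_sq (TD T a b) (d1 pd pd g) + L2_sq ?U (d2 \<epsilon> pd g) + L2_sq ?U (d3 \<epsilon> pd g)
        + L2_sq ?U (d4 \<epsilon> pd pd g) + L2_sq ?U (d5 \<epsilon> pd pd g))"
    unfolding fluctuation_orthogonal by simp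
  \<comment> \<open>Only the space-time integral of the energy is wanted, so its value at time T can
    be discarded.\<close>
  moreover have "0 \<le> (LINT p:box a b \<times> angles|lborel. weight T * energy (T, p))"
    unfolding set_lebesgue_integral_def
    by (rule Bochner_Integration.integral_nonneg) (use weight_facts(1)[of T] in \<open>auto simp: energy_def intro!: mult_nonneg_nonneg add_nonneg_nonneg\<close>)
  ultimately show ?thesis
    using int_Gt lateral_fluxes_bound by linarith
qed

text \<open>f is the sum of r, \<phi> / 2, \<epsilon> P / 2 and \<epsilon> M / 2, and the four-term
  Cauchy-Schwarz inequality yields exactly twice the energy: the powers of \<epsilon> in the energy
  are those of the total error.\<close>

lemma reconstruct_energy: "(reconstruct \<epsilon> g z)\<^sup>2 \<le> 2 * energy z"
proof -
  have 4: "(x1 + x2 + x3 + x4)\<^sup>2 \<le> 4 * (x1\<^sup>2 + x2\<^sup>2 + x3\<^sup>2 + x4\<^sup>2)" for x1 x2 x3 x4 :: real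
    using zero_le_power2[of "x1 - x2"] zero_le_power2[of "x1 - x3"] zero_le_power2[of "x1 - x4"]
      zero_le_power2[of "x2 - x3"] zero_le_power2[of "x2 - x4"] zero_le_power2[of "x3 - x4"]
    by (simp add: power2_eq_square algebra_simps)
  have "reconstruct \<epsilon> g z = rr z + phi_c g z / 2 + \<epsilon> * PP z / 2 + \<epsilon> * MM z / 2"
    by (cases z) (simp add: reconstruct_def rr_def PP_def MM_def algebra_simps)
  then show ?thesis
    using 4[of "rr z" "phi_c g z / 2" "\<epsilon> * PP z / 2" "\<epsilon> * MM z / 2"]
    by (simp add: energy_def power_divide power_mult_distrib)
qed

lemma continuous_reconstruct: "continuous_on UNIV (reconstruct \<epsilon> g)"
  unfolding reconstruct_def case_prod_beta' prod.collapse by (intro continuous_intros) auto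

text \<open>\<open>exp (3 * T + 1)\<close> inverts the lower bound of the weight. The factor 24 is 2
  (4 + 8), dictated by the initial value of w, which enters with 4 through the energy and with 8
  through \<open>WW\<close>; the 2 is that of \<open>reconstruct_energy\<close>.\<close>

lemma smooth_bound:
  "L2_sq (TDV T a b) (reconstruct \<epsilon> g) \<le> 24 * exp (3 * T + 1) *
     (L2_sq (TD T a b) (d1 pd pd g) + L2_sq (TDV T a b) (d2 \<epsilon> pd g) + L2_sq (TDV T a b) (d3 \<epsilon> pd g)
        + L2_sq (TDV T a b) (d4 \<epsilon> pd pd g) + L2_sq (TDV T a b) (d5 \<epsilon> pd pd g)
      + (L2_sq (box a b) (\<lambda>x. rho_c g (0, x)) + \<epsilon>^4 * L2_sq (box a b \<times> angles) (\<lambda>z. w_c g (0, z))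
        + L2_sq (box a b \<times> angles) (\<lambda>z. phi_c g (0, z)) + \<epsilon>\<^sup>2 * L2_sq (box a b \<times> angles) (\<lambda>z. j1_c g (0, z) + j2_c g (0, z))
        + \<epsilon>\<^sup>2 * L2_sq (box a b \<times> angles) (\<lambda>z. j2_c g (0, z) - j1_c g (0, z)))
      + (faces_L2_sq (lateral_faces T a b) (rho_c g)
        + faces_L2_sq (map with_angle (lateral_faces T a b)) (w_c g)
        + faces_L2_sq (map with_angle (lateral_faces T a b)) (phi_c g)
        + faces_L2_sq (map with_angle (lateral_faces T a b)) (\<lambda>z. j1_c g z + j2_c g z)
        + faces_L2_sq (map with_angle (lateral_faces T a b)) (\<lambda>z. j2_c g z - j1_c g z)))"
    (is "_ \<le> 24 * _ * (?r1 + ?r2 + ?r3 + ?r4 + ?r5 + (?i1 + ?i2 + ?i3 + ?i4 + ?i5) + (?b1 + ?b2 + ?b3 + ?b4 + ?b5))")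
proof -
  have nn: "0 \<le> ?r1" "0 \<le> ?r2" "0 \<le> ?r3" "0 \<le> ?r4" "0 \<le> ?r5" "0 \<le> ?i1" "0 \<le> ?i2" "0 \<le> ?i3" "0 \<le> ?i4" "0 \<le> ?i5"
    by (simp_all add: L2_sq_nonneg)
  have fn: "0 \<le> faces_L2_sq \<Gamma> f" for \<Gamma> and f :: "'x \<Rightarrow> real"
    unfolding faces_L2_sq_def by (auto intro!: sum_list_nonneg simp: L2_sq_nonneg)
  have "exp (- (3 * T + 1)) * L2_sq (TDV T a b) (reconstruct \<epsilon> g) \<le> 2 * (LINT z:TDV T a b|lborel. weight (fst z) * energy z)"
  proof -
    have "(LINT z:TDV T a b|lborel. exp (- (3 * T + 1)) * (reconstruct \<epsilon> g z)\<^sup>2) \<le> (LINT z:TDV T a b|lborel. 2 * (weight (fst z) * energy z))"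
    proof (rule set_integral_mono_continuous)
      fix z assume "z \<in> TDV T a b"
      then have "exp (- (3 * T + 1)) \<le> weight (fst z)"
        by (intro weight_facts) (auto simp: TDV_def)
      then have "exp (- (3 * T + 1)) * (reconstruct \<epsilon> g z)\<^sup>2 \<le> weight (fst z) * (2 * energy z)"
        using reconstruct_energy[of z] weight_facts(1)[of "fst z"] by (intro mult_mono) auto
      then show "exp (- (3 * T + 1)) * (reconstruct \<epsilon> g z)\<^sup>2 \<le> 2 * (weight (fst z) * energy z)" by simp
    qed (auto intro!: continuous_intros continuous_on_UNIV_compose[OF continuous_reconstruct] simp: domain_facts)
    then show ?thesis by (simp add: L2_sq_def)
  qed
  also have "\<dots> \<le> 24 * (?r1 + ?r2 + ?r3 + ?r4 + ?r5 + (?i1 + ?i2 + ?i3 + ?i4 + ?i5) + (?b1 + ?b2 + ?b3 + ?b4 + ?b5))"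
  proof -
    \<comment> \<open>With pi < 4 the coefficients containing pi stay below the 12 forced by the
      initial w; the face term appears twice, hence 6.\<close>
    have "pi / 2 * ?r1 \<le> 12 * ?r1" "2 * pi * ?i1 \<le> 12 * ?i1" "pi / 2 * ?b1 \<le> 6 * ?b1"
      using pi_less_4 nn fn by (auto intro!: mult_right_mono)
    moreover have "PP = (\<lambda>z. j1_c g z + j2_c g z)" "MM = (\<lambda>z. j2_c g z - j1_c g z)"
      by (auto simp: PP_def MM_def)
    ultimately show ?thesis
      using weighted_energy_bound mean_w_bound initial_energy_bound faces_integral_sq_sum nn
        fn[of "lateral_faces T a b" "rho_c g"] fn[of "map with_angle (lateral_faces T a b)" "w_c g"]
        fn[of "map with_angle (lateral_faces T a b)" "phi_c g"] fn[of "map with_angle (lateral_faces T a b)" PP]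
        fn[of "map with_angle (lateral_faces T a b)" MM]
      by simp
  qed
  finally have "exp (3 * T + 1) * (exp (- (3 * T + 1)) * L2_sq (TDV T a b) (reconstruct \<epsilon> g)) \<le>
      exp (3 * T + 1) * (24 * (?r1 + ?r2 + ?r3 + ?r4 + ?r5 + (?i1 + ?i2 + ?i3 + ?i4 + ?i5) + (?b1 + ?b2 + ?b3 + ?b4 + ?b5)))"
    by (rule mult_left_mono) simp
  then show ?thesis
    unfolding mult.assoc[symmetric] mult_exp_exp by (simp add: mult.commute[of 24])
qed

end

section \<open>Passage to the exact solution\<close>

text \<open>This says that the limit superior of X is at most c. A convergent majorant is easier to
  handle, since majorants add and scale like limits.\<close>

definition asymp_le :: "(nat \<Rightarrow> real) \<Rightarrow> real \<Rightarrow> bool" where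
  "asymp_le X c \<longleftrightarrow> (\<exists>B. (\<forall>n. X n \<le> B n) \<and> B \<longlonglongrightarrow> c)"

lemma asymp_leI: "(\<And>n. X n \<le> B n) \<Longrightarrow> B \<longlonglongrightarrow> c \<Longrightarrow> asymp_le X c"
  unfolding asymp_le_def by blast

lemma asymp_le_add:
  assumes "asymp_le X c" "asymp_le Y d"
  shows "asymp_le (\<lambda>n. X n + Y n) (c + d)"
proof -
  obtain B D where "\<forall>n. X n \<le> B n" "B \<longlonglongrightarrow> c" "\<forall>n. Y n \<le> D n" "D \<longlonglongrightarrow> d"
    using assms unfolding asymp_le_def by blast
  then show ?thesis
    by (intro asymp_leI[of _ "\<lambda>n. B n + D n"] add_mono tendsto_add) auto
qed

lemma asymp_le_mult:
  assumes "0 \<le> k" "asymp_le X c"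
  shows "asymp_le (\<lambda>n. k * X n) (k * c)"
proof -
  obtain B where "\<forall>n. X n \<le> B n" "B \<longlonglongrightarrow> c"
    using assms unfolding asymp_le_def by blast
  with assms(1) show ?thesis
    by (intro asymp_leI[of _ "\<lambda>n. k * B n"] mult_left_mono tendsto_mult_left) auto
qed

lemma asymp_le_const: "asymp_le X c \<Longrightarrow> (\<And>n. a \<le> X n) \<Longrightarrow> a \<le> c"
  unfolding asymp_le_def by (meson LIMSEQ_le_const order_trans)

text \<open>The factor 2 comes from the crude splitting of a square of a sum; it spares the
  continuity of the norm and only enlarges the final constant.\<close>

lemma asymp_le_L2_sq:
  assumes F: "L2_tendsto U F f" and h: "in_L2 U h"
  shows "asymp_le (\<lambda>n. L2_sq U (\<lambda>x. h x - F n x)) (2 * L2_sq U (\<lambda>x. h x - f x))"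
proof -
  have "L2_sq U (\<lambda>x. h x - F n x) \<le> 2 * L2_sq U (\<lambda>x. h x - f x) + 2 * L2_sq U (\<lambda>x. F n x - f x)" for n
    using in_L2_diff(2)[of U "\<lambda>x. h x - f x" "\<lambda>x. F n x - f x"] F h
    by (simp add: L2_tendsto_def in_L2_diff)
  moreover have "(\<lambda>n. 2 * L2_sq U (\<lambda>x. h x - f x) + 2 * L2_sq U (\<lambda>x. F n x - f x)) \<longlonglongrightarrow>
      2 * L2_sq U (\<lambda>x. h x - f x)"
    using F unfolding L2_tendsto_def by (auto intro!: tendsto_eq_intros)
  ultimately show ?thesis
    by (rule asymp_leI)
qed

lemma asymp_le_faces:
  assumes "\<forall>(S, \<iota>)\<in>set \<Gamma>. L2_tendsto S (\<lambda>n. F n \<circ> \<iota>) (f \<circ> \<iota>) \<and> in_L2 S (h \<circ> \<iota>)"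
  shows "asymp_le (\<lambda>n. faces_L2_sq \<Gamma> (\<lambda>x. h x - F n x)) (2 * faces_L2_sq \<Gamma> (\<lambda>x. h x - f x))"
  using assms
proof (induction \<Gamma>)
  case Nil
  then show ?case by (auto simp: asymp_le_def faces_L2_sq_def)
next
  case (Cons \<Phi> \<Gamma>)
  obtain S \<iota> where \<Phi>: "\<Phi> = (S, \<iota>)" by (cases \<Phi>)
  have "asymp_le (\<lambda>n. L2_sq S (\<lambda>x. (h \<circ> \<iota>) x - (F n \<circ> \<iota>) x)) (2 * L2_sq S (\<lambda>x. (h \<circ> \<iota>) x - (f \<circ> \<iota>) x))"
    using Cons.prems by (intro asymp_le_L2_sq) (auto simp: \<Phi>)
  from asymp_le_add[OF this Cons.IH] Cons.prems show ?case
    by (simp add: faces_L2_sq_def \<Phi> comp_def)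
qed

lemma set_integrable_in_L2: "in_L2 U f \<Longrightarrow> set_integrable lborel U (\<lambda>x. (f x)\<^sup>2)"
  by (simp add: in_L2_def)

lemma faces_integral_sum_squares:
  assumes "\<forall>(S, \<iota>)\<in>set \<Gamma>. \<forall>f\<in>{f1, f2, f3, f4}. in_L2 S (f \<circ> \<iota>)"
  shows "faces_integral \<Gamma> (\<lambda>z. (f1 z)\<^sup>2 + (f2 z)\<^sup>2 + (f3 z)\<^sup>2 + (f4 z)\<^sup>2) =
    faces_L2_sq \<Gamma> f1 + faces_L2_sq \<Gamma> f2 + faces_L2_sq \<Gamma> f3 + faces_L2_sq \<Gamma> f4"
  using assms
proof (induction \<Gamma>)
  case Nil
  then show ?case by (simp add: faces_integral_def faces_L2_sq_def)
next
  case (Cons \<Phi> \<Gamma>)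
  obtain S \<iota> where \<Phi>: "\<Phi> = (S, \<iota>)" by (cases \<Phi>)
  have i: "set_integrable lborel S (\<lambda>q. (f (\<iota> q))\<^sup>2)" if "f \<in> {f1, f2, f3, f4}" for f
    using set_integrable_in_L2[of S "f \<circ> \<iota>"] Cons.prems that by (auto simp: \<Phi> comp_def)
  then show ?case
    using Cons by (simp add: faces_integral_def faces_L2_sq_def \<Phi> L2_sq_def set_integral_add(2) set_integral_add(1))
qed

lemma L2_tendsto_divide: "L2_tendsto U F f \<Longrightarrow> L2_tendsto U (\<lambda>n x. F n x / c) (\<lambda>x. f x / c)"
  using L2_tendsto_cmult[of U F f "1 / c"] by simp

lemma L2_tendsto_cos:
  "L2_tendsto U F f \<Longrightarrow> L2_tendsto U (\<lambda>n z. cos (snd (snd z)) * F n z) (\<lambda>z :: txv. cos (snd (snd z)) * f z)"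
  by (rule L2_tendsto_bounded_mult[where B = 1]) (auto intro!: borel_measurable_continuous_onI continuous_intros)

lemma L2_tendsto_sin:
  "L2_tendsto U F f \<Longrightarrow> L2_tendsto U (\<lambda>n z. sin (snd (snd z)) * F n z) (\<lambda>z :: txv. sin (snd (snd z)) * f z)"
  by (rule L2_tendsto_bounded_mult[where B = 1]) (auto intro!: borel_measurable_continuous_onI continuous_intros)

section \<open>Smooth approximation of the exact solution\<close>

lemma weak_deriv_in_L2: "in_H1 U f \<Longrightarrow> b \<in> Basis \<Longrightarrow> in_L2 U (weak_deriv U b f)"
  unfolding in_H1_def weak_deriv_def by (metis (mono_tags, lifting) someI_ex)

text \<open>Convergence inside, of first derivatives and on all faces must hold for one and the same
  sequence, because residuals and boundary values of the same smooth tuple enter the estimate. The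
  limits of the derivatives are the representatives \<open>weak_deriv\<close> in which the system is
  stated.\<close>

lemma trace_sequence:
  fixes f :: "'a::euclidean_space \<Rightarrow> real" and \<Gamma> :: "('b::euclidean_space set \<times> ('b \<Rightarrow> 'a)) list"
  assumes f: "in_H1 U f" "has_trace_values U \<Gamma> f" and U: "bounded U" "U \<in> sets borel"
    and \<Gamma>: "\<forall>(F, \<iota>)\<in>set \<Gamma>. bounded F \<and> F \<in> sets borel \<and> continuous_on UNIV \<iota>"
  shows "\<exists>X. (\<forall>n. C1 (X n)) \<and> L2_tendsto U X f \<and>
      (\<forall>b\<in>Basis. L2_tendsto U (\<lambda>n. pd b (X n)) (weak_deriv U b f)) \<and>
      (\<forall>(F, \<iota>)\<in>set \<Gamma>. L2_tendsto F (\<lambda>n. X n \<circ> \<iota>) (f \<circ> \<iota>))"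
proof -
  from f(2) obtain X where X: "\<forall>n. smooth (X n)" "(\<lambda>n. L2_dist_sq U (X n) f) \<longlonglongrightarrow> 0"
    "\<forall>b\<in>Basis. (\<lambda>n. L2_dist_sq U (partial_deriv b (X n)) (weak_deriv U b f)) \<longlonglongrightarrow> 0"
    "\<forall>(F, \<iota>)\<in>set \<Gamma>. (\<lambda>n. L2_dist_sq F (X n \<circ> \<iota>) (f \<circ> \<iota>)) \<longlonglongrightarrow> 0"
    and tr: "\<forall>(F, \<iota>)\<in>set \<Gamma>. in_L2 F (f \<circ> \<iota>)"
    unfolding has_trace_values_def by blast
  have C1: "C1 (X n)" for n using X(1) smooth_imp_C1 by blast
  show ?thesis
  proof (intro exI[of _ X] conjI)
    show "\<forall>n. C1 (X n)" using C1 by (rule allI)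
    show "L2_tendsto U X f"
      using X(2) f(1) C1 U by (auto simp: L2_tendsto_def L2_dist_sq_eq in_H1_def intro: in_L2_continuous C1_continuous)
    show "\<forall>b\<in>Basis. L2_tendsto U (\<lambda>n. pd b (X n)) (weak_deriv U b f)"
      using X(3) weak_deriv_in_L2[OF f(1)] in_L2_continuous[OF C1_continuous_partials[OF C1] U]
      by (auto simp: L2_tendsto_def L2_dist_sq_eq)
    show "\<forall>(F, \<iota>)\<in>set \<Gamma>. L2_tendsto F (\<lambda>n. X n \<circ> \<iota>) (f \<circ> \<iota>)"
    proof clarify
      fix F \<iota> assume F: "(F, \<iota>) \<in> set \<Gamma>"
      have "in_L2 F (X n \<circ> \<iota>)" for n
        using \<Gamma> F unfolding comp_def
        by (intro in_L2_continuous continuous_on_UNIV_compose[OF C1_continuous[OF C1]]) auto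
      then show "L2_tendsto F (\<lambda>n. X n \<circ> \<iota>) (f \<circ> \<iota>)"
        using X(4) tr F by (auto simp: L2_tendsto_def L2_dist_sq_eq)
    qed
  qed
qed

definition parity_diff :: "parity \<Rightarrow> parity \<Rightarrow> parity" where
  "parity_diff v u = \<lparr>rho_c = (\<lambda>p. rho_c v p - rho_c u p), w_c = (\<lambda>z. w_c v z - w_c u z),
     phi_c = (\<lambda>z. phi_c v z - phi_c u z), j1_c = (\<lambda>z. j1_c v z - j1_c u z), j2_c = (\<lambda>z. j2_c v z - j2_c u z)\<rparr>"

lemma parity_diff_sel [simp]:
  "rho_c (parity_diff v u) = (\<lambda>p. rho_c v p - rho_c u p)"
  "w_c (parity_diff v u) = (\<lambda>z. w_c v z - w_c u z)"
  "phi_c (parity_diff v u) = (\<lambda>z. phi_c v z - phi_c u z)"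
  "j1_c (parity_diff v u) = (\<lambda>z. j1_c v z - j1_c u z)"
  "j2_c (parity_diff v u) = (\<lambda>z. j2_c v z - j2_c u z)"
  by (simp_all add: parity_diff_def)

text \<open>Linearity of the system. Derivatives split by differentiability, and the average by
  continuity of both fluxes, since integrals are additive on integrable functions.\<close>

lemma smooth_parity_diff:
  assumes v: "smooth_parity T a b \<epsilon> v" and u: "smooth_parity T a b \<epsilon> u"
  shows "smooth_parity T a b \<epsilon> (parity_diff v u)"
    and "d1 pd pd (parity_diff v u) = (\<lambda>p. d1 pd pd v p - d1 pd pd u p)"
    and "d2 \<epsilon> pd (parity_diff v u) = (\<lambda>z. d2 \<epsilon> pd v z - d2 \<epsilon> pd u z)"
    and "d3 \<epsilon> pd (parity_diff v u) = (\<lambda>z. d3 \<epsilon> pd v z - d3 \<epsilon> pd u z)"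
    and "d4 \<epsilon> pd pd (parity_diff v u) = (\<lambda>z. d4 \<epsilon> pd pd v z - d4 \<epsilon> pd pd u z)"
    and "d5 \<epsilon> pd pd (parity_diff v u) = (\<lambda>z. d5 \<epsilon> pd pd v z - d5 \<epsilon> pd pd u z)"
    and "reconstruct \<epsilon> (parity_diff v u) = (\<lambda>z. reconstruct \<epsilon> v z - reconstruct \<epsilon> u z)"
proof -
  interpret v: smooth_parity T a b \<epsilon> v by (rule v)
  interpret u: smooth_parity T a b \<epsilon> u by (rule u)
  note C = v.rho u.rho v.w u.w v.phi u.phi v.j1 u.j1 v.j2 u.j2
  show "smooth_parity T a b \<epsilon> (parity_diff v u)"
    by unfold_locales (use v.eps C in \<open>auto intro: C1_diff\<close>)
  have fl: "flux pd (parity_diff v u) z = flux pd v z - flux pd u z" for z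
    by (cases z) (simp add: flux_def partial_deriv_diff C algebra_simps)
  have av: "vavg (\<lambda>\<alpha>. flux pd v (t, x, \<alpha>) - flux pd u (t, x, \<alpha>)) = vavg (\<lambda>\<alpha>. flux pd v (t, x, \<alpha>)) - vavg (\<lambda>\<alpha>. flux pd u (t, x, \<alpha>))" for t x
    using vavg_add[of "\<lambda>\<alpha>. flux pd v (t, x, \<alpha>)" "\<lambda>\<alpha>. (-1) * flux pd u (t, x, \<alpha>)"]
      vavg_cmult[of "-1" "\<lambda>\<alpha>. flux pd u (t, x, \<alpha>)"]
      continuous_on_section[OF v.continuous_flux, of t x] continuous_on_section[OF u.continuous_flux, of t x]
    by (simp add: continuous_on_minus)
  show "d1 pd pd (parity_diff v u) = (\<lambda>p. d1 pd pd v p - d1 pd pd u p)"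
    by (auto simp: fun_eq_iff d1_def fl av partial_deriv_diff C algebra_simps)
  show "d2 \<epsilon> pd (parity_diff v u) = (\<lambda>z. d2 \<epsilon> pd v z - d2 \<epsilon> pd u z)"
    by (auto simp: fun_eq_iff d2_def fl av partial_deriv_diff C algebra_simps)
  show "d3 \<epsilon> pd (parity_diff v u) = (\<lambda>z. d3 \<epsilon> pd v z - d3 \<epsilon> pd u z)"
    by (auto simp: fun_eq_iff d3_def partial_deriv_diff C algebra_simps diff_divide_distrib)
  show "d4 \<epsilon> pd pd (parity_diff v u) = (\<lambda>z. d4 \<epsilon> pd pd v z - d4 \<epsilon> pd pd u z)"
    by (auto simp: fun_eq_iff d4_def partial_deriv_diff C algebra_simps)
  show "d5 \<epsilon> pd pd (parity_diff v u) = (\<lambda>z. d5 \<epsilon> pd pd v z - d5 \<epsilon> pd pd u z)"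
    by (auto simp: fun_eq_iff d5_def partial_deriv_diff C algebra_simps)
  show "reconstruct \<epsilon> (parity_diff v u) = (\<lambda>z. reconstruct \<epsilon> v z - reconstruct \<epsilon> u z)"
    by (auto simp: fun_eq_iff reconstruct_def algebra_simps diff_divide_distrib add_divide_distrib)
qed

context cell
begin

text \<open>The average of the difference agrees with the difference of the averages where both
  sections are integrable, hence almost everywhere, which suffices for \<open>L2_sq\<close>.\<close>

lemma L2_tendsto_vavg:
  assumes F: "L2_tendsto (TDV T a b) F f"
  shows "L2_tendsto (TD T a b) (\<lambda>n p. vavg (\<lambda>\<alpha>. F n (fst p, snd p, \<alpha>))) (\<lambda>p. vavg (\<lambda>\<alpha>. f (fst p, snd p, \<alpha>)))"
proof (rule L2_tendstoI)
  have L: "in_L2 (TDV T a b) (F n)" "in_L2 (TDV T a b) f" "in_L2 (TDV T a b) (\<lambda>z. F n z - f z)" for n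
    using F in_L2_diff(1) by (auto simp: L2_tendsto_def)
  show "in_L2 (TD T a b) (\<lambda>p. vavg (\<lambda>\<alpha>. F n (fst p, snd p, \<alpha>)))" "in_L2 (TD T a b) (\<lambda>p. vavg (\<lambda>\<alpha>. f (fst p, snd p, \<alpha>)))" for n
    using L by (auto intro: in_L2_vavg(2))
  fix n
  have "L2_sq (TD T a b) (\<lambda>p. vavg (\<lambda>\<alpha>. F n (fst p, snd p, \<alpha>)) - vavg (\<lambda>\<alpha>. f (fst p, snd p, \<alpha>))) =
      L2_sq (TD T a b) (\<lambda>p. vavg (\<lambda>\<alpha>. F n (fst p, snd p, \<alpha>) - f (fst p, snd p, \<alpha>)))"
  proof (rule L2_sq_cong_AE)
    show "AE p in lborel. p \<in> TD T a b \<longrightarrow> vavg (\<lambda>\<alpha>. F n (fst p, snd p, \<alpha>)) - vavg (\<lambda>\<alpha>. f (fst p, snd p, \<alpha>)) =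
        vavg (\<lambda>\<alpha>. F n (fst p, snd p, \<alpha>) - f (fst p, snd p, \<alpha>))"
      using in_L2_vavg(1)[OF L(1)[of n]] in_L2_vavg(1)[OF L(2)]
      by eventually_elim (auto simp: vavg_def set_integral_diff right_diff_distrib)
  qed (use L in_L2_vavg(2) in \<open>auto intro!: in_L2_diff(1)\<close>)
  also have "\<dots> \<le> 2 / pi * L2_sq (TDV T a b) (\<lambda>z. F n z - f z)"
    using in_L2_vavg(3)[OF L(3)[of n]] by (simp add: field_simps)
  finally show "L2_sq (TD T a b) (\<lambda>p. vavg (\<lambda>\<alpha>. F n (fst p, snd p, \<alpha>)) - vavg (\<lambda>\<alpha>. f (fst p, snd p, \<alpha>)))
      \<le> 2 / pi * L2_sq (TDV T a b) (\<lambda>z. F n z - f z)" .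
  show "(\<lambda>n. 2 / pi * L2_sq (TDV T a b) (\<lambda>z. F n z - f z)) \<longlonglongrightarrow> 0"
    using F by (auto simp: L2_tendsto_def intro!: tendsto_mult_right_zero)
qed

lemma L2_tendsto_lift:
  assumes F: "L2_tendsto (TD T a b) F f"
  shows "L2_tendsto (TDV T a b) (\<lambda>n z. F n (fst z, fst (snd z))) (\<lambda>z. f (fst z, fst (snd z)))"
proof (rule L2_tendstoI)
  have L: "in_L2 (TD T a b) (F n)" "in_L2 (TD T a b) f" "in_L2 (TD T a b) (\<lambda>z. F n z - f z)" for n
    using F in_L2_diff(1) by (auto simp: L2_tendsto_def)
  show "in_L2 (TDV T a b) (\<lambda>z. F n (fst z, fst (snd z)))" "in_L2 (TDV T a b) (\<lambda>z. f (fst z, fst (snd z)))" for n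
    using L by (auto intro: in_L2_lift)
  show "L2_sq (TDV T a b) (\<lambda>z. F n (fst z, fst (snd z)) - f (fst z, fst (snd z))) \<le> pi / 2 * L2_sq (TD T a b) (\<lambda>z. F n z - f z)" for n
    using in_L2_lift(2)[OF L(3)[of n]] by simp
  show "(\<lambda>n. pi / 2 * L2_sq (TD T a b) (\<lambda>z. F n z - f z)) \<longlonglongrightarrow> 0"
    using F by (auto simp: L2_tendsto_def intro!: tendsto_mult_right_zero)
qed

lemma lateral_faces_regular:
  "\<forall>(F, \<iota>)\<in>set (initial_face a b # lateral_faces T a b). bounded F \<and> F \<in> sets borel \<and> continuous_on UNIV \<iota>"
  "\<forall>(F, \<iota>)\<in>set (map with_angle (initial_face a b # lateral_faces T a b)). bounded F \<and> F \<in> sets borel \<and> continuous_on UNIV \<iota>"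
  by (auto simp: initial_face_def lateral_faces_def with_angle_def bounded_box borel_Times bounded_Times angles_facts
      case_prod_beta' intro!: continuous_intros)

text \<open>The components are approximated independently, so the tuples need satisfy neither the
  system nor the condition on the mean of w. This is enough because every operator in the residuals,
  the angular average included, is continuous from H^1 to L^2. The selector \<open>c\<close> treats
  j1 + j2 and j2 - j1 on the same footing as w and \<phi>.\<close>

lemma exact_solution_approximation:
  assumes eps: "0 < \<epsilon>" "\<epsilon> \<le> 1" and u: "exact_solution T a b \<epsilon> u"
  shows "\<exists>U. (\<forall>n. smooth_parity T a b \<epsilon> (U n))
    \<and> L2_tendsto (TDV T a b) (\<lambda>n. reconstruct \<epsilon> (U n)) (reconstruct \<epsilon> u)
    \<and> L2_tendsto (TD T a b) (\<lambda>n. d1 pd pd (U n)) (d1 (weak_deriv (TD T a b)) (weak_deriv (TDV T a b)) u)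
    \<and> L2_tendsto (TDV T a b) (\<lambda>n. d2 \<epsilon> pd (U n)) (d2 \<epsilon> (weak_deriv (TDV T a b)) u)
    \<and> L2_tendsto (TDV T a b) (\<lambda>n. d3 \<epsilon> pd (U n)) (d3 \<epsilon> (weak_deriv (TDV T a b)) u)
    \<and> L2_tendsto (TDV T a b) (\<lambda>n. d4 \<epsilon> pd pd (U n)) (d4 \<epsilon> (weak_deriv (TD T a b)) (weak_deriv (TDV T a b)) u)
    \<and> L2_tendsto (TDV T a b) (\<lambda>n. d5 \<epsilon> pd pd (U n)) (d5 \<epsilon> (weak_deriv (TD T a b)) (weak_deriv (TDV T a b)) u)
    \<and> (\<forall>F \<iota>. (F, \<iota>) \<in> set (initial_face a b # lateral_faces T a b) \<longrightarrow>
      L2_tendsto F (\<lambda>n q. rho_c (U n) (\<iota> q)) (\<lambda>q. rho_c u (\<iota> q)))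
    \<and> (\<forall>F \<iota> c. (F, \<iota>) \<in> set (map with_angle (initial_face a b # lateral_faces T a b)) \<longrightarrow>
      c \<in> {w_c, phi_c, \<lambda>u z. j1_c u z + j2_c u z, \<lambda>u z. j2_c u z - j1_c u z} \<longrightarrow>
      L2_tendsto F (\<lambda>n q. c (U n) (\<iota> q)) (\<lambda>q. c u (\<iota> q)))"
proof -
  let ?\<Gamma> = "initial_face a b # lateral_faces T a b"
  let ?\<Gamma>' = "map with_angle (initial_face a b # lateral_faces T a b)"
  let ?D3 = "weak_deriv (TD T a b)" and ?D4 = "weak_deriv (TDV T a b)"
  note u' = u[unfolded exact_solution_def]
  note ex = u'[THEN conjunct1] u'[THEN conjunct2, THEN conjunct1]
  have "\<forall>f\<in>{w_c u, phi_c u, j1_c u, j2_c u}. in_H1 (TDV T a b) f \<and> has_trace_values (TDV T a b) ?\<Gamma>' f \<and> periodic_txv T a b f"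
    by (rule u'[THEN conjunct2, THEN conjunct2, THEN conjunct2, THEN conjunct1])
  then have ex': "in_H1 (TDV T a b) f" "has_trace_values (TDV T a b) ?\<Gamma>' f" if "f \<in> {w_c u, phi_c u, j1_c u, j2_c u}" for f
    using that by (auto dest!: bspec[where x = f])
  have seq: "\<exists>X. (\<forall>n. C1 (X n)) \<and> L2_tendsto (TDV T a b) X f \<and>
      (\<forall>e\<in>Basis. L2_tendsto (TDV T a b) (\<lambda>n. pd e (X n)) (?D4 e f)) \<and>
      (\<forall>(F, \<iota>)\<in>set ?\<Gamma>'. L2_tendsto F (\<lambda>n. X n \<circ> \<iota>) (f \<circ> \<iota>))"
    if "f \<in> {w_c u, phi_c u, j1_c u, j2_c u}" for f
    by (rule trace_sequence[OF ex'[OF that] domain_facts(4,3) lateral_faces_regular(2)])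
  obtain R where R: "\<forall>n. C1 (R n)" "L2_tendsto (TD T a b) R (rho_c u)"
    "\<forall>e\<in>Basis. L2_tendsto (TD T a b) (\<lambda>n. pd e (R n)) (?D3 e (rho_c u))"
    "\<forall>(F, \<iota>)\<in>set ?\<Gamma>. L2_tendsto F (\<lambda>n. R n \<circ> \<iota>) (rho_c u \<circ> \<iota>)"
    using trace_sequence[OF ex domain_facts(2,1) lateral_faces_regular(1)]
    by (elim exE conjE) (rule that)
  obtain W where W: "\<forall>n. C1 (W n)" "L2_tendsto (TDV T a b) W (w_c u)"
    "\<forall>e\<in>Basis. L2_tendsto (TDV T a b) (\<lambda>n. pd e (W n)) (?D4 e (w_c u))"
    "\<forall>(F, \<iota>)\<in>set ?\<Gamma>'. L2_tendsto F (\<lambda>n. W n \<circ> \<iota>) (w_c u \<circ> \<iota>)"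
    using seq[of "w_c u", OF insertI1]
    by (elim exE conjE) (rule that)
  obtain P where P: "\<forall>n. C1 (P n)" "L2_tendsto (TDV T a b) P (phi_c u)"
    "\<forall>e\<in>Basis. L2_tendsto (TDV T a b) (\<lambda>n. pd e (P n)) (?D4 e (phi_c u))"
    "\<forall>(F, \<iota>)\<in>set ?\<Gamma>'. L2_tendsto F (\<lambda>n. P n \<circ> \<iota>) (phi_c u \<circ> \<iota>)"
    using seq[of "phi_c u", OF insertI2[OF insertI1]]
    by (elim exE conjE) (rule that)
  obtain J where J: "\<forall>n. C1 (J n)" "L2_tendsto (TDV T a b) J (j1_c u)"
    "\<forall>e\<in>Basis. L2_tendsto (TDV T a b) (\<lambda>n. pd e (J n)) (?D4 e (j1_c u))"
    "\<forall>(F, \<iota>)\<in>set ?\<Gamma>'. L2_tendsto F (\<lambda>n. J n \<circ> \<iota>) (j1_c u \<circ> \<iota>)"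
    using seq[of "j1_c u", OF insertI2[OF insertI2, OF insertI1]]
    by (elim exE conjE) (rule that)
  obtain K where K: "\<forall>n. C1 (K n)" "L2_tendsto (TDV T a b) K (j2_c u)"
    "\<forall>e\<in>Basis. L2_tendsto (TDV T a b) (\<lambda>n. pd e (K n)) (?D4 e (j2_c u))"
    "\<forall>(F, \<iota>)\<in>set ?\<Gamma>'. L2_tendsto F (\<lambda>n. K n \<circ> \<iota>) (j2_c u \<circ> \<iota>)"
    using seq[of "j2_c u", OF insertI2[OF insertI2, OF insertI2, OF insertI1]]
    by (elim exE conjE) (rule that)
  define U where "U n = \<lparr>rho_c = R n, w_c = W n, phi_c = P n, j1_c = J n, j2_c = K n\<rparr>" for n
  have U [simp]: "rho_c (U n) = R n" "w_c (U n) = W n" "phi_c (U n) = P n" "j1_c (U n) = J n" "j2_c (U n) = K n" for n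
    by (simp_all add: U_def)
  note lims = R(2) R(3)[rule_format] W(2) W(3)[rule_format] P(2) P(3)[rule_format] J(2) J(3)[rule_format] K(2) K(3)[rule_format]
  \<comment> \<open>Each residual is a sum of bounded multiples of components and derivatives, so
    its convergence follows the syntax of its definition.\<close>
  note rules = L2_tendsto_add L2_tendsto_diff L2_tendsto_cos L2_tendsto_sin L2_tendsto_divide L2_tendsto_cmult
  have fl: "L2_tendsto (TDV T a b) (\<lambda>n. flux pd (U n)) (flux ?D4 u)"
    unfolding flux_def case_prod_beta' prod.collapse U by (intro rules lims e_Basis)
  note avg = L2_tendsto_vavg[OF fl]
  note lift = L2_tendsto_lift[OF R(2)] L2_tendsto_lift[OF R(3)[rule_format]] L2_tendsto_lift[OF avg, unfolded fst_conv snd_conv]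
  have sp: "smooth_parity T a b \<epsilon> (U n)" for n
    by unfold_locales (use eps R W P J K in auto)
  show ?thesis
  proof (intro exI[of _ U] conjI allI impI sp)
    show "L2_tendsto (TDV T a b) (\<lambda>n. reconstruct \<epsilon> (U n)) (reconstruct \<epsilon> u)"
      unfolding reconstruct_def case_prod_beta' prod.collapse U by (intro rules lims lift e_Basis)
    show "L2_tendsto (TD T a b) (\<lambda>n. d1 pd pd (U n)) (d1 ?D3 ?D4 u)"
      unfolding d1_def case_prod_beta' prod.collapse U by (intro rules lims avg e_Basis)
    show "L2_tendsto (TDV T a b) (\<lambda>n. d2 \<epsilon> pd (U n)) (d2 \<epsilon> ?D4 u)"
      unfolding d2_def case_prod_beta' prod.collapse U by (intro rules lims fl lift e_Basis)
    show "L2_tendsto (TDV T a b) (\<lambda>n. d3 \<epsilon> pd (U n)) (d3 \<epsilon> ?D4 u)"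
      unfolding d3_def case_prod_beta' prod.collapse U by (intro rules lims lift e_Basis)
    show "L2_tendsto (TDV T a b) (\<lambda>n. d4 \<epsilon> pd pd (U n)) (d4 \<epsilon> ?D3 ?D4 u)"
      unfolding d4_def case_prod_beta' prod.collapse U mult.assoc by (intro rules lims lift e_Basis)
    show "L2_tendsto (TDV T a b) (\<lambda>n. d5 \<epsilon> pd pd (U n)) (d5 \<epsilon> ?D3 ?D4 u)"
      unfolding d5_def case_prod_beta' prod.collapse U mult.assoc by (intro rules lims lift e_Basis)
    fix F \<iota> assume "(F, \<iota>) \<in> set ?\<Gamma>"
    then show "L2_tendsto F (\<lambda>n q. rho_c (U n) (\<iota> q)) (\<lambda>q. rho_c u (\<iota> q))"
      using R(4) unfolding comp_def U by blast
  next
    fix F \<iota> and c :: "parity \<Rightarrow> txv \<Rightarrow> real"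
    assume that: "(F, \<iota>) \<in> set ?\<Gamma>'" "c \<in> {w_c, phi_c, \<lambda>u z. j1_c u z + j2_c u z, \<lambda>u z. j2_c u z - j1_c u z}"
    show "L2_tendsto F (\<lambda>n q. c (U n) (\<iota> q)) (\<lambda>q. c u (\<iota> q))"
    proof -
      have "L2_tendsto F (\<lambda>n q. W n (\<iota> q)) (\<lambda>q. w_c u (\<iota> q))" "L2_tendsto F (\<lambda>n q. P n (\<iota> q)) (\<lambda>q. phi_c u (\<iota> q))"
        "L2_tendsto F (\<lambda>n q. J n (\<iota> q)) (\<lambda>q. j1_c u (\<iota> q))" "L2_tendsto F (\<lambda>n q. K n (\<iota> q)) (\<lambda>q. j2_c u (\<iota> q))"
        using W(4) P(4) J(4) K(4) that(1) unfolding comp_def by blast+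
      then show ?thesis
        using that(2) by (auto intro: L2_tendsto_add L2_tendsto_diff)
    qed
  qed
qed

text \<open>The network stays fixed while the approximation runs, so the residuals of the difference
  approach those of the network. The constant is 96 = 24 * 2 * 2: one 2 from splitting the total
  error, the other from \<open>asymp_le_L2_sq\<close>.\<close>

lemma exact_solution_bound:
  assumes eps: "0 < \<epsilon>" "\<epsilon> \<le> 1" and u: "exact_solution T a b \<epsilon> u" and v: "network v"
  shows "L2_sq (TDV T a b) (\<lambda>z. reconstruct \<epsilon> u z - reconstruct \<epsilon> v z) \<le> 96 * exp (3 * T + 1) *
     (L2_sq (TD T a b) (d1 pd pd v) + L2_sq (TDV T a b) (d2 \<epsilon> pd v) + L2_sq (TDV T a b) (d3 \<epsilon> pd v)
        + L2_sq (TDV T a b) (d4 \<epsilon> pd pd v) + L2_sq (TDV T a b) (d5 \<epsilon> pd pd v)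
      + (L2_sq (box a b) (\<lambda>x. rho_c v (0, x) - rho_c u (0, x))
        + \<epsilon>^4 * L2_sq (box a b \<times> angles) (\<lambda>z. w_c v (0, z) - w_c u (0, z))
        + L2_sq (box a b \<times> angles) (\<lambda>z. phi_c v (0, z) - phi_c u (0, z))
        + \<epsilon>\<^sup>2 * L2_sq (box a b \<times> angles) (\<lambda>z. (j1_c v (0, z) + j2_c v (0, z)) - (j1_c u (0, z) + j2_c u (0, z)))
        + \<epsilon>\<^sup>2 * L2_sq (box a b \<times> angles) (\<lambda>z. (j2_c v (0, z) - j1_c v (0, z)) - (j2_c u (0, z) - j1_c u (0, z))))
      + (faces_L2_sq (lateral_faces T a b) (\<lambda>p. rho_c v p - rho_c u p)
        + faces_L2_sq (map with_angle (lateral_faces T a b)) (\<lambda>z. w_c v z - w_c u z)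
        + faces_L2_sq (map with_angle (lateral_faces T a b)) (\<lambda>z. phi_c v z - phi_c u z)
        + faces_L2_sq (map with_angle (lateral_faces T a b)) (\<lambda>z. (j1_c v z + j2_c v z) - (j1_c u z + j2_c u z))
        + faces_L2_sq (map with_angle (lateral_faces T a b)) (\<lambda>z. (j2_c v z - j1_c v z) - (j2_c u z - j1_c u z))))"
    (is "_ \<le> 96 * ?K * (?r1 + ?r2 + ?r3 + ?r4 + ?r5 + (?i1 + _ * ?i2 + ?i3 + _ * ?i4 + _ * ?i5) + (?b1 + ?b2 + ?b3 + ?b4 + ?b5))")
proof -
  let ?D3 = "weak_deriv (TD T a b)" and ?D4 = "weak_deriv (TDV T a b)"
  let ?\<Gamma> = "lateral_faces T a b" and ?\<Gamma>' = "map with_angle (lateral_faces T a b)"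
  obtain U where sU': "\<forall>n. smooth_parity T a b \<epsilon> (U n)"
    and rec: "L2_tendsto (TDV T a b) (\<lambda>n. reconstruct \<epsilon> (U n)) (reconstruct \<epsilon> u)"
    and d: "L2_tendsto (TD T a b) (\<lambda>n. d1 pd pd (U n)) (d1 ?D3 ?D4 u)"
      "L2_tendsto (TDV T a b) (\<lambda>n. d2 \<epsilon> pd (U n)) (d2 \<epsilon> ?D4 u)"
      "L2_tendsto (TDV T a b) (\<lambda>n. d3 \<epsilon> pd (U n)) (d3 \<epsilon> ?D4 u)"
      "L2_tendsto (TDV T a b) (\<lambda>n. d4 \<epsilon> pd pd (U n)) (d4 \<epsilon> ?D3 ?D4 u)"
      "L2_tendsto (TDV T a b) (\<lambda>n. d5 \<epsilon> pd pd (U n)) (d5 \<epsilon> ?D3 ?D4 u)"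
    and tr0: "\<forall>F \<iota>. (F, \<iota>) \<in> set (initial_face a b # ?\<Gamma>) \<longrightarrow>
      L2_tendsto F (\<lambda>n q. rho_c (U n) (\<iota> q)) (\<lambda>q. rho_c u (\<iota> q))"
    and tr0': "\<forall>F \<iota> c. (F, \<iota>) \<in> set (map with_angle (initial_face a b # ?\<Gamma>)) \<longrightarrow>
      c \<in> {w_c, phi_c, \<lambda>u z. j1_c u z + j2_c u z, \<lambda>u z. j2_c u z - j1_c u z} \<longrightarrow>
      L2_tendsto F (\<lambda>n q. c (U n) (\<iota> q)) (\<lambda>q. c u (\<iota> q))"
    using exact_solution_approximation[OF eps u] by (elim exE conjE) (rule that)
  note sU = sU'[rule_format] and tr = tr0[rule_format] and tr' = tr0'[rule_format]
  have sv: "smooth_parity T a b \<epsilon> v"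
    by unfold_locales (use eps v in \<open>auto simp: network_def smooth_imp_C1\<close>)
  interpret v: smooth_parity T a b \<epsilon> v by (rule sv)
  define G where "G n = parity_diff v (U n)" for n
  have sG: "smooth_parity T a b \<epsilon> (G n)" for n
    unfolding G_def by (rule smooth_parity_diff(1)[OF sv sU])
  note Geqs = smooth_parity_diff(2-7)[OF sv sU, folded G_def]
  \<comment> \<open>Positivity of \<epsilon> cancels the factor \<open>\<epsilon>\<^sup>2\<close>
    with which the third equation is stated.\<close>
  have zero: "AE p in lborel. p \<in> TD T a b \<longrightarrow> d1 ?D3 ?D4 u p = 0"
    "AE z in lborel. z \<in> TDV T a b \<longrightarrow> d2 \<epsilon> ?D4 u z = 0 \<and> d3 \<epsilon> ?D4 u z = 0 \<and> d4 \<epsilon> ?D3 ?D4 u z = 0 \<and> d5 \<epsilon> ?D3 ?D4 u z = 0"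
    using u eps by (auto simp: exact_solution_def solves_system_def Let_def)
  have contv: "in_L2 (TD T a b) (d1 pd pd v)" "in_L2 (TDV T a b) (d2 \<epsilon> pd v)" "in_L2 (TDV T a b) (d3 \<epsilon> pd v)"
    "in_L2 (TDV T a b) (d4 \<epsilon> pd pd v)" "in_L2 (TDV T a b) (d5 \<epsilon> pd pd v)" "in_L2 (TDV T a b) (reconstruct \<epsilon> v)"
    using v.continuous_d v.continuous_reconstruct by (auto intro!: in_L2_continuous simp: domain_facts)
  have lim: "in_L2 (TD T a b) (d1 ?D3 ?D4 u)" "in_L2 (TDV T a b) (d2 \<epsilon> ?D4 u)" "in_L2 (TDV T a b) (d3 \<epsilon> ?D4 u)"
    "in_L2 (TDV T a b) (d4 \<epsilon> ?D3 ?D4 u)" "in_L2 (TDV T a b) (d5 \<epsilon> ?D3 ?D4 u)"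
    using d by (auto simp: L2_tendsto_def)
  have res: "asymp_le (\<lambda>n. L2_sq (TD T a b) (d1 pd pd (G n))) (2 * ?r1)"
      "asymp_le (\<lambda>n. L2_sq (TDV T a b) (d2 \<epsilon> pd (G n))) (2 * ?r2)"
      "asymp_le (\<lambda>n. L2_sq (TDV T a b) (d3 \<epsilon> pd (G n))) (2 * ?r3)"
      "asymp_le (\<lambda>n. L2_sq (TDV T a b) (d4 \<epsilon> pd pd (G n))) (2 * ?r4)"
      "asymp_le (\<lambda>n. L2_sq (TDV T a b) (d5 \<epsilon> pd pd (G n))) (2 * ?r5)"
  proof -
    \<comment> \<open>Applied to the residuals of the exact solution, which vanish almost
      everywhere: the limits are then the residuals of the network alone.\<close>
    have "L2_sq S (\<lambda>x. h x - f x) = L2_sq S h"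
      if "AE x in lborel. x \<in> S \<longrightarrow> f x = 0" "in_L2 S h" "in_L2 S f" for S :: "'x::euclidean_space set" and f h
      by (rule L2_sq_cong_AE) (use that in_L2_diff(1) in \<open>auto elim!: eventually_mono\<close>)
    note [simp] = this
    have z: "AE z in lborel. z \<in> TDV T a b \<longrightarrow> d2 \<epsilon> ?D4 u z = 0" "AE z in lborel. z \<in> TDV T a b \<longrightarrow> d3 \<epsilon> ?D4 u z = 0"
      "AE z in lborel. z \<in> TDV T a b \<longrightarrow> d4 \<epsilon> ?D3 ?D4 u z = 0" "AE z in lborel. z \<in> TDV T a b \<longrightarrow> d5 \<epsilon> ?D3 ?D4 u z = 0"
      using zero(2) by (auto elim: eventually_mono)
    show "asymp_le (\<lambda>n. L2_sq (TD T a b) (d1 pd pd (G n))) (2 * ?r1)"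
      using asymp_le_L2_sq[OF d(1) contv(1)] zero(1) contv(1) lim(1) by (simp add: Geqs)
    show "asymp_le (\<lambda>n. L2_sq (TDV T a b) (d2 \<epsilon> pd (G n))) (2 * ?r2)"
      using asymp_le_L2_sq[OF d(2) contv(2)] z(1) contv(2) lim(2) by (simp add: Geqs)
    show "asymp_le (\<lambda>n. L2_sq (TDV T a b) (d3 \<epsilon> pd (G n))) (2 * ?r3)"
      using asymp_le_L2_sq[OF d(3) contv(3)] z(2) contv(3) lim(3) by (simp add: Geqs)
    show "asymp_le (\<lambda>n. L2_sq (TDV T a b) (d4 \<epsilon> pd pd (G n))) (2 * ?r4)"
      using asymp_le_L2_sq[OF d(4) contv(4)] z(3) contv(4) lim(4) by (simp add: Geqs)
    show "asymp_le (\<lambda>n. L2_sq (TDV T a b) (d5 \<epsilon> pd pd (G n))) (2 * ?r5)"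
      using asymp_le_L2_sq[OF d(5) contv(5)] z(4) contv(5) lim(5) by (simp add: Geqs)
  qed
  note Gsel = G_def parity_diff_sel
  have vL2: "in_L2 F (\<lambda>q. rho_c v (\<iota> q))" if "(F, \<iota>) \<in> set (initial_face a b # ?\<Gamma>)" for F \<iota>
    using lateral_faces_regular(1) that by (intro in_L2_continuous v.continuous_component) auto
  have vL2': "in_L2 F (\<lambda>q. c v (\<iota> q))" if "(F, \<iota>) \<in> set (map with_angle (initial_face a b # ?\<Gamma>))"
    "c \<in> {w_c, phi_c, \<lambda>u z. j1_c u z + j2_c u z, \<lambda>u z. j2_c u z - j1_c u z}" for F \<iota> c
  proof -
    have i: "continuous_on UNIV \<iota>" "bounded F" "F \<in> sets borel"
      using lateral_faces_regular(2) that(1) by blast+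
    have "continuous_on UNIV (\<lambda>q. w_c v (\<iota> q))" "continuous_on UNIV (\<lambda>q. phi_c v (\<iota> q))"
      "continuous_on UNIV (\<lambda>q. j1_c v (\<iota> q) + j2_c v (\<iota> q))" "continuous_on UNIV (\<lambda>q. j2_c v (\<iota> q) - j1_c v (\<iota> q))"
      using i(1) by (auto intro!: continuous_intros v.continuous_component)
    then have "continuous_on UNIV (\<lambda>q. c v (\<iota> q))"
      using that(2) by auto
    then show ?thesis using i by (intro in_L2_continuous)
  qed
  have ini: "asymp_le (\<lambda>n. L2_sq (box a b) (\<lambda>x. rho_c (G n) (0, x))) (2 * ?i1)"
  proof -
    have f0: "(box a b, \<lambda>x. (0, x)) \<in> set (initial_face a b # ?\<Gamma>)"
      by (simp add: initial_face_def)
    show ?thesis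
      using asymp_le_L2_sq[OF tr[OF f0] vL2[OF f0]] by (simp add: Gsel)
  qed
  have face0: "(box a b \<times> angles, \<lambda>z. (0, z)) \<in> set (map with_angle (initial_face a b # ?\<Gamma>))"
    by (simp add: with_angle_def initial_face_def case_prod_beta')
  have ini': "asymp_le (\<lambda>n. L2_sq (box a b \<times> angles) (\<lambda>z. c v (0, z) - c (U n) (0, z)))
      (2 * L2_sq (box a b \<times> angles) (\<lambda>z. c v (0, z) - c u (0, z)))"
    if "c \<in> {w_c, phi_c, \<lambda>u z. j1_c u z + j2_c u z, \<lambda>u z. j2_c u z - j1_c u z}" for c
    by (rule asymp_le_L2_sq[OF tr'[OF face0 that] vL2'[OF face0 that]])
  have bd: "asymp_le (\<lambda>n. faces_L2_sq ?\<Gamma> (rho_c (G n))) (2 * ?b1)"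
    unfolding Gsel using tr vL2 by (intro asymp_le_faces) (auto simp: comp_def)
  have bd': "asymp_le (\<lambda>n. faces_L2_sq ?\<Gamma>' (\<lambda>z. c v z - c (U n) z)) (2 * faces_L2_sq ?\<Gamma>' (\<lambda>z. c v z - c u z))"
    if "c \<in> {w_c, phi_c, \<lambda>u z. j1_c u z + j2_c u z, \<lambda>u z. j2_c u z - j1_c u z}" for c
  proof (rule asymp_le_faces, clarify)
    fix S \<iota> assume "(S, \<iota>) \<in> set ?\<Gamma>'"
    then have "(S, \<iota>) \<in> set (map with_angle (initial_face a b # ?\<Gamma>))" by simp
    from tr'[OF this that] vL2'[OF this that]
    show "L2_tendsto S (\<lambda>n. c (U n) \<circ> \<iota>) (c u \<circ> \<iota>) \<and> in_L2 S (c v \<circ> \<iota>)"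
      by (simp add: comp_def)
  qed
  let ?S = "\<lambda>n. L2_sq (TD T a b) (d1 pd pd (G n)) + L2_sq (TDV T a b) (d2 \<epsilon> pd (G n)) + L2_sq (TDV T a b) (d3 \<epsilon> pd (G n))
        + L2_sq (TDV T a b) (d4 \<epsilon> pd pd (G n)) + L2_sq (TDV T a b) (d5 \<epsilon> pd pd (G n))
      + (L2_sq (box a b) (\<lambda>x. rho_c (G n) (0, x)) + \<epsilon>^4 * L2_sq (box a b \<times> angles) (\<lambda>z. w_c (G n) (0, z))
        + L2_sq (box a b \<times> angles) (\<lambda>z. phi_c (G n) (0, z)) + \<epsilon>\<^sup>2 * L2_sq (box a b \<times> angles) (\<lambda>z. j1_c (G n) (0, z) + j2_c (G n) (0, z))
        + \<epsilon>\<^sup>2 * L2_sq (box a b \<times> angles) (\<lambda>z. j2_c (G n) (0, z) - j1_c (G n) (0, z)))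
      + (faces_L2_sq ?\<Gamma> (rho_c (G n)) + faces_L2_sq ?\<Gamma>' (w_c (G n)) + faces_L2_sq ?\<Gamma>' (phi_c (G n))
        + faces_L2_sq ?\<Gamma>' (\<lambda>z. j1_c (G n) z + j2_c (G n) z) + faces_L2_sq ?\<Gamma>' (\<lambda>z. j2_c (G n) z - j1_c (G n) z))"
  let ?L = "2 * ?r1 + 2 * ?r2 + 2 * ?r3 + 2 * ?r4 + 2 * ?r5
      + (2 * ?i1 + \<epsilon>^4 * (2 * ?i2) + 2 * ?i3 + \<epsilon>\<^sup>2 * (2 * ?i4) + \<epsilon>\<^sup>2 * (2 * ?i5))
      + (2 * ?b1 + 2 * ?b2 + 2 * ?b3 + 2 * ?b4 + 2 * ?b5)"
  have jeq: "j1_c (G n) z + j2_c (G n) z = (j1_c v z + j2_c v z) - (j1_c (U n) z + j2_c (U n) z)"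
    "j2_c (G n) z - j1_c (G n) z = (j2_c v z - j1_c v z) - (j2_c (U n) z - j1_c (U n) z)"
    for n z
    by (simp_all add: Gsel)
  have feq: "w_c (G n) = (\<lambda>z. w_c v z - w_c (U n) z)" "phi_c (G n) = (\<lambda>z. phi_c v z - phi_c (U n) z)" for n
    by (simp_all add: Gsel)
  have i2: "asymp_le (\<lambda>n. L2_sq (box a b \<times> angles) (\<lambda>z. w_c (G n) (0, z))) (2 * ?i2)"
    using ini'[of w_c] by (simp add: feq)
  have i3: "asymp_le (\<lambda>n. L2_sq (box a b \<times> angles) (\<lambda>z. phi_c (G n) (0, z))) (2 * ?i3)"
    using ini'[of phi_c] by (simp add: feq)
  have i4: "asymp_le (\<lambda>n. L2_sq (box a b \<times> angles) (\<lambda>z. j1_c (G n) (0, z) + j2_c (G n) (0, z))) (2 * ?i4)"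
    unfolding jeq using ini'[of "\<lambda>u z. j1_c u z + j2_c u z"] by simp
  have i5: "asymp_le (\<lambda>n. L2_sq (box a b \<times> angles) (\<lambda>z. j2_c (G n) (0, z) - j1_c (G n) (0, z))) (2 * ?i5)"
    unfolding jeq using ini'[of "\<lambda>u z. j2_c u z - j1_c u z"] by simp
  have b2: "asymp_le (\<lambda>n. faces_L2_sq ?\<Gamma>' (w_c (G n))) (2 * ?b2)"
    unfolding feq using bd'[of w_c] by simp
  have b3: "asymp_le (\<lambda>n. faces_L2_sq ?\<Gamma>' (phi_c (G n))) (2 * ?b3)"
    unfolding feq using bd'[of phi_c] by simp
  have b4: "asymp_le (\<lambda>n. faces_L2_sq ?\<Gamma>' (\<lambda>z. j1_c (G n) z + j2_c (G n) z)) (2 * ?b4)"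
    unfolding jeq using bd'[of "\<lambda>u z. j1_c u z + j2_c u z"] by simp
  have b5: "asymp_le (\<lambda>n. faces_L2_sq ?\<Gamma>' (\<lambda>z. j2_c (G n) z - j1_c (G n) z)) (2 * ?b5)"
    unfolding jeq using bd'[of "\<lambda>u z. j2_c u z - j1_c u z"] by simp
  have S: "asymp_le ?S ?L"
    by (intro asymp_le_add asymp_le_mult res ini i2 i3 i4 i5 bd b2 b3 b4 b5) simp_all
  have R: "asymp_le (\<lambda>n. L2_sq (TDV T a b) (\<lambda>z. reconstruct \<epsilon> (U n) z - reconstruct \<epsilon> u z)) 0"
    using rec by (intro asymp_leI[of _ "\<lambda>n. L2_sq (TDV T a b) (\<lambda>z. reconstruct \<epsilon> (U n) z - reconstruct \<epsilon> u z)"])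
      (auto simp: L2_tendsto_def)
  \<comment> \<open>The left-hand side does not depend on n, so it is bounded by the limit of any
    majorant; the distance of the approximation to u contributes 0.\<close>
  have "L2_sq (TDV T a b) (\<lambda>z. reconstruct \<epsilon> u z - reconstruct \<epsilon> v z) \<le> 2 * 0 + 2 * (24 * ?K * ?L)"
  proof (rule asymp_le_const)
    show "asymp_le (\<lambda>n. 2 * L2_sq (TDV T a b) (\<lambda>z. reconstruct \<epsilon> (U n) z - reconstruct \<epsilon> u z) + 2 * (24 * ?K * ?S n))
        (2 * 0 + 2 * (24 * ?K * ?L))"
      by (intro asymp_le_add[OF asymp_le_mult[OF _ R] asymp_le_mult[OF _ asymp_le_mult[OF _ S]]]) simp_all
    fix n
    have L: "in_L2 (TDV T a b) (reconstruct \<epsilon> (U n))" "in_L2 (TDV T a b) (reconstruct \<epsilon> u)"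
      using rec by (auto simp: L2_tendsto_def)
    have "L2_sq (TDV T a b) (\<lambda>z. reconstruct \<epsilon> u z - reconstruct \<epsilon> v z) =
        L2_sq (TDV T a b) (\<lambda>z. (reconstruct \<epsilon> v z - reconstruct \<epsilon> (U n) z) + (reconstruct \<epsilon> (U n) z - reconstruct \<epsilon> u z))"
      by (simp add: L2_sq_def power2_commute)
    also have "\<dots> \<le> 2 * L2_sq (TDV T a b) (reconstruct \<epsilon> (G n)) +
        2 * L2_sq (TDV T a b) (\<lambda>z. reconstruct \<epsilon> (U n) z - reconstruct \<epsilon> u z)"
      using in_L2_add(2)[OF in_L2_diff(1)[OF contv(6) L(1)] in_L2_diff(1)[OF L]] by (simp add: Geqs)
    also have "L2_sq (TDV T a b) (reconstruct \<epsilon> (G n)) \<le> 24 * ?K * ?S n"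
      by (rule smooth_parity.smooth_bound[OF sG])
    finally show "L2_sq (TDV T a b) (\<lambda>z. reconstruct \<epsilon> u z - reconstruct \<epsilon> v z)
      \<le> 2 * L2_sq (TDV T a b) (\<lambda>z. reconstruct \<epsilon> (U n) z - reconstruct \<epsilon> u z) + 2 * (24 * ?K * ?S n)"
      by simp
  qed
  also have "2 * 0 + 2 * (24 * ?K * ?L) = 96 * ?K * (?r1 + ?r2 + ?r3 + ?r4 + ?r5 + (?i1 + \<epsilon>^4 * ?i2 + ?i3 + \<epsilon>\<^sup>2 * ?i4 + \<epsilon>\<^sup>2 * ?i5) + (?b1 + ?b2 + ?b3 + ?b4 + ?b5))"
    by (simp add: algebra_simps)
  finally show ?thesis .
qed

text \<open>The risk integrates a sum of squares over a face, while the estimate has a sum of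
  integrals. Splitting one into the other requires each trace difference to be square
  integrable.\<close>

lemma trace_difference_in_L2:
  assumes eps: "0 < \<epsilon>" "\<epsilon> \<le> 1" and u: "exact_solution T a b \<epsilon> u" and v: "network v"
    and F: "(F, \<iota>) \<in> set (map with_angle (initial_face a b # lateral_faces T a b))"
    and c: "c \<in> {w_c, phi_c, \<lambda>u z. j1_c u z + j2_c u z, \<lambda>u z. j2_c u z - j1_c u z}"
  shows "in_L2 F (\<lambda>q. c v (\<iota> q) - c u (\<iota> q))"
proof -
  have i: "continuous_on UNIV \<iota>" "bounded F" "F \<in> sets borel"
    using lateral_faces_regular(2) F by blast+
  have "continuous_on UNIV (\<lambda>q. w_c v (\<iota> q))" "continuous_on UNIV (\<lambda>q. phi_c v (\<iota> q))"
    "continuous_on UNIV (\<lambda>q. j1_c v (\<iota> q))" "continuous_on UNIV (\<lambda>q. j2_c v (\<iota> q))"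
    using v i(1) by (auto simp: network_def intro: continuous_on_UNIV_compose C1_continuous smooth_imp_C1)
  then have "continuous_on UNIV (\<lambda>q. c v (\<iota> q))"
    using c by (auto intro!: continuous_intros)
  moreover obtain U where "L2_tendsto F (\<lambda>n q. c (U n) (\<iota> q)) (\<lambda>q. c u (\<iota> q))"
    using exact_solution_approximation[OF eps u] F c by (elim exE conjE) (rule that, iprover)
  ultimately have "in_L2 F (\<lambda>q. c v (\<iota> q))" "in_L2 F (\<lambda>q. c u (\<iota> q))"
    using i by (auto intro: in_L2_continuous simp: L2_tendsto_def)
  then show ?thesis by (rule in_L2_diff(1))
qed

end

section \<open>Normalisation of the risks and the final constant\<close>

lemma set_integral_weighted_squares:
  assumes "in_L2 U f1" "in_L2 U f2" "in_L2 U f3" "in_L2 U f4"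
  shows "(LINT z:U|lborel. k1 * (f1 z)\<^sup>2 + (f2 z)\<^sup>2 + k3 * (f3 z)\<^sup>2 + k4 * (f4 z)\<^sup>2) =
    k1 * L2_sq U f1 + L2_sq U f2 + k3 * L2_sq U f3 + k4 * L2_sq U f4"
  using assms[THEN set_integrable_in_L2]
  by (simp add: L2_sq_def set_integral_add(1) set_integral_add(2))

lemma (in cell) measures_pos:
  "0 < measure lborel (TD T a b)" "0 < measure lborel (TDV T a b)" "0 < measure lborel (box a b)"
  "0 < measure lborel (box a b \<times> angles)" "0 < T * perimeter a b" "0 < T * perimeter a b * measure lborel angles"
proof -
  show b: "0 < measure lborel (box a b)"
    using ab by (simp add: box_ab measure_lborel_Times)
  then show "0 < measure lborel (TD T a b)" "0 < measure lborel (TDV T a b)" "0 < measure lborel (box a b \<times> angles)"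
    using T by (simp_all add: TD_def TDV_def measure_lborel_Times borel_Times angles_facts)
  show "0 < T * perimeter a b" "0 < T * perimeter a b * measure lborel angles"
    using T ab by (simp_all add: perimeter_def angles_facts)
qed

theorem theorem3p2:
  fixes T lam1 lam2 lam3 lam4 :: real and a b :: "real \<times> real"
  assumes "0 < T"
    and "fst a < fst b" and "snd a < snd b"
    and "0 < lam1" and "0 < lam2" and "0 < lam3" and "0 < lam4"
  shows "\<exists>C>0. \<forall>\<epsilon> u v. 0 < \<epsilon> \<and> \<epsilon> \<le> 1 \<longrightarrow> exact_solution T a b \<epsilon> u \<longrightarrow> network v \<longrightarrow>
           R_total T a b \<epsilon> u v \<le> C / \<epsilon> * R_APNN T a b lam1 lam2 lam3 lam4 \<epsilon> u v"
proof -
  interpret cell T a b by unfold_locales (use assms in auto)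
  define m1 m2 m3 m4 m5 m6 where m: "m1 = 1 / measure lborel (TD T a b)" "m2 = 1 / measure lborel (TDV T a b)"
    "m3 = lam1 / measure lborel (box a b)" "m4 = lam2 / measure lborel (box a b \<times> angles)"
    "m5 = lam3 / (T * perimeter a b)" "m6 = lam4 / (T * perimeter a b * measure lborel angles)"
  \<comment> \<open>The smallest normalised penalty. It depends on T, the cell and the weights but
    not on \<epsilon>, and compares all six groups of the risk with the unnormalised sum at
    once.\<close>
  define c where "c = Min {m1, m2, m3, m4, m5, m6}"
  have c: "0 < c" "c \<le> m1" "c \<le> m2" "c \<le> m3" "c \<le> m4" "c \<le> m5" "c \<le> m6"
    using measures_pos assms unfolding c_def by (simp_all add: m)
  show ?thesis
  proof (intro exI[of _ "96 * exp (3 * T + 1) / c"] conjI allI impI)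
    show "0 < 96 * exp (3 * T + 1) / c" using c by simp
    fix \<epsilon> u v
    assume e: "0 < \<epsilon> \<and> \<epsilon> \<le> 1" and u: "exact_solution T a b \<epsilon> u" and v: "network v"
    then have eps: "0 < \<epsilon>" "\<epsilon> \<le> 1" by auto
    let ?\<Gamma> = "lateral_faces T a b" and ?\<Gamma>' = "map with_angle (lateral_faces T a b)"
    let ?w = "\<lambda>z. w_c v z - w_c u z" and ?phi = "\<lambda>z. phi_c v z - phi_c u z"
    let ?P = "\<lambda>z. (j1_c v z + j2_c v z) - (j1_c u z + j2_c u z)" and ?M = "\<lambda>z. (j2_c v z - j1_c v z) - (j2_c u z - j1_c u z)"
    let ?U = "box a b \<times> angles"
    define r1 where "r1 = L2_sq (TD T a b) (d1 pd pd v)"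
    define r2 where "r2 = L2_sq (TDV T a b) (d2 \<epsilon> pd v) + L2_sq (TDV T a b) (d3 \<epsilon> pd v)
      + L2_sq (TDV T a b) (d4 \<epsilon> pd pd v) + L2_sq (TDV T a b) (d5 \<epsilon> pd pd v)"
    define i1 where "i1 = L2_sq (box a b) (\<lambda>x. rho_c v (0, x) - rho_c u (0, x))"
    define i2 where "i2 = \<epsilon>^4 * L2_sq ?U (\<lambda>z. ?w (0, z)) + L2_sq ?U (\<lambda>z. ?phi (0, z))
      + \<epsilon>\<^sup>2 * L2_sq ?U (\<lambda>z. ?P (0, z)) + \<epsilon>\<^sup>2 * L2_sq ?U (\<lambda>z. ?M (0, z))"
    define b1 where "b1 = faces_L2_sq ?\<Gamma> (\<lambda>p. rho_c v p - rho_c u p)"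
    define b2 where "b2 = faces_L2_sq ?\<Gamma>' ?w + faces_L2_sq ?\<Gamma>' ?phi + faces_L2_sq ?\<Gamma>' ?P + faces_L2_sq ?\<Gamma>' ?M"
    note dfs = r1_def r2_def i1_def i2_def b1_def b2_def
    have fn: "0 \<le> faces_L2_sq \<Gamma> f" for \<Gamma> and f :: "'x \<Rightarrow> real"
      unfolding faces_L2_sq_def by (auto intro!: sum_list_nonneg simp: L2_sq_nonneg)
    have nn: "0 \<le> r1" "0 \<le> r2" "0 \<le> i1" "0 \<le> i2" "0 \<le> b1" "0 \<le> b2"
      by (simp_all add: dfs L2_sq_nonneg fn)
    have face0: "(?U, \<lambda>z. (0, z)) \<in> set (map with_angle (initial_face a b # ?\<Gamma>))"
      by (simp add: with_angle_def initial_face_def case_prod_beta')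
    note tr = trace_difference_in_L2[OF eps u v]
    have L: "in_L2 ?U (\<lambda>z. ?w (0, z))" "in_L2 ?U (\<lambda>z. ?phi (0, z))" "in_L2 ?U (\<lambda>z. ?P (0, z))" "in_L2 ?U (\<lambda>z. ?M (0, z))"
      using tr[OF face0, of w_c] tr[OF face0, of phi_c] tr[OF face0, of "\<lambda>u z. j1_c u z + j2_c u z"]
        tr[OF face0, of "\<lambda>u z. j2_c u z - j1_c u z"] by simp_all
    have "R_residual T a b \<epsilon> v = m1 * r1 + m2 * r2"
      by (simp add: R_residual_def m dfs L2_sq_def)
    moreover have "R_initial a b lam1 lam2 \<epsilon> u v = m3 * i1 + m4 * i2"
      unfolding R_initial_def m i1_def i2_def set_integral_weighted_squares[OF L, symmetric]
      by (simp add: L2_sq_def case_prod_beta')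
    moreover have "R_boundary T a b lam3 lam4 u v = m5 * b1 + m6 * b2"
    proof -
      have "\<forall>(S, \<iota>)\<in>set ?\<Gamma>'. \<forall>f\<in>{?w, ?phi, ?P, ?M}. in_L2 S (f \<circ> \<iota>)"
      proof clarify
        fix S \<iota> f assume S: "(S, \<iota>) \<in> set ?\<Gamma>'" and f: "f \<in> {?w, ?phi, ?P, ?M}"
        then have S': "(S, \<iota>) \<in> set (map with_angle (initial_face a b # ?\<Gamma>))" by simp
        show "in_L2 S (f \<circ> \<iota>)"
          using f tr[OF S', of w_c] tr[OF S', of phi_c] tr[OF S', of "\<lambda>u z. j1_c u z + j2_c u z"]
            tr[OF S', of "\<lambda>u z. j2_c u z - j1_c u z"] unfolding comp_def by auto
      qed
      from faces_integral_sum_squares[OF this] show ?thesis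
        by (simp add: R_boundary_def m b1_def b2_def faces_integral_def faces_L2_sq_def L2_sq_def)
    qed
    ultimately have R: "R_APNN T a b lam1 lam2 lam3 lam4 \<epsilon> u v = m1 * r1 + m2 * r2 + (m3 * i1 + m4 * i2) + (m5 * b1 + m6 * b2)"
      by (simp add: R_APNN_def)
    have le: "c * (r1 + r2 + i1 + i2 + b1 + b2) \<le> R_APNN T a b lam1 lam2 lam3 lam4 \<epsilon> u v"
      using mult_right_mono[OF c(2) nn(1)] mult_right_mono[OF c(3) nn(2)] mult_right_mono[OF c(4) nn(3)]
        mult_right_mono[OF c(5) nn(4)] mult_right_mono[OF c(6) nn(5)] mult_right_mono[OF c(7) nn(6)]
      unfolding R distrib_left by linarith
    have "R_total T a b \<epsilon> u v \<le> 96 * exp (3 * T + 1) * (r1 + r2 + i1 + i2 + b1 + b2)"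
      using exact_solution_bound[OF eps u v] by (simp add: R_total_def L2_dist_sq_eq dfs algebra_simps)
    also have "\<dots> = 96 * exp (3 * T + 1) / c * (c * (r1 + r2 + i1 + i2 + b1 + b2))"
      using c by simp
    also have "\<dots> \<le> 96 * exp (3 * T + 1) / c * R_APNN T a b lam1 lam2 lam3 lam4 \<epsilon> u v"
      using c by (intro mult_left_mono le) auto
    \<comment> \<open>Here \<epsilon> \<le> 1 inserts the factor 1 / \<epsilon>; the risk must be
      nonnegative for this.\<close>
    also have "\<dots> \<le> 96 * exp (3 * T + 1) / c / \<epsilon> * R_APNN T a b lam1 lam2 lam3 lam4 \<epsilon> u v"
    proof (rule mult_right_mono)
      show "0 \<le> R_APNN T a b lam1 lam2 lam3 lam4 \<epsilon> u v"
        using le nn c by (auto intro: order_trans[rotated])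
      show "96 * exp (3 * T + 1) / c \<le> 96 * exp (3 * T + 1) / c / \<epsilon>"
        using eps c by (simp add: pos_le_divide_eq mult_left_le)
    qed
    finally show "R_total T a b \<epsilon> u v \<le> 96 * exp (3 * T + 1) / c / \<epsilon> * R_APNN T a b lam1 lam2 lam3 lam4 \<epsilon> u v" .
  qed
qed

end
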